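(* Let $A_0=\mathbb{C}[t]$, let $D_+,D_-$ be $\mathbb{Q}$-divisors on $\mathbb{A}^1_{\mathbb{C}}=\operatorname{Spec}A_0$ with $D_++D_-\le0$, and let $A=A_0[D_+,D_-]$. Let $d\ge1$ and $e$ be integers with $0\le e<d$ and $\gcd(e,d)=1$. The following conditions are equivalent. (i) $\{-D_+\}=\frac{e}{d}[0]$. (ii) $A\cong(A_{k,P})^{\mathbb{Z}_d}$ as graded $\mathbb{C}[t]$-algebras (with $t=s^d$), where, for an integer $k\ge1$ and a unitary (i.e. monic) polynomial $Q\in\mathbb{C}[t]$, $A_{k,P}$ is the normalization of $$B_{k,P}=\mathbb{C}[s,\tilde u,v]/\left(\tilde u^kv-P(s)\right),\qquad P(s):=Q(s^d)s^{ke},$$ graded via $\deg s=0$, $\deg\tilde u=1$, $\deg v=-k$, and where $\mathbb{Z}_d=\langle\zeta\rangle$ ($\zeta$ a primitive $d$-th root of unity) acts on $A_{k,P}$ via $$\zeta.s=\zeta s,\quad\zeta.\tilde u=\zeta^e\tilde u,\quad\zeta.v=v.$$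
   Context: For a $\mathbb{Q}$-divisor $D=\sum D(a)\,a$, $\lfloor D\rfloor=\sum\lfloor D(a)\rfloor a$ and $\{D\}=D-\lfloor D\rfloor$; $[0]$ is the origin of $\mathbb{A}^1_{\mathbb{C}}$. For $\mathbb{Q}$-divisors with $D_++D_-\le0$, the normal graded $A_0$-algebra $A_0[D_+,D_-]=\bigoplus_{n\in\mathbb{Z}}A_n\subseteq\operatorname{Frac}(A_0)[u,u^{-1}]$ ($u$ an indeterminate of degree $1$) is defined by $A_n=H^0(\mathbb{A}^1_{\mathbb{C}},\mathcal{O}(\lfloor nD_+\rfloor))\cdot u^n$ and $A_{-n}=H^0(\mathbb{A}^1_{\mathbb{C}},\mathcal{O}(\lfloor nD_-\rfloor))\cdot u^{-n}$ for $n\ge0$. The data in (ii) arise as follows when $D_+=-\frac{e}{d}[0]$: $k$ is the smallest positive integer such that $kD_-$ is integral, $Q\in\mathbb{C}[t]$ is a unitary polynomial with $D_-=-\operatorname{div}(Q)/k$, $A_{k,P}$ is the normalization of $A$ in $\operatorname{Frac}(A)[s]$ with $s=\sqrt[d]{t}$, and $\tilde u=s^eu$.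
   Formalization: As stated (i)⇒(ii) fails for D_+=-½[0], D_-=½[0]. Proved: (i) iff (ii) with Q a monic Laurent polynomial for which P is a polynomial; and (ii) with Q∈C[t] iff (i) and (D_+ + D_-)(0) ≤ -e/d. *)

theory Defs
  imports
    "HOL-Algebra.Algebraic_Closure_Type"
    "HOL-Algebra.QuotRing"
    "HOL-Algebra.Polynomials"
    "HOL-Computational_Algebra.Computational_Algebra"
    "HOL-Computational_Algebra.Field_as_Ring"
    "HOL-Library.Poly_Mapping"
begin

section \<open>Divisors on the affine line\<close>

text \<open>The library order on finitely supported functions is lexicographic, so the order of
  divisors is always spelled out pointwise below.\<close>

type_synonym q_divisor = "complex \<Rightarrow>\<^sub>0 rat"

definition div_floor :: "q_divisor \<Rightarrow> (complex \<Rightarrow>\<^sub>0 int)" where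
  "div_floor D = Poly_Mapping.map floor D"

definition div_frac :: "q_divisor \<Rightarrow> q_divisor" where
  "div_frac D = D - Poly_Mapping.map of_int (div_floor D)"

definition div_scale :: "nat \<Rightarrow> q_divisor \<Rightarrow> q_divisor" where
  "div_scale n D = Poly_Mapping.map (\<lambda>c. of_nat n * c) D"

definition ord_at :: "complex \<Rightarrow> complex poly fract \<Rightarrow> int" where
  "ord_at a f = int (order a (fst (quot_of_fract f))) - int (order a (snd (quot_of_fract f)))"

definition global_sections :: "(complex \<Rightarrow>\<^sub>0 int) \<Rightarrow> complex poly fract set" where
  "global_sections E = {f. f = 0 \<or> (\<forall>a. 0 \<le> ord_at a f + Poly_Mapping.lookup E a)}"


section \<open>The graded algebra $A_0[D_+,D_-]$\<close>

text \<open>The Laurent polynomial ring over a ring is its monoid ring over the additive group of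
  integers; \<open>Poly_Mapping.single n f\<close> is $f u^n$.\<close>

type_synonym laurent = "int \<Rightarrow>\<^sub>0 complex poly fract"

definition dpd_coeffs :: "q_divisor \<Rightarrow> q_divisor \<Rightarrow> int \<Rightarrow> complex poly fract set" where
  "dpd_coeffs Dp Dm n =
     (if 0 \<le> n then global_sections (div_floor (div_scale (nat n) Dp))
      else global_sections (div_floor (div_scale (nat (- n)) Dm)))"

definition dpd_component :: "q_divisor \<Rightarrow> q_divisor \<Rightarrow> int \<Rightarrow> laurent set" where
  "dpd_component Dp Dm n = Poly_Mapping.single n ` dpd_coeffs Dp Dm n"

definition dpd_ring :: "q_divisor \<Rightarrow> q_divisor \<Rightarrow> laurent ring" where
  "dpd_ring Dp Dm =
     ring_of_type_algebra \<lparr>carrier := {F. \<forall>n. Poly_Mapping.lookup F n \<in> dpd_coeffs Dp Dm n}\<rparr>"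

definition dpd_struct :: "complex poly \<Rightarrow> laurent" where
  "dpd_struct f = Poly_Mapping.single 0 (to_fract f)"


section \<open>Fraction field and normalization of a domain\<close>

definition frac_rel :: "('a, 'm) ring_scheme \<Rightarrow> (('a \<times> 'a) \<times> ('a \<times> 'a)) set" where
  "frac_rel R = {((a, b), (c, d)).
     a \<in> carrier R \<and> b \<in> carrier R - {\<zero>\<^bsub>R\<^esub>} \<and> c \<in> carrier R \<and> d \<in> carrier R - {\<zero>\<^bsub>R\<^esub>} \<and>
     a \<otimes>\<^bsub>R\<^esub> d = c \<otimes>\<^bsub>R\<^esub> b}"

definition frac_class :: "('a, 'm) ring_scheme \<Rightarrow> 'a \<Rightarrow> 'a \<Rightarrow> ('a \<times> 'a) set" where
  "frac_class R a b = frac_rel R `` {(a, b)}"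

definition frac_field :: "('a, 'm) ring_scheme \<Rightarrow> ('a \<times> 'a) set ring" where
  "frac_field R =
     \<lparr>carrier = (carrier R \<times> (carrier R - {\<zero>\<^bsub>R\<^esub>})) // frac_rel R,
      monoid.mult = (\<lambda>x y. \<Union>p\<in>x. \<Union>q\<in>y. frac_class R (fst p \<otimes>\<^bsub>R\<^esub> fst q) (snd p \<otimes>\<^bsub>R\<^esub> snd q)),
      one = frac_class R \<one>\<^bsub>R\<^esub> \<one>\<^bsub>R\<^esub>,
      ring.zero = frac_class R \<zero>\<^bsub>R\<^esub> \<one>\<^bsub>R\<^esub>,
      add = (\<lambda>x y. \<Union>p\<in>x. \<Union>q\<in>y.
        frac_class R ((fst p \<otimes>\<^bsub>R\<^esub> snd q) \<oplus>\<^bsub>R\<^esub> (fst q \<otimes>\<^bsub>R\<^esub> snd p)) (snd p \<otimes>\<^bsub>R\<^esub> snd q))\<rparr>"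

definition frac_embed :: "('a, 'm) ring_scheme \<Rightarrow> 'a \<Rightarrow> ('a \<times> 'a) set" where
  "frac_embed R a = frac_class R a \<one>\<^bsub>R\<^esub>"

text \<open>Lists of coefficients have the leading coefficient first.\<close>

definition integral_over :: "('a, 'm) ring_scheme \<Rightarrow> 'a set \<Rightarrow> 'a \<Rightarrow> bool" where
  "integral_over K S x \<longleftrightarrow>
     (\<exists>p. p \<noteq> [] \<and> set p \<subseteq> S \<and> hd p = \<one>\<^bsub>K\<^esub> \<and> ring.eval K p x = \<zero>\<^bsub>K\<^esub>)"

definition normalization_ring :: "('a, 'm) ring_scheme \<Rightarrow> ('a \<times> 'a) set ring" where
  "normalization_ring R = (frac_field R)
     \<lparr>carrier := {x \<in> carrier (frac_field R).
        integral_over (frac_field R) (frac_embed R ` carrier R) x}\<rparr>"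


section \<open>The algebras $B_{k,P}$ and $A_{k,P}$\<close>

text \<open>$\mathbb{C}[s,\tilde u,v]$ is $\mathbb{C}[s][\tilde u][v]$: the innermost variable is $s$, the
  outermost is $v$.\<close>

type_synonym poly3 = "complex poly poly poly"

abbreviation poly3_ring :: "poly3 ring" where
  "poly3_ring \<equiv> ring_of_type_algebra"

definition s_const :: "complex poly \<Rightarrow> poly3" where
  "s_const p = [:[:p:]:]"

definition u_var :: poly3 where
  "u_var = [:[:0, 1:]:]"

definition v_var :: poly3 where
  "v_var = [:0, 1:]"

definition B_ideal :: "nat \<Rightarrow> complex poly \<Rightarrow> poly3 set" where
  "B_ideal k P = PIdl\<^bsub>poly3_ring\<^esub> (u_var ^ k * v_var - s_const P)"

definition B_ring :: "nat \<Rightarrow> complex poly \<Rightarrow> poly3 set ring" where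
  "B_ring k P = poly3_ring Quot B_ideal k P"

definition B_class :: "nat \<Rightarrow> complex poly \<Rightarrow> poly3 \<Rightarrow> poly3 set" where
  "B_class k P g = B_ideal k P +>\<^bsub>poly3_ring\<^esub> g"

definition B_component :: "nat \<Rightarrow> complex poly \<Rightarrow> int \<Rightarrow> poly3 set set" where
  "B_component k P n = B_class k P `
     {g. \<forall>j l. coeff (coeff g l) j \<noteq> 0 \<longrightarrow> int j - int k * int l = n}"

definition A_ring :: "nat \<Rightarrow> complex poly \<Rightarrow> (poly3 set \<times> poly3 set) set ring" where
  "A_ring k P = normalization_ring (B_ring k P)"

text \<open>The grading of a graded domain extends to its homogeneous localization, where $b'/b$ with
  $b'$, $b$ homogeneous has degree $\deg b' - \deg b$; the normalization is a graded subring of it.\<close>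

definition A_component :: "nat \<Rightarrow> complex poly \<Rightarrow> int \<Rightarrow> (poly3 set \<times> poly3 set) set set" where
  "A_component k P n = {x \<in> carrier (A_ring k P).
     \<exists>m. \<exists>b \<in> B_component k P m - {\<zero>\<^bsub>B_ring k P\<^esub>}. \<exists>b' \<in> B_component k P (m + n).
       x = frac_class (B_ring k P) b' b}"


section \<open>The cyclic group action and its invariants\<close>

definition primitive_root_of_unity :: "nat \<Rightarrow> complex \<Rightarrow> bool" where
  "primitive_root_of_unity d \<zeta> \<longleftrightarrow> \<zeta> ^ d = 1 \<and> (\<forall>j. 0 < j \<and> j < d \<longrightarrow> \<zeta> ^ j \<noteq> 1)"

text \<open>$g(s,\tilde u,v) \mapsto g(\zeta s, \zeta^e \tilde u, v)$.\<close>

definition poly3_act :: "nat \<Rightarrow> complex \<Rightarrow> poly3 \<Rightarrow> poly3" where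
  "poly3_act e \<zeta> g =
     map_poly (\<lambda>h. pcompose (map_poly (\<lambda>c. pcompose c [:0, \<zeta>:]) h) [:0, [:\<zeta> ^ e:]:]) g"

text \<open>A ring automorphism preserving the ideal induces maps on cosets and on fractions, which
  are just given by taking images of the corresponding sets.\<close>

definition B_act :: "nat \<Rightarrow> complex \<Rightarrow> poly3 set \<Rightarrow> poly3 set" where
  "B_act e \<zeta> b = poly3_act e \<zeta> ` b"

definition A_act :: "nat \<Rightarrow> complex \<Rightarrow> (poly3 set \<times> poly3 set) set \<Rightarrow> (poly3 set \<times> poly3 set) set"
  where "A_act e \<zeta> x = map_prod (B_act e \<zeta>) (B_act e \<zeta>) ` x"

text \<open>Invariance under a cyclic group is invariance under its generator.\<close>

definition inv_ring ::
  "nat \<Rightarrow> complex \<Rightarrow> nat \<Rightarrow> complex poly \<Rightarrow> (poly3 set \<times> poly3 set) set ring" where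
  "inv_ring e \<zeta> k P =
     (A_ring k P)\<lparr>carrier := {x \<in> carrier (A_ring k P). A_act e \<zeta> x = x}\<rparr>"

definition inv_component ::
  "nat \<Rightarrow> complex \<Rightarrow> nat \<Rightarrow> complex poly \<Rightarrow> int \<Rightarrow> (poly3 set \<times> poly3 set) set set" where
  "inv_component e \<zeta> k P n = {x \<in> A_component k P n. A_act e \<zeta> x = x}"

definition subst_power :: "nat \<Rightarrow> complex poly \<Rightarrow> complex poly" where
  "subst_power d f = pcompose f (Polynomial.monom 1 d)"

text \<open>$\mathbb{C}[t]$ acts through $t = s^d$.\<close>

definition inv_struct ::
  "nat \<Rightarrow> nat \<Rightarrow> complex poly \<Rightarrow> complex poly \<Rightarrow> (poly3 set \<times> poly3 set) set" where
  "inv_struct d k P f =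
     frac_embed (B_ring k P) (B_class k P (s_const (subst_power d f)))"


section \<open>Isomorphisms of graded algebras\<close>

text \<open>A graded \<open>'c\<close>-algebra is given by its ring, its homogeneous components and its structure
  map.\<close>

definition graded_algebra_iso ::
  "('a, 'm) ring_scheme \<Rightarrow> (int \<Rightarrow> 'a set) \<Rightarrow> ('c \<Rightarrow> 'a) \<Rightarrow>
   ('b, 'n) ring_scheme \<Rightarrow> (int \<Rightarrow> 'b set) \<Rightarrow> ('c \<Rightarrow> 'b) \<Rightarrow> bool" where
  "graded_algebra_iso R R_comp R_struct S S_comp S_struct \<longleftrightarrow>
     (\<exists>\<phi> \<in> ring_iso R S. (\<forall>n. \<phi> ` R_comp n = S_comp n) \<and> (\<forall>f. \<phi> (R_struct f) = S_struct f))"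

definition dpd_iso_invariants ::
  "q_divisor \<Rightarrow> q_divisor \<Rightarrow> nat \<Rightarrow> nat \<Rightarrow> complex \<Rightarrow> nat \<Rightarrow> complex poly \<Rightarrow> bool" where
  "dpd_iso_invariants Dp Dm d e \<zeta> k P \<longleftrightarrow>
     graded_algebra_iso
       (dpd_ring Dp Dm) (dpd_component Dp Dm) dpd_struct
       (inv_ring e \<zeta> k P) (inv_component e \<zeta> k P) (inv_struct d k P)"

text \<open>$P(s) = Q(s^d) s^{ke}$ for the Laurent polynomial $Q = q / t^m$, where $q$ is a polynomial;
  part of the condition is that $P$ is a polynomial.

  If $D_+ = - \frac{e}{d} [0]$ and $k D_-$ is integral, then $D_- = - \mathrm{div}(Q) / k$
  defines a monic rational function $Q$ for which $P$ is a polynomial, because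
  $D_-(0) \le \frac{e}{d}$. But $Q$ has a pole at $0$ if $D_-(0) > 0$, and then polynomials $Q$
  do not suffice: for $D_+ = - \frac{1}{2} [0]$, $D_- = \frac{1}{2} [0]$ the algebra
  $A_0[D_+,D_-]$ contains the unit $t u^2$, whereas for $d = 2$, $e = 1$ and a polynomial $Q$ the
  variable $s$ divides $P$, so that the action of the multiplicative group given by the grading
  fixes a point over $s = \tilde u = v = 0$ and $A_{k,P}$ has no unit of non-zero degree.
  Here $k = 2$, $Q = 1 / t$ and $P = 1$ are correct.\<close>

definition P_of_laurent ::
  "nat \<Rightarrow> nat \<Rightarrow> nat \<Rightarrow> complex poly \<Rightarrow> nat \<Rightarrow> complex poly \<Rightarrow> bool" where
  "P_of_laurent d e k q m P \<longleftrightarrow>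
     P * subst_power d (Polynomial.monom 1 m) = subst_power d q * Polynomial.monom 1 (k * e)"

end

theory Submission
  imports Defs
begin

text \<open>The map \<open>s, u, v \<mapsto> s, u, P u\<^sup>-\<^sup>k\<close> identifies \<open>B\<^sub>k\<^sub>,\<^sub>P\<close> with a subring of \<open>\<complex>(s)[u, 1/u]\<close>,
  whose normalization consists of the Laurent polynomials with coefficients in
  \<open>A\<^sub>0[0, -div P / k]\<close>: integral elements are almost integral, and an almost integral element has
  almost integral homogeneous components, for which the condition on the orders is linear;
  conversely a norm over the \<open>k\<close>-th roots of unity gives an integral equation. The element
  \<open>f u\<^sup>n\<close> is invariant iff \<open>s\<^sup>e\<^sup>n f\<close> is a function of \<open>t = s\<^sup>d\<close>, which identifies the ring of
  invariants with \<open>A\<^sub>0[-e/d [0], -div Q / k]\<close>. Finally \<open>A\<^sub>0[D\<^sub>+, D\<^sub>-]\<close> determines \<open>D\<^sub>+ + D\<^sub>-\<close> and the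
  fractional part of \<open>D\<^sub>+\<close>, and only changes by an isomorphism when a principal divisor is moved
  from \<open>D\<^sub>-\<close> to \<open>D\<^sub>+\<close>.\<close>

section \<open>Orders of rational functions\<close>

text \<open>An integral equation does not split into homogeneous parts, whereas almost integrality
  (one \<open>c\<close> with all c z^i in the ring) is a condition on single powers: the top
  components of \<open>c\<close> and of the element can be read off from the products. Degree by
  degree it bounds ord c + i ord x from below by a function that is affine in i for large i, and
  letting i grow isolates the condition on x.

  The number e/d comes from ramification: t = s^d has index d over 0 and index 1 elsewhere, so the
  order -en at s = 0 that the substitution u = s^-e u' introduces in degree n counts as -en/d in
  terms of t.

  The divisor sum also controls the form of Q: in every presentation -ord_0(Q)/k is the value of D_+
  + D_- at 0 plus e/d, so the sign of this number decides whether Q can be a polynomial.\<close>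

lemma ord_at_Fract:
  assumes "p \<noteq> 0" "q \<noteq> 0"
  shows "ord_at a (Fract p q) = int (Polynomial.order a p) - int (Polynomial.order a q)"
proof -
  obtain p' q' where pq: "quot_of_fract (Fract p q) = (p', q')" by force
  have q': "q' \<noteq> 0" using snd_quot_of_fract_nonzero[of "Fract p q"] pq by simp
  have eq: "Fract p' q' = Fract p q" using Fract_quot_of_fract[of "Fract p q"] pq by simp
  hence e: "p' * q = p * q'" using q' assms by (simp add: eq_fract)
  hence p': "p' \<noteq> 0" using assms q' by auto
  have "Polynomial.order a (p' * q) = Polynomial.order a (p * q')" using e by simp
  hence "Polynomial.order a p' + Polynomial.order a q = Polynomial.order a p + Polynomial.order a q'"
    using assms p' q' by (simp add: order_mult)
  thus ?thesis unfolding ord_at_def pq by simp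
qed

lemma ord_at_to_fract: "ord_at a (to_fract p) = int (Polynomial.order a p)"
  by (simp add: ord_at_def)

lemma fract_cases_nonzero:
  fixes f :: "'a :: idom fract"
  assumes "f \<noteq> 0"
  obtains p q where "f = Fract p q" "p \<noteq> 0" "q \<noteq> 0"
proof -
  obtain p q where "f = Fract p q" "q \<noteq> 0" by (cases f) auto
  with assms show ?thesis by (intro that[of p q]) (auto simp: fract_collapse)
qed

lemma ord_at_mult:
  assumes "f \<noteq> 0" "g \<noteq> 0"
  shows "ord_at a (f * g) = ord_at a f + ord_at a g"
proof -
  obtain p q where f: "f = Fract p q" "p \<noteq> 0" "q \<noteq> 0" using assms by (elim fract_cases_nonzero)
  obtain r s where g: "g = Fract r s" "r \<noteq> 0" "s \<noteq> 0" using assms by (elim fract_cases_nonzero)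
  have "f * g = Fract (p * r) (q * s)" using f g by simp
  thus ?thesis using f g by (simp add: ord_at_Fract order_mult)
qed

lemma ord_at_one [simp]: "ord_at a 1 = 0"
  by (simp add: ord_at_def)

lemma ord_at_inverse:
  assumes "f \<noteq> 0"
  shows "ord_at a (inverse f) = - ord_at a f"
proof -
  have "ord_at a (f * inverse f) = ord_at a f + ord_at a (inverse f)"
    using assms by (intro ord_at_mult) auto
  thus ?thesis using assms by simp
qed

lemma ord_at_divide:
  assumes "f \<noteq> 0" "g \<noteq> 0"
  shows "ord_at a (f / g) = ord_at a f - ord_at a g"
  using assms by (simp add: divide_inverse ord_at_mult ord_at_inverse)

lemma ord_at_power:
  assumes "f \<noteq> 0"
  shows "ord_at a (f ^ n) = int n * ord_at a f"
  using assms by (induction n) (auto simp: ord_at_mult algebra_simps)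

lemma ord_at_powi:
  assumes "f \<noteq> 0"
  shows "ord_at a (f powi n) = n * ord_at a f"
  using assms by (auto simp: power_int_def ord_at_power ord_at_inverse power_inverse[symmetric])

lemma ord_at_add_ge:
  assumes "f \<noteq> 0" "g \<noteq> 0" "f + g \<noteq> 0" "n \<le> ord_at a f" "n \<le> ord_at a g"
  shows "n \<le> ord_at a (f + g)"
proof -
  obtain p q where f: "f = Fract p q" "p \<noteq> 0" "q \<noteq> 0" using assms by (elim fract_cases_nonzero)
  obtain r s where g: "g = Fract r s" "r \<noteq> 0" "s \<noteq> 0" using assms by (elim fract_cases_nonzero)
  have fg: "f + g = Fract (p * s + r * q) (q * s)" using f g by simp
  have nz: "p * s + r * q \<noteq> 0" using assms(3) fg f g by (auto simp: fract_collapse)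
  \<comment> \<open>Over the common denominator \<open>q * s\<close> both terms of the numerator are
    divisible by the linear factor to this power; truncation at 0 covers a negative bound, where
    divisibility is trivial.\<close>
  define N where "N = nat (n + int (Polynomial.order a q) + int (Polynomial.order a s))"
  have "[:-a, 1:] ^ N dvd p * s" unfolding order_divides
    using assms(4) f g by (auto simp: order_mult ord_at_Fract N_def)
  moreover have "[:-a, 1:] ^ N dvd r * q" unfolding order_divides
    using assms(5) f g by (auto simp: order_mult ord_at_Fract N_def)
  ultimately have "[:-a, 1:] ^ N dvd p * s + r * q" by (rule dvd_add)
  hence "N \<le> Polynomial.order a (p * s + r * q)" using nz by (simp add: order_divides)
  thus ?thesis using fg nz f g by (simp add: ord_at_Fract order_mult N_def)
qed

text \<open>In lowest terms a nonconstant denominator has a root over the complex numbers, and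
  coprimality makes this root a pole.\<close>

lemma polynomial_if_ord_at_nonneg:
  assumes "\<And>a. f \<noteq> 0 \<Longrightarrow> 0 \<le> ord_at a f"
  obtains p where "f = to_fract p"
proof (cases "f = 0")
  case True
  thus ?thesis using that[of 0] by simp
next
  case False
  obtain p q where pq: "quot_of_fract f = (p, q)" by force
  have q: "q \<noteq> 0" using snd_quot_of_fract_nonzero[of f] pq by simp
  have cop: "coprime p q" using coprime_quot_of_fract[of f] pq by simp
  have p: "p \<noteq> 0" using False pq fst_quot_of_fract_eq_0_iff[of f] by simp
  have "Polynomial.degree q = 0"
  proof (rule ccontr)
    assume "Polynomial.degree q \<noteq> 0"
    then obtain a where a: "poly q a = 0"
      using fundamental_theorem_of_algebra[of q] by (auto simp: constant_degree)
    hence "Polynomial.order a q > 0" using q by (simp add: order_gt_0_iff)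
    moreover have "Polynomial.order a q \<le> Polynomial.order a p"
      using assms[of a] False pq by (simp add: ord_at_def)
    ultimately have "poly p a = 0" using p by (simp add: order_root)
    with a have "[:-a, 1:] dvd p" "[:-a, 1:] dvd q" by (simp_all add: poly_eq_0_iff_dvd)
    with cop have "is_unit [:-a, 1:]" by (auto dest: coprime_common_divisor)
    thus False by (simp add: is_unit_iff_degree)
  qed
  then obtain c where c: "q = [:c:]" by (auto elim: degree_eq_zeroE)
  with q have "c \<noteq> 0" by auto
  have "f = Fract p q" using Fract_quot_of_fract[of f] pq by simp
  also have "\<dots> = to_fract (smult (1 / c) p)"
    using \<open>c \<noteq> 0\<close> by (simp add: to_fract_def eq_fract c)
  finally show ?thesis by (rule that)
qed

lemma poly_mapping_single_add_induct [case_names single add]: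
  fixes F :: "'a \<Rightarrow>\<^sub>0 'b :: comm_monoid_add"
  assumes single: "\<And>k v. Q (Poly_Mapping.single k v)"
    and add: "\<And>F G. Q F \<Longrightarrow> Q G \<Longrightarrow> Q (F + G)"
  shows "Q F"
proof (induction F rule: update_induct)
  case const
  show ?case using single[of undefined 0] by simp
next
  case (update f a b)
  have "Poly_Mapping.update a b f = f + Poly_Mapping.single a b"
    using update by (intro poly_mapping_eqI) (auto simp: lookup_update lookup_add lookup_single when_def in_keys_iff)
  thus ?case using update single add by simp
qed

section \<open>Rational functions with prescribed divisor\<close>

lemma ord_at_linear: "ord_at a (to_fract [:-b, 1:]) = (if a = b then 1 else 0)"
proof (cases "a = b")
  case True
  thus ?thesis using order_power_n_n[of b 1] by (simp add: ord_at_to_fract)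
next
  case False
  thus ?thesis by (simp add: ord_at_to_fract order_0I)
qed

text \<open>Powers of linear polynomials realise multiples of single points, so all integral
  divisors on the affine line are principal. This provides generators of the graded pieces and the
  functions \<open>h\<close> and \<open>Q0\<close> of the presentation.\<close>

lemma function_with_divisor:
  fixes E :: "complex \<Rightarrow>\<^sub>0 int"
  shows "\<exists>h. h \<noteq> 0 \<and> (\<forall>a. ord_at a h = Poly_Mapping.lookup E a)"
proof (induction E rule: poly_mapping_single_add_induct)
  case (single b n)
  have nz: "to_fract [:-b, 1:] \<noteq> (0 :: complex poly fract)" by simp
  show ?case
    by (rule exI[of _ "to_fract [:-b, 1:] powi n"])
       (use nz in \<open>auto simp: ord_at_powi ord_at_linear lookup_single when_def\<close>)
next
  case (add F G)
  then obtain f g where "f \<noteq> 0" "\<forall>a. ord_at a f = Poly_Mapping.lookup F a"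
    "g \<noteq> 0" "\<forall>a. ord_at a g = Poly_Mapping.lookup G a" by blast
  thus ?case by (intro exI[of _ "f * g"]) (auto simp: ord_at_mult lookup_add)
qed

lemma finite_ord_at_nonzero:
  assumes "f \<noteq> 0"
  shows "finite {a. ord_at a f \<noteq> 0}"
proof -
  obtain p q where f: "f = Fract p q" "p \<noteq> 0" "q \<noteq> 0" using assms by (elim fract_cases_nonzero)
  have "{a. ord_at a f \<noteq> 0} \<subseteq> {a. poly p a = 0} \<union> {a. poly q a = 0}"
    using f by (auto simp: ord_at_Fract order_root)
  thus ?thesis using f poly_roots_finite finite_subset by blast
qed

section \<open>Substitutions in rational functions\<close>

text \<open>A predicate on functions between ring types, stable under composition, so that
  substitutions, evaluations and twists of Laurent polynomials share one set of rewrite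
  rules.\<close>

definition unital_hom :: "('a :: comm_ring_1 \<Rightarrow> 'b :: comm_ring_1) \<Rightarrow> bool" where
  "unital_hom f \<longleftrightarrow> (\<forall>x y. f (x + y) = f x + f y) \<and> (\<forall>x y. f (x * y) = f x * f y) \<and> f 1 = 1"

lemma unital_homI:
  assumes "\<And>x y. f (x + y) = f x + f y" "\<And>x y. f (x * y) = f x * f y" "f 1 = 1"
  shows "unital_hom f"
  using assms by (simp add: unital_hom_def)

lemma unital_hom_add: "unital_hom f \<Longrightarrow> f (x + y) = f x + f y"
  and unital_hom_mult: "unital_hom f \<Longrightarrow> f (x * y) = f x * f y"
  and unital_hom_one: "unital_hom f \<Longrightarrow> f 1 = 1"
  by (simp_all add: unital_hom_def)

lemma unital_hom_zero: "unital_hom f \<Longrightarrow> f 0 = 0"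
  using unital_hom_add[of f 0 0] by simp

lemma unital_hom_uminus: "unital_hom f \<Longrightarrow> f (- x) = - f x"
  using unital_hom_add[of f x "- x"] by (simp add: unital_hom_zero eq_neg_iff_add_eq_0 add.commute)

lemma unital_hom_diff: "unital_hom f \<Longrightarrow> f (x - y) = f x - f y"
  using unital_hom_add[of f x "- y"] by (simp add: unital_hom_uminus)

lemma unital_hom_power: "unital_hom f \<Longrightarrow> f (x ^ n) = f x ^ n"
  by (induction n) (auto simp: unital_hom_one unital_hom_mult)

lemmas unital_hom_simps = unital_hom_add unital_hom_mult unital_hom_one unital_hom_zero
  unital_hom_uminus unital_hom_diff unital_hom_power

lemma unital_hom_comp: "unital_hom f \<Longrightarrow> unital_hom g \<Longrightarrow> unital_hom (\<lambda>x. f (g x))"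
  by (simp add: unital_hom_def)

lemma unital_hom_eq_0_iff:
  fixes f :: "'a :: field \<Rightarrow> 'b :: comm_ring_1"
  assumes "unital_hom f"
  shows "f x = 0 \<longleftrightarrow> x = 0"
proof
  assume *: "f x = 0"
  show "x = 0"
  proof (rule ccontr)
    assume "x \<noteq> 0"
    hence "f x * f (inverse x) = f 1" using assms by (simp add: unital_hom_simps flip: unital_hom_mult)
    thus False using * assms by (simp add: unital_hom_one)
  qed
qed (use assms in \<open>simp add: unital_hom_zero\<close>)

lemma unital_hom_inj:
  fixes f :: "'a :: field \<Rightarrow> 'b :: comm_ring_1"
  assumes "unital_hom f"
  shows "inj f"
proof (rule injI)
  fix x y assume "f x = f y"
  hence "f (x - y) = 0" using assms by (simp add: unital_hom_simps)
  thus "x = y" using unital_hom_eq_0_iff[OF assms] by simp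
qed

lemma unital_hom_inverse:
  fixes f :: "'a :: field \<Rightarrow> 'b :: field"
  assumes "unital_hom f"
  shows "f (inverse x) = inverse (f x)"
proof (cases "x = 0")
  case False
  hence "f x * f (inverse x) = 1" using assms by (simp add: unital_hom_simps flip: unital_hom_mult)
  thus ?thesis by (metis inverse_unique)
qed (use assms in \<open>simp add: unital_hom_zero\<close>)

lemma unital_hom_divide:
  fixes f :: "'a :: field \<Rightarrow> 'b :: field"
  assumes "unital_hom f"
  shows "f (x / y) = f x / f y"
  using assms by (simp add: divide_inverse unital_hom_simps unital_hom_inverse)

lemma unital_hom_powi:
  fixes f :: "'a :: field \<Rightarrow> 'b :: field"
  assumes "unital_hom f"
  shows "f (x powi n) = f x powi n"
  using assms by (simp add: power_int_def unital_hom_simps unital_hom_inverse)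

lemma unital_hom_to_fract: "unital_hom to_fract"
  by (rule unital_homI) auto

text \<open>Composition with \<open>r\<close>, on the reduced representative. For constant
  \<open>r\<close> a denominator may compose to 0, so the homomorphism property needs positive
  degree.\<close>

definition fract_subst :: "complex poly \<Rightarrow> complex poly fract \<Rightarrow> complex poly fract" where
  "fract_subst r f = to_fract (pcompose (fst (quot_of_fract f)) r) /
                     to_fract (pcompose (snd (quot_of_fract f)) r)"

lemma pcompose_eq_0': "Polynomial.degree r > 0 \<Longrightarrow> pcompose p r = 0 \<longleftrightarrow> p = (0 :: complex poly)"
  using pcompose_eq_0[of p r] by auto

lemma fract_subst_Fract:
  assumes "Polynomial.degree r > 0" "q \<noteq> 0"
  shows "fract_subst r (Fract p q) = to_fract (pcompose p r) / to_fract (pcompose q r)"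
proof -
  obtain p' q' where pq: "quot_of_fract (Fract p q) = (p', q')" by force
  have q': "q' \<noteq> 0" using snd_quot_of_fract_nonzero[of "Fract p q"] pq by simp
  have "Fract p' q' = Fract p q" using Fract_quot_of_fract[of "Fract p q"] pq by simp
  hence "p' * q = p * q'" using q' assms by (simp add: eq_fract)
  hence "pcompose p' r * pcompose q r = pcompose p r * pcompose q' r"
    by (simp flip: pcompose_mult)
  hence "to_fract (pcompose p' r) * to_fract (pcompose q r) = to_fract (pcompose p r) * to_fract (pcompose q' r)"
    by (simp flip: to_fract_mult)
  thus ?thesis using assms q' by (simp add: fract_subst_def pq frac_eq_eq pcompose_eq_0')
qed

lemma fract_subst_to_fract: "fract_subst r (to_fract p) = to_fract (pcompose p r)"
  by (simp add: fract_subst_def pcompose_1)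

lemma unital_hom_fract_subst:
  assumes r: "Polynomial.degree r > 0"
  shows "unital_hom (fract_subst r)"
proof (rule unital_homI)
  fix x y :: "complex poly fract"
  obtain a b where x: "x = Fract a b" "b \<noteq> 0" by (cases x) auto
  obtain c d where y: "y = Fract c d" "d \<noteq> 0" by (cases y) auto
  have "to_fract (pcompose b r) \<noteq> 0" "to_fract (pcompose d r) \<noteq> 0"
    using x y r by (simp_all add: pcompose_eq_0')
  thus "fract_subst r (x + y) = fract_subst r x + fract_subst r y"
    using x y r by (simp add: fract_subst_Fract pcompose_add pcompose_mult add_frac_eq)
  show "fract_subst r (x * y) = fract_subst r x * fract_subst r y"
    using x y r by (simp add: fract_subst_Fract pcompose_mult)
next
  show "fract_subst r 1 = 1"
    using fract_subst_to_fract[of r 1] by (simp add: pcompose_1)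
qed

section \<open>Ramification of the map s -> s^d\<close>

lemma order_power:
  fixes p :: "'a :: idom poly"
  assumes "p \<noteq> 0"
  shows "Polynomial.order a (p ^ n) = n * Polynomial.order a p"
  using assms by (induction n) (auto simp: order_mult)

text \<open>The first factor is the ramification index of \<open>g\<close> at \<open>a\<close>: once
  \<open>p\<close> is split as \<open>[:-b, 1:] ^ n * r\<close> with \<open>r\<close> nonzero at
  \<open>b = poly g a\<close>, the composition of \<open>r\<close> with \<open>g\<close> does not
  vanish at \<open>a\<close>.\<close>

lemma order_pcompose:
  fixes p g :: "complex poly"
  assumes p: "p \<noteq> 0" and g: "Polynomial.degree g > 0"
  shows "Polynomial.order a (pcompose p g) =
    Polynomial.order a (g - [:poly g a:]) * Polynomial.order (poly g a) p"
proof -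
  define b where "b = poly g a"
  obtain r where r: "p = [:-b, 1:] ^ Polynomial.order b p * r" "\<not> [:-b, 1:] dvd r"
    using order_decomp[OF p] by blast
  have r0: "r \<noteq> 0" using r p by auto
  have gb: "pcompose [:-b, 1:] g = g - [:b:]" by (simp add: pcompose_pCons)
  have pw: "pcompose ([:-b, 1:] ^ n) g = (g - [:b:]) ^ n" for n
    by (induction n) (simp_all only: power.simps pcompose_1 pcompose_mult gb)
  have nz: "g - [:b:] \<noteq> 0" using g by auto
  have rg: "pcompose r g \<noteq> 0" using r0 g by (simp add: pcompose_eq_0')
  have o: "Polynomial.order a (pcompose r g) = 0"
    using r(2) by (intro order_0I) (simp add: poly_pcompose poly_eq_0_iff_dvd flip: b_def)
  have "pcompose p g = (g - [:b:]) ^ Polynomial.order b p * pcompose r g"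
    by (subst r(1)) (simp only: pcompose_mult pw)
  thus ?thesis using nz rg o by (simp add: order_mult order_power flip: b_def)
qed

lemma order_pcompose_monom:
  fixes p :: "complex poly"
  assumes "p \<noteq> 0" "d > 0"
  shows "Polynomial.order a (pcompose p (Polynomial.monom 1 d)) =
    (if a = 0 then d * Polynomial.order 0 p else Polynomial.order (a ^ d) p)"
proof -
  let ?g = "Polynomial.monom 1 d :: complex poly"
  have deg: "Polynomial.degree ?g > 0" using assms by (simp add: degree_monom_eq)
  show ?thesis
  proof (cases "a = 0")
    case True
    thus ?thesis using assms order_pcompose[OF assms(1) deg, of 0]
      by (simp add: poly_monom zero_power)
  next
    case False
    \<comment> \<open>Away from 0 the derivative of s^d - a^d is nonzero at \<open>a\<close>, so
      \<open>a\<close> is a simple root and the index is 1.\<close>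
    have pd: "pderiv (?g - [:a ^ d:]) = Polynomial.monom (of_nat d) (d - 1)"
      by (simp add: pderiv_diff pderiv_monom pderiv_pCons)
    have "?g - [:a ^ d:] \<noteq> 0" using deg by auto
    hence "Polynomial.order a (?g - [:a ^ d:]) = Suc (Polynomial.order a (pderiv (?g - [:a ^ d:])))"
      by (rule order_pderiv) (simp add: poly_monom)
    also have "Polynomial.order a (pderiv (?g - [:a ^ d:])) = 0"
      unfolding pd using assms False by (intro order_0I) (simp add: poly_monom)
    finally show ?thesis using order_pcompose[OF assms(1) deg, of a] False
      by (simp add: poly_monom)
  qed
qed

lemma degree_monom_pos: "d > 0 \<Longrightarrow> Polynomial.degree (Polynomial.monom (1 :: complex) d) > 0"
  by (simp add: degree_monom_eq)

lemma ord_at_fract_subst_monom: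
  assumes "f \<noteq> 0" "d > 0"
  shows "ord_at a (fract_subst (Polynomial.monom 1 d) f) =
    (if a = 0 then int d * ord_at 0 f else ord_at (a ^ d) f)"
proof -
  obtain p q where f: "f = Fract p q" "p \<noteq> 0" "q \<noteq> 0" using assms by (elim fract_cases_nonzero)
  have nz: "pcompose p (Polynomial.monom 1 d) \<noteq> 0" "pcompose q (Polynomial.monom 1 d) \<noteq> 0"
    using f assms(2) by (simp_all add: pcompose_eq_0' degree_monom_pos)
  have "fract_subst (Polynomial.monom 1 d) f =
        Fract (pcompose p (Polynomial.monom 1 d)) (pcompose q (Polynomial.monom 1 d))"
    unfolding f(1) Fract_conv_to_fract[of "pcompose p _"]
    by (rule fract_subst_Fract[OF degree_monom_pos[OF assms(2)] f(3)])
  thus ?thesis using f nz assms(2)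
    by (simp add: ord_at_Fract order_pcompose_monom algebra_simps)
qed

section \<open>Roots of unity and functions invariant under rotation\<close>

lemma primitive_root_power_eq_1_iff:
  assumes "primitive_root_of_unity d z" "d > 0"
  shows "z ^ n = 1 \<longleftrightarrow> d dvd n"
proof -
  have "z ^ n = z ^ (d * (n div d) + n mod d)" by simp
  also have "\<dots> = z ^ (n mod d)"
    using assms by (simp only: power_add power_mult) (simp add: primitive_root_of_unity_def)
  finally have eq: "z ^ n = z ^ (n mod d)" .
  have lt: "n mod d < d" using assms by simp
  show ?thesis
  proof (cases "n mod d = 0")
    case False
    hence "z ^ (n mod d) \<noteq> 1" using assms lt by (auto simp: primitive_root_of_unity_def)
    thus ?thesis using eq False by auto
  qed (use eq in auto)
qed

lemma pcompose_monom:
  "pcompose (Polynomial.monom c i) (Polynomial.monom 1 d) = Polynomial.monom (c :: complex) (d * i)"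
proof -
  have "pcompose (Polynomial.monom 1 i) (Polynomial.monom 1 d) = Polynomial.monom (1 :: complex) (d * i)"
  proof (induction i)
    case 0
    thus ?case by (simp add: pcompose_1)
  next
    case (Suc i)
    have "Polynomial.monom (1 :: complex) (Suc i) = Polynomial.monom 1 1 * Polynomial.monom 1 i"
      by (simp add: mult_monom)
    moreover have "pcompose (Polynomial.monom 1 1) (Polynomial.monom 1 d) = Polynomial.monom (1 :: complex) d"
      by (simp add: monom_Suc pcompose_pCons pcompose_1)
    ultimately show ?case using Suc by (simp only: pcompose_mult) (simp add: mult_monom)
  qed
  moreover have "Polynomial.monom c i = smult c (Polynomial.monom 1 i)" by (simp add: smult_monom)
  ultimately show ?thesis by (metis pcompose_smult smult_monom mult.right_neutral)
qed

text \<open>The rotation multiplies the coefficient of degree i by z^i, so in an invariant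
  polynomial only degrees divisible by \<open>d\<close> occur.\<close>

lemma rotation_invariant_poly:
  assumes z: "primitive_root_of_unity d z" "d > 0" and p: "pcompose p [:0, z:] = p"
  shows "\<exists>M. p = pcompose M (Polynomial.monom 1 d)"
proof -
  have c: "coeff p i = 0" if "\<not> d dvd i" for i
  proof -
    have "z ^ i * coeff p i = coeff p i"
      using arg_cong[OF p, of "\<lambda>p. coeff p i"] by (simp add: coeff_pcompose_linear)
    thus ?thesis using primitive_root_power_eq_1_iff[OF z] that by auto
  qed
  \<comment> \<open>The coefficients of index \<open>d * j\<close>. The summation bound is generous:
    terms with \<open>d * j\<close> beyond the degree are zero.\<close>
  define M where "M = (\<Sum>j\<le>Polynomial.degree p. Polynomial.monom (coeff p (d * j)) j)"
  have "coeff (pcompose M (Polynomial.monom 1 d)) i = coeff p i" for i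
  proof -
    have "coeff (pcompose M (Polynomial.monom 1 d)) i =
          (\<Sum>j\<le>Polynomial.degree p. if d * j = i then coeff p (d * j) else 0)"
      by (simp add: M_def pcompose_sum pcompose_monom Polynomial.coeff_sum)
    also have "\<dots> = coeff p i"
    proof (cases "d dvd i \<and> i \<le> Polynomial.degree p")
      case True
      then obtain j where j: "i = d * j" by blast
      have "j \<le> i" using z(2) j by simp
      have "(\<Sum>j'\<le>Polynomial.degree p. if d * j' = i then coeff p (d * j') else 0) =
            (\<Sum>j'\<le>Polynomial.degree p. if j' = j then coeff p (d * j') else 0)"
        using j z(2) by (intro sum.cong) auto
      also have "\<dots> = coeff p i" using order_trans[OF \<open>j \<le> i\<close>] True j by simp
      finally show ?thesis .
    next
      case False
      hence "coeff p i = 0" using c coeff_eq_0 by (metis linorder_not_le)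
      thus ?thesis by (intro trans[OF sum.neutral]) auto
    qed
    finally show ?thesis .
  qed
  thus ?thesis by (metis poly_eqI)
qed

text \<open>Each linear factor s - a is completed to s^d - a^d, a polynomial in s^d. This lets a
  denominator be replaced by an invariant one.\<close>

lemma divides_power_subst:
  assumes "b \<noteq> 0" "d > 0"
  shows "\<exists>c N. c \<noteq> 0 \<and> N \<noteq> 0 \<and> b * c = pcompose N (Polynomial.monom (1 :: complex) d)"
  using assms(1)
proof (induction "Polynomial.degree b" arbitrary: b)
  case 0
  then obtain c where "b = [:c:]" by (metis degree_eq_zeroE)
  with 0 show ?case by (intro exI[of _ 1] exI[of _ b]) auto
next
  case (Suc n)
  hence "\<not> constant (poly b)" by (simp add: constant_degree)
  then obtain a where "poly b a = 0" using fundamental_theorem_of_algebra by blast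
  then obtain b' where b': "b = [:-a, 1:] * b'" by (auto simp: poly_eq_0_iff_dvd elim: dvdE)
  with Suc.prems have "b' \<noteq> 0" by auto
  hence "Polynomial.degree b = Suc (Polynomial.degree b')"
    unfolding b' by (subst degree_mult_eq) auto
  with Suc.hyps have "n = Polynomial.degree b'" by simp
  from Suc.hyps(1)[OF this \<open>b' \<noteq> 0\<close>] obtain c N where
    cN: "c \<noteq> 0" "N \<noteq> 0" "b' * c = pcompose N (Polynomial.monom 1 d)" by blast
  have "poly (Polynomial.monom 1 d - [:a ^ d:]) a = 0" by (simp add: poly_monom)
  then obtain c0 where c0: "Polynomial.monom 1 d - [:a ^ d:] = [:-a, 1:] * c0"
    unfolding poly_eq_0_iff_dvd by (rule dvdE)
  have nz: "Polynomial.monom 1 d - [:a ^ d:] \<noteq> 0"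
    using degree_monom_pos[OF assms(2)] by auto
  have comp: "pcompose [:- (a ^ d), 1:] (Polynomial.monom 1 d) = Polynomial.monom 1 d - [:a ^ d:]"
    by (simp add: pcompose_pCons)
  have "b * (c0 * c) = ([:-a, 1:] * c0) * (b' * c)" by (simp only: b' mult_ac)
  also have "\<dots> = pcompose ([:- (a ^ d), 1:] * N) (Polynomial.monom 1 d)"
    by (simp only: c0[symmetric] cN(3) pcompose_mult comp)
  finally have "b * (c0 * c) = \<dots>" .
  moreover have "c0 * c \<noteq> 0" using c0 nz cN by auto
  moreover have "[:- (a ^ d), 1:] * N \<noteq> 0" using cN(2) by (metis mult_eq_0_iff one_neq_zero pCons_eq_0_iff)
  ultimately show ?case by blast
qed

text \<open>The fixed field of the rotation is C(s^d): once the denominator has been extended to a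
  polynomial in s^d, invariance passes to the numerator, where it can be read off the
  coefficients.\<close>

lemma rotation_invariant_fract:
  assumes z: "primitive_root_of_unity d z" "d > 0" and f: "fract_subst [:0, z:] f = f"
  shows "\<exists>g. f = fract_subst (Polynomial.monom 1 d) g"
proof -
  obtain p b where pb: "f = Fract p b" "b \<noteq> 0" by (cases f) auto
  obtain c N where cN: "c \<noteq> 0" "N \<noteq> 0" "b * c = pcompose N (Polynomial.monom 1 d)"
    using divides_power_subst[OF pb(2) z(2)] by blast
  have zd: "z ^ d = 1" using z unfolding primitive_root_of_unity_def by blast
  hence "z \<noteq> 0" using z(2) by (auto simp: zero_power)
  hence deg: "Polynomial.degree [:0, z:] > 0" by simp
  have "pcompose (Polynomial.monom 1 d) [:0, z:] = Polynomial.monom 1 d"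
    using zd by (intro poly_eqI) (auto simp: coeff_pcompose_linear)
  hence inv: "pcompose (b * c) [:0, z:] = b * c"
    by (simp add: cN(3) pcompose_assoc[symmetric])
  have bc: "b * c \<noteq> 0" using pb(2) cN(1) by simp
  have f': "f * to_fract (b * c) = to_fract (p * c)"
    using pb(2) by (simp add: pb(1) Fract_conv_to_fract)
  have "to_fract (pcompose (p * c) [:0, z:]) = fract_subst [:0, z:] (f * to_fract (b * c))"
    by (simp only: f' fract_subst_to_fract)
  also have "\<dots> = f * to_fract (b * c)"
    by (simp only: unital_hom_mult[OF unital_hom_fract_subst[OF deg]] f fract_subst_to_fract inv)
  finally have "pcompose (p * c) [:0, z:] = p * c" by (simp only: f' to_fract_eq_iff)
  then obtain M where M: "p * c = pcompose M (Polynomial.monom 1 d)"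
    using rotation_invariant_poly[OF z] by blast
  have "f = to_fract (p * c) / to_fract (b * c)" using f' bc by (metis eq_divide_imp to_fract_eq_0_iff)
  also have "\<dots> = fract_subst (Polynomial.monom 1 d) (Fract M N)"
    using cN M z(2) by (simp only: fract_subst_Fract[OF degree_monom_pos] simp_thms not_False_eq_True)
  finally show ?thesis by blast
qed

section \<open>Laurent polynomials\<close>

text \<open>The ring map that applies \<open>f\<close> to the coefficients and sends u to c u.
  Suitable \<open>f\<close> and \<open>c\<close> give the shift of divisors, the rotation of u by
  roots of unity, the group action and the comparison map \<open>\<theta>\<close>.\<close>

definition twist :: "('a :: field \<Rightarrow> 'a) \<Rightarrow> 'a \<Rightarrow> (int \<Rightarrow>\<^sub>0 'a) \<Rightarrow> (int \<Rightarrow>\<^sub>0 'a)" where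
  "twist f c F = Poly_Mapping.mapp (\<lambda>n x. f x * c powi n) F"

lemma lookup_twist:
  "unital_hom f \<Longrightarrow> Poly_Mapping.lookup (twist f c F) n = f (Poly_Mapping.lookup F n) * c powi n"
  by (simp add: twist_def lookup_mapp when_def in_keys_iff unital_hom_zero)

lemma twist_single:
  "unital_hom f \<Longrightarrow> twist f c (Poly_Mapping.single n x) = Poly_Mapping.single n (f x * c powi n)"
  by (rule poly_mapping_eqI) (auto simp: lookup_twist lookup_single when_def unital_hom_zero)

lemma unital_hom_twist:
  assumes f: "unital_hom f" and c: "c \<noteq> 0"
  shows "unital_hom (twist f c)"
proof (rule unital_homI)
  show add: "twist f c (F + G) = twist f c F + twist f c G" for F G
    using f by (intro poly_mapping_eqI)
      (simp add: lookup_twist lookup_add unital_hom_add algebra_simps)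
  show "twist f c (F * G) = twist f c F * twist f c G" for F G
  proof (induction F rule: poly_mapping_single_add_induct)
    case (single m x)
    show ?case
    proof (induction G rule: poly_mapping_single_add_induct)
      case (single n y)
      thus ?case using f c
        by (simp add: mult_single twist_single unital_hom_mult power_int_add mult_ac)
    qed (simp add: add distrib_left)
  qed (simp add: add distrib_right)
  have "twist f c (Poly_Mapping.single 0 1) = Poly_Mapping.single 0 1"
    using f by (simp add: twist_single unital_hom_one del: single_one)
  thus "twist f c 1 = 1" by simp
qed

lemma lookup_single_mult:
  fixes F :: "int \<Rightarrow>\<^sub>0 'a :: comm_ring_1"
  shows "Poly_Mapping.lookup (Poly_Mapping.single m x * F) n = x * Poly_Mapping.lookup F (n - m)"
  by (induction F rule: poly_mapping_single_add_induct)
    (auto simp: mult_single lookup_single when_def lookup_add algebra_simps)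

lemma single_power:
  fixes x :: "'a :: comm_ring_1"
  shows "Poly_Mapping.single m x ^ n = Poly_Mapping.single (int n * m) (x ^ n)"
  by (induction n) (auto simp: mult_single algebra_simps)

lemma unital_hom_single: "unital_hom (Poly_Mapping.single (0 :: int) :: 'a :: comm_ring_1 \<Rightarrow> _)"
  by (rule unital_homI) (auto simp: single_add mult_single)

lemma unital_hom_poly_map_poly:
  assumes f: "unital_hom f"
  shows "unital_hom (\<lambda>p. poly (map_poly f p) x)"
proof -
  have ev_pCons: "poly (map_poly f (pCons a p)) x = f a + x * poly (map_poly f p) x" for a p
    using f by (simp add: map_poly_pCons unital_hom_zero)
  have add: "poly (map_poly f (p + q)) x = poly (map_poly f p) x + poly (map_poly f q) x" for p q
  proof (induction p q rule: poly_induct2)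
    case (pCons a p b q)
    thus ?case using f by (simp add: ev_pCons unital_hom_add algebra_simps)
  qed simp
  have smult: "poly (map_poly f (smult a p)) x = f a * poly (map_poly f p) x" for a p
  proof (induction p)
    case (pCons b p)
    show ?case using f pCons.IH by (simp add: ev_pCons unital_hom_mult algebra_simps)
  qed simp
  have "poly (map_poly f (p * q)) x = poly (map_poly f p) x * poly (map_poly f q) x" for p q
  proof (induction p)
    case (pCons a p)
    have "poly (map_poly f (pCons a p * q)) x = poly (map_poly f (smult a q)) x + poly (map_poly f (pCons 0 (p * q))) x"
      by (simp only: mult_pCons_left add)
    also have "\<dots> = f a * poly (map_poly f q) x + x * (poly (map_poly f p) x * poly (map_poly f q) x)"
      using f by (simp add: smult ev_pCons unital_hom_zero pCons.IH)
    finally show ?case using f by (simp add: ev_pCons algebra_simps)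
  qed simp
  thus ?thesis using f add by (intro unital_homI) (auto simp: map_poly_1' unital_hom_one)
qed

text \<open>With \<open>f\<close> the identity of a field K this embeds K[u] into K[u, 1/u]; with
  \<open>to_fract\<close> it interprets C[s][u] over C(s).\<close>

definition to_laurent :: "('b :: comm_ring_1 \<Rightarrow> 'a :: comm_ring_1) \<Rightarrow> 'b poly \<Rightarrow> (int \<Rightarrow>\<^sub>0 'a)" where
  "to_laurent f p = poly (map_poly (\<lambda>c. Poly_Mapping.single 0 (f c)) p) (Poly_Mapping.single 1 1)"

lemma unital_hom_to_laurent: "unital_hom f \<Longrightarrow> unital_hom (to_laurent f)"
  unfolding to_laurent_def
  by (intro unital_hom_poly_map_poly unital_hom_comp[OF unital_hom_single])

lemma lookup_to_laurent:
  assumes f: "unital_hom f"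
  shows "Poly_Mapping.lookup (to_laurent f p) n = (if 0 \<le> n then f (coeff p (nat n)) else 0)"
proof (induction p arbitrary: n)
  case 0
  thus ?case using f by (simp add: to_laurent_def unital_hom_zero)
next
  case (pCons a p)
  have "to_laurent f (pCons a p) =
        Poly_Mapping.single 0 (f a) + Poly_Mapping.single 1 1 * to_laurent f p"
    using f by (simp add: to_laurent_def map_poly_pCons unital_hom_zero)
  thus ?case using f
    by (auto simp: lookup_add lookup_single_mult pCons.IH lookup_single when_def coeff_pCons
        nat_diff_distrib unital_hom_zero split: nat.splits)
qed

lemma to_laurent_monom:
  assumes "unital_hom f"
  shows "to_laurent f (Polynomial.monom c n) = Poly_Mapping.single (int n) (f c)"
  using assms by (intro poly_mapping_eqI)
    (auto simp: lookup_to_laurent lookup_single when_def unital_hom_zero)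

lemma to_laurent_eq_0_iff:
  assumes "unital_hom f" "inj f"
  shows "to_laurent f p = 0 \<longleftrightarrow> p = 0"
proof
  assume *: "to_laurent f p = 0"
  have "f (coeff p n) = f 0" for n
    using lookup_to_laurent[OF assms(1), of p "int n"] * assms(1) by (simp add: unital_hom_zero)
  hence "coeff p n = 0" for n using assms(2) by (auto dest: injD)
  thus "p = 0" by (intro poly_eqI) auto
qed (use assms in \<open>simp add: unital_hom_to_laurent unital_hom_zero\<close>)

section \<open>Complete integral closedness of K[u, 1/u] for a field K\<close>

lemma laurent_clear_negative:
  fixes F :: "int \<Rightarrow>\<^sub>0 'a :: field"
  shows "\<exists>M p. F * Poly_Mapping.single (int M) 1 = to_laurent (\<lambda>x. x) p"
proof (induction F rule: poly_mapping_single_add_induct)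
  case (single n x)
  have "Poly_Mapping.single n x * Poly_Mapping.single (int (nat (- n))) 1 =
        to_laurent (\<lambda>x. x) (Polynomial.monom x (nat (n + int (nat (- n)))))"
    by (subst to_laurent_monom) (auto simp: unital_hom_def mult_single)
  thus ?case by blast
next
  case (add F G)
  then obtain M p N q where 
    p: "F * Poly_Mapping.single (int M) 1 = to_laurent (\<lambda>x. x) p" and
    q: "G * Poly_Mapping.single (int N) 1 = to_laurent (\<lambda>x. x) q" by blast
  have hom: "unital_hom (to_laurent (\<lambda>x. x :: 'a))"
    by (rule unital_hom_to_laurent) (simp add: unital_hom_def)
  have m: "Poly_Mapping.single (int n) 1 = to_laurent (\<lambda>x. x :: 'a) (Polynomial.monom 1 n)" for n
    by (subst to_laurent_monom) (auto simp: unital_hom_def)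
  have "(F + G) * Poly_Mapping.single (int (M + N)) 1 =
        F * Poly_Mapping.single (int M) 1 * Poly_Mapping.single (int N) 1 +
        G * Poly_Mapping.single (int N) 1 * Poly_Mapping.single (int M) 1"
    by (simp add: mult_single algebra_simps)
  also have "\<dots> = to_laurent (\<lambda>x. x) (p * Polynomial.monom 1 N + q * Polynomial.monom 1 M)"
    by (simp only: p q unital_hom_add[OF hom] unital_hom_mult[OF hom] m[symmetric])
  finally show ?case by blast
qed

text \<open>The polynomials \<open>p\<close> with \<open>p z\<^sup>i\<close> in the ring for all \<open>i\<close> form an ideal closed under
  multiplication by \<open>z\<close>, up to powers of \<open>u\<close>. So its generator \<open>p\<close> divides \<open>u\<^sup>N p z\<close>.\<close>

lemma laurent_completely_integrally_closed:
  fixes z :: "(int \<Rightarrow>\<^sub>0 'a :: field) fract"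
  assumes c: "c \<noteq> 0" and z: "\<And>i. \<exists>F. to_fract c * z ^ i = to_fract F"
  shows "\<exists>F. z = to_fract F"
proof -
  define L :: "'a poly \<Rightarrow> (int \<Rightarrow>\<^sub>0 'a)" where "L = to_laurent (\<lambda>x. x)"
  have id: "unital_hom (\<lambda>x :: 'a. x)" by (simp add: unital_hom_def)
  have hom: "unital_hom L" unfolding L_def by (rule unital_hom_to_laurent[OF id])
  have L0: "L p = 0 \<longleftrightarrow> p = 0" for p
    unfolding L_def by (rule to_laurent_eq_0_iff[OF id]) (simp add: inj_def)
  define J where "J = {p. \<forall>i. \<exists>F. to_fract (L p) * z ^ i = to_fract F}"
  obtain M p0 where "c * Poly_Mapping.single (int M) 1 = L p0"
    using laurent_clear_negative[of c] unfolding L_def by blast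
  note p0 = this[symmetric]
  have "Poly_Mapping.single (int M) (1 :: 'a) \<noteq> 0" by (metis lookup_single_eq lookup_zero one_neq_zero)
  hence "p0 \<noteq> 0" using p0 c L0[of p0] by auto
  moreover have "p0 \<in> J" unfolding J_def
  proof safe
    fix i
    obtain F where F: "to_fract c * z ^ i = to_fract F" using z by blast
    have "to_fract (L p0) * z ^ i = to_fract (F * Poly_Mapping.single (int M) 1)"
      by (simp only: p0 to_fract_mult flip: F) (simp add: mult_ac)
    thus "\<exists>F. to_fract (L p0) * z ^ i = to_fract F" by blast
  qed
  \<comment> \<open>An element of least degree serves as generator of the ideal \<open>J\<close>: a
    remainder modulo \<open>p\<close> that lies in \<open>J\<close> must vanish.\<close>
  ultimately obtain p where p: "p \<in> J" "p \<noteq> 0"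
    and min: "\<And>q. q \<in> J \<Longrightarrow> q \<noteq> 0 \<Longrightarrow> Polynomial.degree p \<le> Polynomial.degree q"
    using ex_has_least_nat[of "\<lambda>p. p \<in> J \<and> p \<noteq> 0" p0 Polynomial.degree] by blast
  have "\<exists>F. to_fract (L p) * z ^ 1 = to_fract F" using p(1) unfolding J_def by blast
  then obtain F1 where F1: "to_fract (L p) * z = to_fract F1" by auto
  obtain N h where h: "F1 * Poly_Mapping.single (int N) 1 = L h"
    using laurent_clear_negative[of F1] unfolding L_def by blast
  have Lh: "to_fract (L h) = to_fract (L p) * z * to_fract (Poly_Mapping.single (int N) 1)"
    by (simp flip: h F1)
  \<comment> \<open>\<open>L h\<close> is u^N z times \<open>L p\<close>. Multiplying h - (h div p)
    p by z^i therefore involves only z^i and z^(i+1) times \<open>L p\<close>, both of which are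
    Laurent polynomials.\<close>
  have mod: "h mod p \<in> J" unfolding J_def
  proof safe
    fix i
    obtain F G where FG: "to_fract (L p) * z ^ i = to_fract F" "to_fract (L p) * z ^ Suc i = to_fract G"
      using p(1) unfolding J_def by blast
    have "L (h mod p) = L h - L (h div p) * L p"
      by (simp add: minus_div_mult_eq_mod[symmetric] unital_hom_simps[OF hom])
    hence mod: "to_fract (L (h mod p)) = to_fract (L h) - to_fract (L (h div p)) * to_fract (L p)"
      by simp
    have "to_fract (L (h mod p)) * z ^ i =
       to_fract (L p) * z ^ Suc i * to_fract (Poly_Mapping.single (int N) 1) -
       to_fract (L (h div p)) * (to_fract (L p) * z ^ i)"
      unfolding mod Lh by (simp add: algebra_simps)
    also have "\<dots> = to_fract (G * Poly_Mapping.single (int N) 1 - L (h div p) * F)"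
      by (simp only: FG to_fract_mult to_fract_diff)
    finally show "\<exists>F. to_fract (L (h mod p)) * z ^ i = to_fract F" by blast
  qed
  have "h mod p = 0"
    using degree_mod_less[OF p(2), of h] min[OF mod] by linarith
  hence "L h = L (h div p) * L p"
    using unital_hom_mult[OF hom, of "h div p" p] by (metis add.right_neutral div_mult_mod_eq)
  hence "to_fract (L p) * (z * to_fract (Poly_Mapping.single (int N) 1)) = to_fract (L p) * to_fract (L (h div p))"
    using Lh by (auto simp: mult_ac)
  hence eq: "z * to_fract (Poly_Mapping.single (int N) 1) = to_fract (L (h div p))"
    using p(2) L0 by simp
  have "z = z * to_fract (Poly_Mapping.single (int N) 1 * Poly_Mapping.single (- int N) 1)"
    by (simp add: mult_single)
  also have "\<dots> = to_fract (L (h div p) * Poly_Mapping.single (- int N) 1)"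
    by (simp only: to_fract_mult mult.assoc[symmetric] eq)
  finally show ?thesis by blast
qed

section \<open>Graded subrings of K[u, 1/u]\<close>

lemma lookup_mult_top:
  fixes F G :: "int \<Rightarrow>\<^sub>0 'a :: comm_ring_1"
  assumes F: "\<forall>k\<in>Poly_Mapping.keys F. k \<le> n" and G: "\<forall>k\<in>Poly_Mapping.keys G. k \<le> m"
  shows "Poly_Mapping.lookup (F * G) (n + m) = Poly_Mapping.lookup F n * Poly_Mapping.lookup G m"
    and "\<forall>k\<in>Poly_Mapping.keys (F * G). k \<le> n + m"
proof -
  \<comment> \<open>Without its term in degree \<open>n\<close> the first factor contributes nothing
    in degree \<open>n + m\<close>. The bounds are only upper bounds, so the top coefficients may be
    0.\<close>
  define F' where "F' = F - Poly_Mapping.single n (Poly_Mapping.lookup F n)"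
  have F': "k < n" if "k \<in> Poly_Mapping.keys F'" for k
    using that F by (force simp: F'_def in_keys_iff lookup_minus lookup_single when_def split: if_splits)
  have "n + m \<notin> Poly_Mapping.keys (F' * G)"
    using keys_mult[of F' G] F' G by fastforce
  hence 0: "Poly_Mapping.lookup (F' * G) (n + m) = 0" by (simp add: in_keys_iff)
  have "F * G = F' * G + Poly_Mapping.single n (Poly_Mapping.lookup F n) * G"
    by (simp add: F'_def algebra_simps)
  thus "Poly_Mapping.lookup (F * G) (n + m) = Poly_Mapping.lookup F n * Poly_Mapping.lookup G m"
    using 0 by (simp add: lookup_add lookup_single_mult)
  show "\<forall>k\<in>Poly_Mapping.keys (F * G). k \<le> n + m"
    using keys_mult[of F G] F G by fastforce
qed

lemma lookup_power_top:
  fixes F :: "int \<Rightarrow>\<^sub>0 'a :: comm_ring_1"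
  assumes F: "\<forall>k\<in>Poly_Mapping.keys F. k \<le> n"
  shows "Poly_Mapping.lookup (F ^ i) (int i * n) = Poly_Mapping.lookup F n ^ i \<and>
    (\<forall>k\<in>Poly_Mapping.keys (F ^ i). k \<le> int i * n)"
proof (induction i)
  case (Suc i)
  show ?case using lookup_mult_top[OF F conjunct2[OF Suc]] Suc by (simp add: algebra_simps)
qed auto

text \<open>\<open>a n\<close> holds the coefficients of u^n in a graded subring of K[u, 1/u], which
  \<open>laurents\<close> assembles.\<close>

locale graded_coeffs =
  fixes a :: "int \<Rightarrow> 'a :: field set"
  assumes coeffs_zero: "0 \<in> a n"
    and coeffs_one: "1 \<in> a 0"
    and coeffs_add: "x \<in> a n \<Longrightarrow> y \<in> a n \<Longrightarrow> x + y \<in> a n"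
    and coeffs_uminus: "x \<in> a n \<Longrightarrow> - x \<in> a n"
    and coeffs_mult: "x \<in> a m \<Longrightarrow> y \<in> a n \<Longrightarrow> x * y \<in> a (m + n)"
begin

definition laurents :: "(int \<Rightarrow>\<^sub>0 'a) set" where
  "laurents = {F. \<forall>n. Poly_Mapping.lookup F n \<in> a n}"

lemma laurents_zero: "0 \<in> laurents"
  by (simp add: laurents_def coeffs_zero)

lemma laurents_one: "1 \<in> laurents"
  by (simp add: laurents_def lookup_one when_def coeffs_zero coeffs_one)

lemma laurents_add: "F \<in> laurents \<Longrightarrow> G \<in> laurents \<Longrightarrow> F + G \<in> laurents"
  by (simp add: laurents_def lookup_add coeffs_add)

lemma laurents_uminus: "F \<in> laurents \<Longrightarrow> - F \<in> laurents"
  by (simp add: laurents_def coeffs_uminus)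

lemma laurents_diff: "F \<in> laurents \<Longrightarrow> G \<in> laurents \<Longrightarrow> F - G \<in> laurents"
  using laurents_add[of F "- G"] laurents_uminus[of G] by simp

lemma single_in_laurents_iff: "Poly_Mapping.single n x \<in> laurents \<longleftrightarrow> x \<in> a n"
  by (auto simp: laurents_def lookup_single when_def coeffs_zero split: if_splits)

lemma laurents_sum: "(\<And>i. i \<in> I \<Longrightarrow> F i \<in> laurents) \<Longrightarrow> (\<Sum>i\<in>I. F i) \<in> laurents"
  by (induction I rule: infinite_finite_induct) (auto simp: laurents_zero laurents_add)

lemma laurents_induct [consumes 1, case_names single add]:
  assumes F: "F \<in> laurents"
    and single: "\<And>n x. x \<in> a n \<Longrightarrow> Q (Poly_Mapping.single n x)"
    and add: "\<And>F G. F \<in> laurents \<Longrightarrow> G \<in> laurents \<Longrightarrow> Q F \<Longrightarrow> Q G \<Longrightarrow> Q (F + G)"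
  shows "Q F"
  using F
proof (induction "card (Poly_Mapping.keys F)" arbitrary: F)
  case 0
  hence "F = 0" by simp
  thus ?case using single[OF coeffs_zero[of 0]] by simp
next
  case (Suc k)
  then obtain n where n: "n \<in> Poly_Mapping.keys F" by fastforce
  define G where "G = F - Poly_Mapping.single n (Poly_Mapping.lookup F n)"
  have "Poly_Mapping.keys G = Poly_Mapping.keys F - {n}"
    by (auto simp: G_def in_keys_iff lookup_minus lookup_single when_def split: if_splits)
  hence k: "k = card (Poly_Mapping.keys G)" using Suc.hyps(2) n by simp
  have c: "Poly_Mapping.lookup F n \<in> a n" using Suc.prems by (simp add: laurents_def)
  hence G: "G \<in> laurents" unfolding G_def
    using Suc.prems by (intro laurents_diff) (auto simp: single_in_laurents_iff)
  have "Q (G + Poly_Mapping.single n (Poly_Mapping.lookup F n))"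
    using Suc.hyps(1)[OF k G] single[OF c] G c by (intro add) (auto simp: single_in_laurents_iff)
  thus ?case by (simp add: G_def)
qed

lemma laurents_mult: "F \<in> laurents \<Longrightarrow> G \<in> laurents \<Longrightarrow> F * G \<in> laurents"
proof (induction F rule: laurents_induct)
  case (single m x)
  from single(2,1) show ?case
  proof (induction G rule: laurents_induct)
    case (single n y)
    thus ?case by (simp add: mult_single single_in_laurents_iff coeffs_mult)
  qed (simp add: distrib_left laurents_add)
qed (simp add: distrib_right laurents_add)

lemma laurents_power: "F \<in> laurents \<Longrightarrow> F ^ n \<in> laurents"
  by (induction n) (auto simp: laurents_one laurents_mult)

end

text \<open>The added axiom is complete integral closedness for homogeneous elements only: x u^n is
  almost integral with the homogeneous multiplier c u^m.\<close>

locale graded_coeffs_closed = graded_coeffs +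
  assumes coeffs_closed: "c \<noteq> 0 \<Longrightarrow> (\<And>i. c * x ^ i \<in> a (m + int i * n)) \<Longrightarrow> x \<in> a n"
begin

text \<open>The top component of an almost integral element is almost integral, and subtracting it
  keeps the element almost integral.\<close>

lemma laurents_completely_integrally_closed:
  assumes "C \<noteq> 0" "\<And>i. C * F ^ i \<in> laurents"
  shows "F \<in> laurents"
  using assms
proof (induction "card (Poly_Mapping.keys F)" arbitrary: F C)
  case 0
  hence "F = 0" by simp
  thus ?case by (simp add: laurents_zero)
next
  case (Suc k)
  define n where "n = Max (Poly_Mapping.keys F)"
  define m where "m = Max (Poly_Mapping.keys C)"
  define x where "x = Poly_Mapping.lookup F n"
  have ne: "Poly_Mapping.keys F \<noteq> {}" "Poly_Mapping.keys C \<noteq> {}"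
    using Suc.hyps(2) Suc.prems(1) by auto
  hence nm: "n \<in> Poly_Mapping.keys F" "m \<in> Poly_Mapping.keys C"
    unfolding n_def m_def by (auto intro!: Max_in)
  have top: "\<forall>k\<in>Poly_Mapping.keys F. k \<le> n" "\<forall>k\<in>Poly_Mapping.keys C. k \<le> m"
    unfolding n_def m_def by auto
  have "Poly_Mapping.lookup C m * x ^ i \<in> a (m + int i * n)" for i
  proof -
    have "Poly_Mapping.lookup (C * F ^ i) (m + int i * n) = Poly_Mapping.lookup C m * x ^ i"
      using lookup_mult_top(1)[OF top(2) conjunct2[OF lookup_power_top[OF top(1)]]]
        lookup_power_top[OF top(1), of i] by (simp add: x_def)
    moreover have "Poly_Mapping.lookup (C * F ^ i) (m + int i * n) \<in> a (m + int i * n)"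
      using Suc.prems(2)[of i] by (simp add: laurents_def)
    ultimately show ?thesis by simp
  qed
  moreover have "Poly_Mapping.lookup C m \<noteq> 0" using nm(2) by (simp add: in_keys_iff)
  ultimately have x: "x \<in> a n" by (rule coeffs_closed[rotated])
  define s where "s = Poly_Mapping.single n x"
  have s: "s \<in> laurents" using x by (simp add: s_def single_in_laurents_iff)
  define G where "G = F - s"
  have "Poly_Mapping.keys G = Poly_Mapping.keys F - {n}"
    by (auto simp: G_def s_def x_def in_keys_iff lookup_minus lookup_single when_def split: if_splits)
  hence k: "k = card (Poly_Mapping.keys G)" using Suc.hyps(2) nm by simp
  \<comment> \<open>Mixed powers keep the induction going, since each factor
    \<open>G = F - s\<close> turns into a further factor \<open>F\<close> or
    \<open>s\<close>.\<close>
  have "C * F ^ j * G ^ i \<in> laurents" for i j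
  proof (induction i arbitrary: j)
    case 0
    thus ?case using Suc.prems(2) by simp
  next
    case (Suc i)
    have "C * F ^ j * G ^ Suc i = C * F ^ Suc j * G ^ i - s * (C * F ^ j * G ^ i)"
      by (simp add: G_def algebra_simps)
    also have "\<dots> \<in> laurents" by (intro laurents_diff laurents_mult s Suc)
    finally show ?case .
  qed
  from this[of 0] have "C * G ^ i \<in> laurents" for i by simp
  hence "G \<in> laurents" using Suc.hyps(1)[OF k Suc.prems(1)] by blast
  moreover have "F = G + s" by (simp add: G_def)
  ultimately show ?case using s laurents_add by simp
qed

end

section \<open>The algebras $A_0[D_+,D_-]$\<close>

text \<open>The multiplicity at \<open>a\<close> of n D_+ or of -n D_-, without rounding. Orders are
  integers, so the condition on sections can be stated with this number instead of its
  floor.\<close>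

definition slope :: "q_divisor \<Rightarrow> q_divisor \<Rightarrow> int \<Rightarrow> complex \<Rightarrow> rat" where
  "slope Dp Dm n a = (if 0 \<le> n then of_int n * Poly_Mapping.lookup Dp a
                      else - of_int n * Poly_Mapping.lookup Dm a)"

lemma lookup_map_zero:
  "f 0 = 0 \<Longrightarrow> Poly_Mapping.lookup (Poly_Mapping.map f D) a = f (Poly_Mapping.lookup D a)"
  by (simp add: Poly_Mapping.map.rep_eq when_def)

lemma global_sections_floor_iff:
  "f \<in> global_sections (div_floor (div_scale k D)) \<longleftrightarrow>
   f = 0 \<or> (\<forall>a. 0 \<le> of_int (ord_at a f) + of_nat k * Poly_Mapping.lookup D a)"
proof -
  have "0 \<le> ord_at a f + Poly_Mapping.lookup (div_floor (div_scale k D)) a \<longleftrightarrow>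
    0 \<le> of_int (ord_at a f) + of_nat k * Poly_Mapping.lookup D a" for a
  proof -
    have "0 \<le> ord_at a f + Poly_Mapping.lookup (div_floor (div_scale k D)) a \<longleftrightarrow>
      - ord_at a f \<le> \<lfloor>of_nat k * Poly_Mapping.lookup D a\<rfloor>"
      by (auto simp: div_floor_def div_scale_def lookup_map_zero)
    thus ?thesis by (auto simp: le_floor_iff)
  qed
  thus ?thesis by (simp add: global_sections_def)
qed

lemma dpd_coeffs_iff:
  "f \<in> dpd_coeffs Dp Dm n \<longleftrightarrow> f = 0 \<or> (\<forall>a. 0 \<le> of_int (ord_at a f) + slope Dp Dm n a)"
  by (simp add: dpd_coeffs_def global_sections_floor_iff slope_def)

text \<open>As a function of the degree the slope is linear on each side of 0, and the hypothesis
  says that it is concave there; a concave, positively homogeneous function is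
  superadditive.\<close>

lemma slope_superadditive:
  assumes "Poly_Mapping.lookup Dp a + Poly_Mapping.lookup Dm a \<le> 0"
  shows "slope Dp Dm m a + slope Dp Dm n a \<le> slope Dp Dm (m + n) a"
proof -
  define x y where "x = Poly_Mapping.lookup Dp a" and "y = Poly_Mapping.lookup Dm a"
  have neg: "of_int i * (x + y) \<le> 0" if "i \<ge> 0" for i
    using assms that by (intro mult_nonneg_nonpos) (auto simp: x_def y_def)
  show ?thesis
    using neg[of m] neg[of "- m"] neg[of n] neg[of "- n"] neg[of "m + n"] neg[of "- (m + n)"]
    unfolding slope_def x_def[symmetric] y_def[symmetric]
    by (cases "0 \<le> m"; cases "0 \<le> n"; cases "0 \<le> m + n") (auto simp: algebra_simps)
qed

lemma slope_zero [simp]: "slope Dp Dm 0 a = 0"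
  by (simp add: slope_def)

lemma nonneg_if_nonneg_multiples:
  fixes y :: "'a :: archimedean_field"
  assumes "\<And>i. i0 \<le> i \<Longrightarrow> 0 \<le> K + of_nat i * y"
  shows "0 \<le> y"
proof (rule ccontr)
  assume "\<not> 0 \<le> y"
  then obtain n where n: "K < of_nat n * (- y)" using ex_less_of_nat_mult[of "- y" K] by auto
  also have "\<dots> \<le> of_nat (max n i0) * (- y)"
    using \<open>\<not> 0 \<le> y\<close> by (intro mult_right_mono) auto
  finally show False using assms[of "max n i0"] by simp
qed

text \<open>The sign of m + i n is eventually constant, so that only one of D_+ and D_- is involved;
  \<open>K\<close> is the contribution of \<open>m\<close>.\<close>

lemma slope_eventually_affine:
  "\<exists>K i0. \<forall>i\<ge>i0. slope Dp Dm (m + int i * n) a = K + of_nat i * slope Dp Dm n a"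
proof -
  consider "n > 0" | "n = 0" | "n < 0" by linarith
  thus ?thesis
  proof cases
    case 1
    have "m + int i * n \<ge> 0" if "i \<ge> nat \<bar>m\<bar>" for i
    proof -
      have "int i * 1 \<le> int i * n" using 1 by (intro mult_left_mono) auto
      thus ?thesis using that by linarith
    qed
    thus ?thesis using 1
      by (intro exI[of _ "of_int m * Poly_Mapping.lookup Dp a"] exI[of _ "nat \<bar>m\<bar>"])
        (auto simp: slope_def algebra_simps)
  next
    case 2
    thus ?thesis by (intro exI[of _ "slope Dp Dm m a"]) auto
  next
    case 3
    have "slope Dp Dm (m + int i * n) a = - of_int m * Poly_Mapping.lookup Dm a + of_nat i * slope Dp Dm n a"
      if "i \<ge> Suc (nat \<bar>m\<bar>)" for i
    proof -
      have "int i * n \<le> int i * (-1)" using 3 by (intro mult_left_mono) auto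
      hence "\<not> 0 \<le> m + int i * n" using that by linarith
      thus ?thesis using 3 by (simp add: slope_def left_diff_distrib)
    qed
    thus ?thesis by blast
  qed
qed

text \<open>The closure axiom holds for asymptotic reasons: the order of c x^i and the slope are
  affine in i for large i, and an affine function that stays nonnegative has a nonnegative linear
  coefficient.\<close>

lemma graded_coeffs_closed_dpd:
  assumes D: "\<forall>a. Poly_Mapping.lookup Dp a + Poly_Mapping.lookup Dm a \<le> 0"
  shows "graded_coeffs_closed (dpd_coeffs Dp Dm)"
proof unfold_locales
  fix x y :: "complex poly fract" and m n :: int
  show "0 \<in> dpd_coeffs Dp Dm n" "1 \<in> dpd_coeffs Dp Dm 0" by (simp_all add: dpd_coeffs_iff)
  show "x + y \<in> dpd_coeffs Dp Dm n" if "x \<in> dpd_coeffs Dp Dm n" "y \<in> dpd_coeffs Dp Dm n"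
  proof (cases "x = 0 \<or> y = 0 \<or> x + y = 0")
    case False
    have "0 \<le> of_int (ord_at a (x + y)) + slope Dp Dm n a" for a
    proof -
      \<comment> \<open>\<open>ord_at_add_ge\<close> takes an integer bound, hence the
        ceiling.\<close>
      have "\<lceil>- slope Dp Dm n a\<rceil> \<le> ord_at a (x + y)"
      proof (rule ord_at_add_ge)
        show "\<lceil>- slope Dp Dm n a\<rceil> \<le> ord_at a x" "\<lceil>- slope Dp Dm n a\<rceil> \<le> ord_at a y"
          using that False by (auto simp: dpd_coeffs_iff ceiling_le_iff minus_le_iff add.commute neg_le_iff_le)
            (metis add.commute le_add_iff2 diff_0 diff_le_eq minus_le_iff)+
      qed (use False in auto)
      thus ?thesis by (simp add: ceiling_le_iff)
    qed
    thus ?thesis by (simp add: dpd_coeffs_iff)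
  qed (use that in \<open>auto simp: dpd_coeffs_iff\<close>)
  show "- x \<in> dpd_coeffs Dp Dm n" if "x \<in> dpd_coeffs Dp Dm n"
  proof (cases "x = 0")
    case False
    have "ord_at a (- x) = ord_at a x" for a
      using ord_at_mult[of "-1" x a] False ord_at_to_fract[of a "-1"]
      by (simp add: order_0I)
    thus ?thesis using that by (simp add: dpd_coeffs_iff)
  qed (use that in auto)
  show "x * y \<in> dpd_coeffs Dp Dm (m + n)" if "x \<in> dpd_coeffs Dp Dm m" "y \<in> dpd_coeffs Dp Dm n"
  proof (cases "x = 0 \<or> y = 0")
    case False
    have "0 \<le> of_int (ord_at a (x * y)) + slope Dp Dm (m + n) a" for a
    proof -
      have "0 \<le> of_int (ord_at a x) + slope Dp Dm m a" "0 \<le> of_int (ord_at a y) + slope Dp Dm n a"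
        using that False by (auto simp: dpd_coeffs_iff)
      thus ?thesis using slope_superadditive[of Dp a Dm m n] D False by (simp add: ord_at_mult)
    qed
    thus ?thesis by (simp add: dpd_coeffs_iff)
  qed (auto simp: dpd_coeffs_iff)
  fix c :: "complex poly fract"
  assume c: "c \<noteq> 0" and mem: "\<And>i. c * x ^ i \<in> dpd_coeffs Dp Dm (m + int i * n)"
  show "x \<in> dpd_coeffs Dp Dm n"
  proof (cases "x = 0")
    case False
    have "0 \<le> of_int (ord_at a x) + slope Dp Dm n a" for a
    proof -
      obtain K i0 where K: "\<And>i. i \<ge> i0 \<Longrightarrow> slope Dp Dm (m + int i * n) a = K + of_nat i * slope Dp Dm n a"
        using slope_eventually_affine[of Dp Dm m n a] by blast
      show ?thesis
      proof (rule nonneg_if_nonneg_multiples)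
        fix i assume "i0 \<le> i"
        have "0 \<le> of_int (ord_at a (c * x ^ i)) + slope Dp Dm (m + int i * n) a"
          using mem[of i] c False by (auto simp: dpd_coeffs_iff)
        thus "0 \<le> of_int (ord_at a c) + K + of_nat i * (of_int (ord_at a x) + slope Dp Dm n a)"
          using c False K[OF \<open>i0 \<le> i\<close>] by (simp add: ord_at_mult ord_at_power algebra_simps)
      qed
    qed
    thus ?thesis by (simp add: dpd_coeffs_iff)
  qed (simp add: dpd_coeffs_iff)
qed

section \<open>Ring structures and graded isomorphisms\<close>

lemma ring_of_type_algebra_simps [simp]:
  "carrier (ring_of_type_algebra :: 'a :: ring_1 ring) = UNIV"
  "monoid.mult (ring_of_type_algebra :: 'a ring) = (*)"
  "add (ring_of_type_algebra :: 'a ring) = (+)"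
  "one (ring_of_type_algebra :: 'a ring) = 1"
  "ring.zero (ring_of_type_algebra :: 'a ring) = 0"
  by (simp_all add: ring_of_type_algebra_def)

lemma carrier_dpd_ring: "carrier (dpd_ring Dp Dm) = {F. \<forall>n. Poly_Mapping.lookup F n \<in> dpd_coeffs Dp Dm n}"
  and dpd_ring_simps [simp]:
    "monoid.mult (dpd_ring Dp Dm) = (*)" "add (dpd_ring Dp Dm) = (+)" "one (dpd_ring Dp Dm) = 1"
    "ring.zero (dpd_ring Dp Dm) = 0"
  by (simp_all add: dpd_ring_def)

lemma (in graded_coeffs) subring_laurents: "subring laurents ring_of_type_algebra"
proof -
  interpret ring "ring_of_type_algebra :: (int \<Rightarrow>\<^sub>0 'a) ring" by (rule ring_from_type_algebra)
  show ?thesis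
  proof (rule subringI)
    fix F assume F: "F \<in> laurents"
    have "\<ominus>\<^bsub>ring_of_type_algebra\<^esub> F = - F" by (rule minus_equality) auto
    thus "\<ominus>\<^bsub>ring_of_type_algebra\<^esub> F \<in> laurents" using F by (simp add: laurents_uminus)
  qed (auto simp: laurents_one laurents_mult laurents_add)
qed

lemma ring_dpd_ring:
  assumes "\<forall>a. Poly_Mapping.lookup Dp a + Poly_Mapping.lookup Dm a \<le> 0"
  shows "ring (dpd_ring Dp Dm)"
proof -
  interpret graded_coeffs_closed "dpd_coeffs Dp Dm" by (rule graded_coeffs_closed_dpd[OF assms])
  interpret ring "ring_of_type_algebra :: laurent ring" by (rule ring_from_type_algebra)
  show ?thesis
    using subring_is_ring[OF subring_laurents] by (simp add: dpd_ring_def laurents_def)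
qed

lemma graded_algebra_iso_trans:
  assumes "graded_algebra_iso R Rc Rs S Sc Ss" "graded_algebra_iso S Sc Ss T Tc Ts"
  shows "graded_algebra_iso R Rc Rs T Tc Ts"
proof -
  obtain f where f: "f \<in> ring_iso R S" "\<And>n. f ` Rc n = Sc n" "\<And>c. f (Rs c) = Ss c"
    using assms(1) unfolding graded_algebra_iso_def by blast
  obtain g where g: "g \<in> ring_iso S T" "\<And>n. g ` Sc n = Tc n" "\<And>c. g (Ss c) = Ts c"
    using assms(2) unfolding graded_algebra_iso_def by blast
  have "g \<circ> f \<in> ring_iso R T" using ring_iso_set_trans f(1) g(1) by blast
  moreover have "(g \<circ> f) ` Rc n = Tc n" for n using f(2) g(2) by (metis image_comp)
  moreover have "(g \<circ> f) (Rs c) = Ts c" for c using f(3) g(3) by simp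
  ultimately show ?thesis unfolding graded_algebra_iso_def by blast
qed

lemma graded_algebra_iso_sym:
  assumes "ring R" "\<And>n. Rc n \<subseteq> carrier R" "\<And>c. Rs c \<in> carrier R"
    and "graded_algebra_iso R Rc Rs S Sc Ss"
  shows "graded_algebra_iso S Sc Ss R Rc Rs"
proof -
  obtain f where f: "f \<in> ring_iso R S" "\<And>n. f ` Rc n = Sc n" "\<And>c. f (Rs c) = Ss c"
    using assms(4) unfolding graded_algebra_iso_def by blast
  have inj: "inj_on f (carrier R)" using f(1) by (simp add: ring_iso_def bij_betw_def)
  let ?g = "inv_into (carrier R) f"
  have "?g \<in> ring_iso S R" using ring_iso_set_sym[OF assms(1) f(1)] .
  moreover have "?g ` Sc n = Rc n" for n
    using inj assms(2)[of n] by (simp flip: f(2))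
  moreover have "?g (Ss c) = Rs c" for c
    using inj assms(3)[of c] by (simp flip: f(3))
  ultimately show ?thesis unfolding graded_algebra_iso_def by blast
qed

lemma dpd_component_subset: "dpd_component Dp Dm n \<subseteq> carrier (dpd_ring Dp Dm)"
  by (auto simp: dpd_component_def carrier_dpd_ring lookup_single when_def dpd_coeffs_iff)

lemma dpd_struct_in_carrier: "dpd_struct f \<in> carrier (dpd_ring Dp Dm)"
  by (auto simp: dpd_struct_def carrier_dpd_ring lookup_single when_def dpd_coeffs_iff ord_at_to_fract)

text \<open>The isomorphism replaces u by u / h. In degree n it lowers orders by n ord h, while the
  opposite signs in the two divisors raise the slope by n ord h on both sides of 0.\<close>

lemma dpd_algebra_iso_shift:
  assumes h: "h \<noteq> 0"
    and p: "\<And>a. Poly_Mapping.lookup Dp' a = Poly_Mapping.lookup Dp a + of_int (ord_at a h)"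
    and m: "\<And>a. Poly_Mapping.lookup Dm' a = Poly_Mapping.lookup Dm a - of_int (ord_at a h)"
  shows "graded_algebra_iso (dpd_ring Dp Dm) (dpd_component Dp Dm) dpd_struct
    (dpd_ring Dp' Dm') (dpd_component Dp' Dm') dpd_struct"
proof -
  have id: "unital_hom (\<lambda>x :: complex poly fract. x)" by (simp add: unital_hom_def)
  define \<phi> where "\<phi> = twist (\<lambda>x. x) (inverse h)"
  define \<psi> where "\<psi> = twist (\<lambda>x. x) h"
  have hom: "unital_hom \<phi>" unfolding \<phi>_def using h by (intro unital_hom_twist id) auto
  have slope: "slope Dp' Dm' n a = slope Dp Dm n a + of_int (n * ord_at a h)" for n a
    by (simp add: slope_def p m algebra_simps)
  have mem: "x * inverse h powi n \<in> dpd_coeffs Dp' Dm' n \<longleftrightarrow> x \<in> dpd_coeffs Dp Dm n" for x n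
    using h by (cases "x = 0") (auto simp: dpd_coeffs_iff ord_at_mult ord_at_powi ord_at_inverse slope)
  have mem': "x \<in> dpd_coeffs Dp' Dm' n \<longleftrightarrow> x * h powi n \<in> dpd_coeffs Dp Dm n" for x n
    using mem[of "x * h powi n" n] h by (simp add: power_int_inverse field_simps)
  have inv: "\<phi> (\<psi> F) = F" "\<psi> (\<phi> F) = F" for F
    using h by (auto intro!: poly_mapping_eqI simp: \<phi>_def \<psi>_def lookup_twist[OF id] power_int_inverse)
  have \<phi>: "\<phi> F \<in> carrier (dpd_ring Dp' Dm') \<longleftrightarrow> F \<in> carrier (dpd_ring Dp Dm)" for F
    by (simp add: carrier_dpd_ring \<phi>_def lookup_twist[OF id] mem)
  have "\<phi> \<in> ring_iso (dpd_ring Dp Dm) (dpd_ring Dp' Dm')"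
  proof (rule ring_iso_memI)
    show "bij_betw \<phi> (carrier (dpd_ring Dp Dm)) (carrier (dpd_ring Dp' Dm'))"
      by (rule bij_betw_byWitness[where f' = \<psi>]) (use inv \<phi> in \<open>auto, metis\<close>)
  qed (auto simp: \<phi> unital_hom_simps[OF hom])
  moreover have "\<phi> ` dpd_component Dp Dm n = dpd_component Dp' Dm' n" for n
  proof
    show "\<phi> ` dpd_component Dp Dm n \<subseteq> dpd_component Dp' Dm' n"
      by (auto simp: dpd_component_def \<phi>_def twist_single[OF id] mem)
    show "dpd_component Dp' Dm' n \<subseteq> \<phi> ` dpd_component Dp Dm n"
    proof
      fix F assume "F \<in> dpd_component Dp' Dm' n"
      hence "\<psi> F \<in> dpd_component Dp Dm n"
        by (auto simp: dpd_component_def \<psi>_def twist_single[OF id] mem')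
      thus "F \<in> \<phi> ` dpd_component Dp Dm n" using inv(1) by (metis imageI)
    qed
  qed
  moreover have "\<phi> (dpd_struct f) = dpd_struct f" for f
    by (simp add: dpd_struct_def \<phi>_def twist_single[OF id])
  ultimately show ?thesis unfolding graded_algebra_iso_def by blast
qed

text \<open>Since divisors are principal, some \<open>g\<close> has exactly the rounded slopes as
  allowed poles. Quotients \<open>f / g\<close> then have no poles, so each graded piece is free of
  rank one over C[t].\<close>

lemma dpd_coeffs_generator:
  obtains g where "g \<noteq> 0" "\<And>a. ord_at a g = - \<lfloor>slope Dp Dm n a\<rfloor>" "g \<in> dpd_coeffs Dp Dm n"
    "\<And>f. f \<in> dpd_coeffs Dp Dm n \<Longrightarrow> \<exists>p. f = to_fract p * g"
proof -
  define E where "E = (if 0 \<le> n then div_floor (div_scale (nat n) Dp) else div_floor (div_scale (nat (- n)) Dm))"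
  have E: "Poly_Mapping.lookup E a = \<lfloor>slope Dp Dm n a\<rfloor>" for a
    by (simp add: E_def div_floor_def div_scale_def lookup_map_zero slope_def)
  obtain g where g: "g \<noteq> 0" "\<And>a. ord_at a g = - \<lfloor>slope Dp Dm n a\<rfloor>"
    using function_with_divisor[of "- E"] by (auto simp: E)
  show ?thesis
  proof (rule that[OF g])
    have "0 \<le> - of_int \<lfloor>slope Dp Dm n a\<rfloor> + slope Dp Dm n a" for a by linarith
    thus "g \<in> dpd_coeffs Dp Dm n" by (simp add: dpd_coeffs_iff g)
    fix f assume f: "f \<in> dpd_coeffs Dp Dm n"
    have "0 \<le> ord_at a (f / g)" if "f / g \<noteq> 0" for a
    proof -
      have "f \<noteq> 0" using that by auto
      hence "- slope Dp Dm n a \<le> of_int (ord_at a f)" using f by (auto simp: dpd_coeffs_iff minus_le_iff add.commute)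
          (metis add.commute neg_le_iff_le le_add_iff2 diff_0 diff_le_eq minus_le_iff)
      hence "- ord_at a f \<le> \<lfloor>slope Dp Dm n a\<rfloor>" by (simp add: le_floor_iff)
      thus ?thesis using g \<open>f \<noteq> 0\<close> by (simp add: ord_at_divide)
    qed
    then obtain p where "f / g = to_fract p" using polynomial_if_ord_at_nonneg by blast
    thus "\<exists>p. f = to_fract p * g" using g(1) by (auto simp: field_simps)
  qed
qed

lemma common_denominator:
  fixes x :: rat
  obtains N :: nat where "N > 0" "of_nat N * x \<in> \<int>"
proof -
  obtain p q where pq: "quotient_of x = (p, q)" by force
  have "q > 0" using quotient_of_denom_pos[OF pq] .
  moreover have "x = of_int p / of_int q" using quotient_of_div[OF pq] .
  ultimately show ?thesis by (intro that[of "nat q"]) auto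
qed

text \<open>A graded isomorphism over \<open>\<complex>[t]\<close> maps a generator \<open>x\<^sub>n\<close> of the rank one module \<open>A\<^sub>n\<close> to a
  generator of its image. Hence the polynomials \<open>x\<^sub>1\<^sup>N / x\<^sub>N\<close> and \<open>x\<^sub>N x\<^sub>-\<^sub>N\<close> are invariants; when \<open>N\<close>
  clears the denominators at \<open>a\<close>, their orders there are \<open>N frac (D\<^sub>+ a)\<close> and \<open>-N (D\<^sub>+ + D\<^sub>-) a\<close>.\<close>

lemma dpd_algebra_iso_invariants:
  assumes D: "\<forall>a. Poly_Mapping.lookup Dp a + Poly_Mapping.lookup Dm a \<le> 0"
    and D': "\<forall>a. Poly_Mapping.lookup Dp' a + Poly_Mapping.lookup Dm' a \<le> 0"
    and iso: "graded_algebra_iso (dpd_ring Dp Dm) (dpd_component Dp Dm) dpd_struct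
      (dpd_ring Dp' Dm') (dpd_component Dp' Dm') dpd_struct"
  shows "Poly_Mapping.lookup Dp' a + Poly_Mapping.lookup Dm' a =
      Poly_Mapping.lookup Dp a + Poly_Mapping.lookup Dm a"
    and "frac (Poly_Mapping.lookup Dp' a) = frac (Poly_Mapping.lookup Dp a)"
proof -
  interpret A: graded_coeffs_closed "dpd_coeffs Dp Dm" by (rule graded_coeffs_closed_dpd[OF D])
  have cA: "carrier (dpd_ring Dp Dm) = A.laurents" by (simp add: carrier_dpd_ring A.laurents_def)
  obtain \<theta> where \<theta>: "\<theta> \<in> ring_iso (dpd_ring Dp Dm) (dpd_ring Dp' Dm')"
    and comp: "\<And>n. \<theta> ` dpd_component Dp Dm n = dpd_component Dp' Dm' n"
    and struct: "\<And>f. \<theta> (dpd_struct f) = dpd_struct f"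
    using iso unfolding graded_algebra_iso_def by blast
  have mult: "\<theta> (F * G) = \<theta> F * \<theta> G" if "F \<in> A.laurents" "G \<in> A.laurents" for F G
    using \<theta> that by (auto simp: ring_iso_def ring_hom_def cA)
  have one: "\<theta> 1 = 1" using \<theta> by (auto simp: ring_iso_def ring_hom_def)
  have power: "\<theta> (F ^ i) = \<theta> F ^ i" if "F \<in> A.laurents" for F i
    using that by (induction i) (auto simp: one mult A.laurents_power)
  have structA: "dpd_struct f \<in> A.laurents" for f using dpd_struct_in_carrier[of f Dp Dm] by (simp add: cA)
  have smult: "dpd_struct f * Poly_Mapping.single n x = Poly_Mapping.single n (to_fract f * x)" for f n x
    by (simp add: dpd_struct_def mult_single)
  have gen: "\<exists>g g'. g \<noteq> 0 \<and> g' \<noteq> 0 \<and> g \<in> dpd_coeffs Dp Dm n \<and>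
      (\<forall>f\<in>dpd_coeffs Dp Dm n. \<exists>p. f = to_fract p * g) \<and>
      \<theta> (Poly_Mapping.single n g) = Poly_Mapping.single n g' \<and>
      (\<forall>a. ord_at a g = - \<lfloor>slope Dp Dm n a\<rfloor>) \<and> (\<forall>a. ord_at a g' = - \<lfloor>slope Dp' Dm' n a\<rfloor>)" for n
  proof -
    obtain g where g: "g \<noteq> 0" "\<And>a. ord_at a g = - \<lfloor>slope Dp Dm n a\<rfloor>" "g \<in> dpd_coeffs Dp Dm n"
      "\<And>f. f \<in> dpd_coeffs Dp Dm n \<Longrightarrow> \<exists>p. f = to_fract p * g" by (rule dpd_coeffs_generator[of Dp Dm n]) blast
    obtain h where h: "h \<noteq> 0" "\<And>a. ord_at a h = - \<lfloor>slope Dp' Dm' n a\<rfloor>" "h \<in> dpd_coeffs Dp' Dm' n"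
      "\<And>f. f \<in> dpd_coeffs Dp' Dm' n \<Longrightarrow> \<exists>p. f = to_fract p * h" by (rule dpd_coeffs_generator[of Dp' Dm' n]) blast
    have "\<theta> (Poly_Mapping.single n g) \<in> dpd_component Dp' Dm' n"
      unfolding comp[symmetric] using g(3) by (auto simp: dpd_component_def)
    then obtain g' where g': "\<theta> (Poly_Mapping.single n g) = Poly_Mapping.single n g'" "g' \<in> dpd_coeffs Dp' Dm' n"
      by (auto simp: dpd_component_def)
    have "Poly_Mapping.single n h \<in> \<theta> ` dpd_component Dp Dm n"
      using h(3) by (simp add: comp) (simp add: dpd_component_def)
    then obtain f where f: "f \<in> dpd_coeffs Dp Dm n" "Poly_Mapping.single n h = \<theta> (Poly_Mapping.single n f)"
      by (auto simp: dpd_component_def)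
    obtain p where p: "f = to_fract p * g" using g(4)[OF f(1)] by blast
    have "Poly_Mapping.single n h = \<theta> (dpd_struct p * Poly_Mapping.single n g)"
      by (simp add: smult f(2) p)
    also have "\<dots> = dpd_struct p * Poly_Mapping.single n g'"
      using g(3) by (subst mult) (auto simp: structA A.single_in_laurents_iff struct g')
    finally have hp: "h = to_fract p * g'" by (simp add: smult inj_eq[OF inj_single])
    obtain q where q: "g' = to_fract q * h" using h(4)[OF g'(2)] by blast
    have "g' \<noteq> 0" using hp h(1) by auto
    have nz: "p \<noteq> 0" "q \<noteq> 0" using hp q h(1) \<open>g' \<noteq> 0\<close> by auto
    \<comment> \<open>\<open>h\<close> and \<open>g'\<close> are polynomial multiples of each other,
      which bounds their orders in both directions.\<close>
    have "ord_at a g' = ord_at a h" for a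
    proof -
      have "ord_at a h = ord_at a (to_fract p) + ord_at a g'"
        by (subst hp, rule ord_at_mult) (use nz \<open>g' \<noteq> 0\<close> in auto)
      moreover have "ord_at a g' = ord_at a (to_fract q) + ord_at a h"
        by (subst q, rule ord_at_mult) (use nz h(1) in auto)
      ultimately show ?thesis by (simp add: ord_at_to_fract)
    qed
    hence ord: "ord_at a g' = - \<lfloor>slope Dp' Dm' n a\<rfloor>" for a by (simp add: h(2))
    show ?thesis
      by (rule exI[of _ g], rule exI[of _ g'], intro conjI ballI allI; fact g g' ord \<open>g' \<noteq> 0\<close>)
  qed
  define x y x' y' where "x = Poly_Mapping.lookup Dp a" and "y = Poly_Mapping.lookup Dm a"
    and "x' = Poly_Mapping.lookup Dp' a" and "y' = Poly_Mapping.lookup Dm' a"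
  obtain N1 where N1: "N1 > 0" "of_nat N1 * x \<in> \<int>" using common_denominator by blast
  obtain N2 where N2: "N2 > 0" "of_nat N2 * y \<in> \<int>" using common_denominator by blast
  obtain N3 where N3: "N3 > 0" "of_nat N3 * x' \<in> \<int>" using common_denominator by blast
  obtain N4 where N4: "N4 > 0" "of_nat N4 * y' \<in> \<int>" using common_denominator by blast
  \<comment> \<open>A common multiple of the four denominators; it is positive, so that degree -N
    belongs to D_-.\<close>
  define N where "N = N1 * N2 * N3 * N4"
  have "N > 0" using N1 N2 N3 N4 by (simp add: N_def)
  have "of_nat (N2 * N3 * N4) * (of_nat N1 * x) \<in> \<int>" "of_nat (N1 * N3 * N4) * (of_nat N2 * y) \<in> \<int>"
    "of_nat (N1 * N2 * N4) * (of_nat N3 * x') \<in> \<int>" "of_nat (N1 * N2 * N3) * (of_nat N4 * y') \<in> \<int>"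
    by (rule Ints_mult[OF Ints_of_nat], fact)+
  hence N: "of_nat N * x \<in> \<int>" "of_nat N * y \<in> \<int>" "of_nat N * x' \<in> \<int>" "of_nat N * y' \<in> \<int>"
    by (simp_all add: N_def mult_ac)
  obtain g1 g1' where g1: "g1 \<noteq> 0" "g1' \<noteq> 0" "g1 \<in> dpd_coeffs Dp Dm 1"
    "\<theta> (Poly_Mapping.single 1 g1) = Poly_Mapping.single 1 g1'"
    "ord_at a g1 = - \<lfloor>x\<rfloor>" "ord_at a g1' = - \<lfloor>x'\<rfloor>"
    using gen[of 1] by (auto simp: slope_def x_def x'_def)
  obtain gN gN' where gN: "gN \<noteq> 0" "gN' \<noteq> 0" "gN \<in> dpd_coeffs Dp Dm (int N)"
    "\<And>f. f \<in> dpd_coeffs Dp Dm (int N) \<Longrightarrow> \<exists>p. f = to_fract p * gN"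
    "\<theta> (Poly_Mapping.single (int N) gN) = Poly_Mapping.single (int N) gN'"
    "ord_at a gN = - \<lfloor>of_nat N * x\<rfloor>" "ord_at a gN' = - \<lfloor>of_nat N * x'\<rfloor>"
    using gen[of "int N"] by (auto simp: slope_def x_def x'_def)
  obtain gM gM' where gM: "gM \<noteq> 0" "gM' \<noteq> 0" "gM \<in> dpd_coeffs Dp Dm (- int N)"
    "\<theta> (Poly_Mapping.single (- int N) gM) = Poly_Mapping.single (- int N) gM'"
    "ord_at a gM = - \<lfloor>of_nat N * y\<rfloor>" "ord_at a gM' = - \<lfloor>of_nat N * y'\<rfloor>"
    using gen[of "- int N"] \<open>N > 0\<close> by (auto simp: slope_def y_def y'_def)
  have floor: "of_int \<lfloor>of_nat N * x\<rfloor> = of_nat N * x" "of_int \<lfloor>of_nat N * y\<rfloor> = of_nat N * y"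
    "of_int \<lfloor>of_nat N * x'\<rfloor> = of_nat N * x'" "of_int \<lfloor>of_nat N * y'\<rfloor> = of_nat N * y'"
    using N by (auto elim!: Ints_cases)

  have "Poly_Mapping.single 1 g1 ^ N \<in> A.laurents"
    by (intro A.laurents_power) (simp add: A.single_in_laurents_iff g1)
  hence "g1 ^ N \<in> dpd_coeffs Dp Dm (int N)" by (simp add: single_power A.single_in_laurents_iff)
  \<comment> \<open>\<open>\<theta>\<close> is C[t]-linear, so the same polynomial \<open>c\<close>
    relates the images. Its order at \<open>a\<close> is N times the fractional part of
    \<open>x\<close>, and likewise of \<open>x'\<close>.\<close>
  then obtain c where c: "g1 ^ N = to_fract c * gN" using gN(4) by blast
  have "Poly_Mapping.single (int N) (g1' ^ N) = \<theta> (Poly_Mapping.single 1 g1 ^ N)"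
    using g1 by (subst power) (simp_all add: A.single_in_laurents_iff single_power)
  also have "\<dots> = \<theta> (dpd_struct c * Poly_Mapping.single (int N) gN)"
    by (simp add: single_power smult c)
  also have "\<dots> = dpd_struct c * Poly_Mapping.single (int N) gN'"
    using gN(3,5) by (subst mult) (simp_all add: structA A.single_in_laurents_iff struct)
  finally have c': "g1' ^ N = to_fract c * gN'" by (simp add: smult inj_eq[OF inj_single])
  have "c \<noteq> 0" using c g1(1) by auto
  have "ord_at a (g1 ^ N) = ord_at a (to_fract c) + ord_at a gN"
    unfolding c using \<open>c \<noteq> 0\<close> gN(1) by (intro ord_at_mult) auto
  moreover have "ord_at a (g1' ^ N) = ord_at a (to_fract c) + ord_at a gN'"
    unfolding c' using \<open>c \<noteq> 0\<close> gN(2) by (intro ord_at_mult) auto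
  ultimately have "\<lfloor>of_nat N * x\<rfloor> - int N * \<lfloor>x\<rfloor> = \<lfloor>of_nat N * x'\<rfloor> - int N * \<lfloor>x'\<rfloor>"
    using g1(1,2,5,6) gN(6,7) by (simp add: ord_at_power)
  hence "(of_int (\<lfloor>of_nat N * x\<rfloor> - int N * \<lfloor>x\<rfloor>) :: rat) = of_int (\<lfloor>of_nat N * x'\<rfloor> - int N * \<lfloor>x'\<rfloor>)"
    by simp
  hence "of_nat N * (x - of_int \<lfloor>x\<rfloor>) = of_nat N * (x' - of_int \<lfloor>x'\<rfloor>)"
    by (simp only: of_int_diff of_int_mult of_int_of_nat_eq floor right_diff_distrib)
  thus "frac (Poly_Mapping.lookup Dp' a) = frac (Poly_Mapping.lookup Dp a)"
    using \<open>N > 0\<close> by (simp add: frac_def x_def x'_def)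

  have "gN * gM \<in> dpd_coeffs Dp Dm (int N + - int N)"
    using gN(3) gM(3) by (rule A.coeffs_mult)
  hence "0 \<le> ord_at a (gN * gM)" for a
    using gN(1) gM(1) by (simp add: dpd_coeffs_iff)
  \<comment> \<open>The generators in degrees N and -N multiply into degree 0, which is C[t], and
    there \<open>\<theta>\<close> is the identity.\<close>
  then obtain b where b: "gN * gM = to_fract b" using polynomial_if_ord_at_nonneg by blast
  have "Poly_Mapping.single 0 (gN' * gM') =
      \<theta> (Poly_Mapping.single (int N) gN) * \<theta> (Poly_Mapping.single (- int N) gM)"
    by (simp add: gN(5) gM(4) mult_single)
  also have "\<dots> = \<theta> (dpd_struct b)"
    using gN(3) gM(3) by (subst mult[symmetric]) (simp_all add: A.single_in_laurents_iff mult_single b dpd_struct_def)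
  also have "\<dots> = Poly_Mapping.single 0 (gN * gM)" by (simp only: struct b) (simp add: dpd_struct_def)
  finally have "gN' * gM' = gN * gM" by (simp add: inj_eq[OF inj_single])
  hence "ord_at a gN' + ord_at a gM' = ord_at a gN + ord_at a gM"
    using gN(1,2) gM(1,2) by (simp flip: ord_at_mult)
  hence "(of_int (\<lfloor>of_nat N * x'\<rfloor> + \<lfloor>of_nat N * y'\<rfloor>) :: rat) = of_int (\<lfloor>of_nat N * x\<rfloor> + \<lfloor>of_nat N * y\<rfloor>)"
    using gN(6,7) gM(5,6) by simp
  hence "of_nat N * (x' + y') = of_nat N * (x + y)"
    by (simp only: of_int_add floor distrib_left)
  thus "Poly_Mapping.lookup Dp' a + Poly_Mapping.lookup Dm' a =
      Poly_Mapping.lookup Dp a + Poly_Mapping.lookup Dm a"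
    using \<open>N > 0\<close> by (simp add: x_def y_def x'_def y'_def)
qed

section \<open>Fraction fields with values in a field\<close>

text \<open>An embedding \<open>j\<close> into a field replaces calculations with equivalence
  classes of pairs by calculations with quotients \<open>j a / j b\<close>; it also makes
  \<open>R\<close> a commutative domain.\<close>

locale fraction_model = ring R for R (structure) +
  fixes j :: "'a \<Rightarrow> 'f :: field"
  assumes j_add: "x \<in> carrier R \<Longrightarrow> y \<in> carrier R \<Longrightarrow> j (x \<oplus> y) = j x + j y"
    and j_mult: "x \<in> carrier R \<Longrightarrow> y \<in> carrier R \<Longrightarrow> j (x \<otimes> y) = j x * j y"
    and j_one: "j \<one> = 1"
    and j_inj: "inj_on j (carrier R)"
begin

lemma j_zero: "j \<zero> = 0"
  using j_add[of \<zero> \<zero>] by (metis add_cancel_left_right zero_closed l_zero)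

lemma j_eq_0_iff: "x \<in> carrier R \<Longrightarrow> j x = 0 \<longleftrightarrow> x = \<zero>"
  using j_inj j_zero by (metis inj_onD zero_closed)

lemma j_uminus: "x \<in> carrier R \<Longrightarrow> j (\<ominus> x) = - j x"
  using j_add[of x "\<ominus> x"] by (simp add: r_neg j_zero eq_neg_iff_add_eq_0 add.commute)

text \<open>The classes of pairs that make up \<open>frac_field R\<close> are the fibres of \<open>(c, d) \<mapsto> j c / j d\<close>.\<close>

definition fr :: "'f \<Rightarrow> ('a \<times> 'a) set" where
  "fr z = {(c, d). c \<in> carrier R \<and> d \<in> carrier R - {\<zero>} \<and> j c / j d = z}"

definition fractions :: "'f set" where
  "fractions = {j a / j b | a b. a \<in> carrier R \<and> b \<in> carrier R - {\<zero>}}"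

lemma fractionsI: "a \<in> carrier R \<Longrightarrow> b \<in> carrier R - {\<zero>} \<Longrightarrow> j a / j b \<in> fractions"
  by (auto simp: fractions_def)

lemma frac_class_eq:
  assumes "a \<in> carrier R" "b \<in> carrier R - {\<zero>}"
  shows "frac_class R a b = fr (j a / j b)"
proof -
  have "a \<otimes> d = c \<otimes> b \<longleftrightarrow> j c / j d = j a / j b" if "c \<in> carrier R" "d \<in> carrier R - {\<zero>}" for c d
  proof -
    have "a \<otimes> d = c \<otimes> b \<longleftrightarrow> j (a \<otimes> d) = j (c \<otimes> b)"
      using j_inj assms that by (auto dest: inj_onD)
    also have "\<dots> \<longleftrightarrow> j a * j d = j c * j b" using assms that by (simp add: j_mult)
    also have "\<dots> \<longleftrightarrow> j c / j d = j a / j b"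
      using assms that by (auto simp: frac_eq_eq j_eq_0_iff)
    finally show ?thesis .
  qed
  thus ?thesis using assms by (auto simp: frac_class_def frac_rel_def fr_def)
qed

lemma fr_eqI: "(a, b) \<in> fr z \<Longrightarrow> a \<in> carrier R \<and> b \<in> carrier R - {\<zero>} \<and> z = j a / j b"
  by (auto simp: fr_def)

lemma fr_nonempty: "z \<in> fractions \<Longrightarrow> fr z \<noteq> {}"
  by (auto simp: fractions_def fr_def)

lemma fr_inj: "inj_on fr fractions"
proof (rule inj_onI)
  fix z w assume "z \<in> fractions" "w \<in> fractions" "fr z = fr w"
  then obtain a b where "(a, b) \<in> fr z" "(a, b) \<in> fr w" using fr_nonempty by fastforce
  thus "z = w" by (auto simp: fr_def)
qed

lemma carrier_frac_field: "carrier (frac_field R) = fr ` fractions"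
proof -
  have "carrier (frac_field R) = {frac_class R a b | a b. a \<in> carrier R \<and> b \<in> carrier R - {\<zero>}}"
    by (auto simp: frac_field_def quotient_def frac_class_def)
  also have "\<dots> = {fr (j a / j b) | a b. a \<in> carrier R \<and> b \<in> carrier R - {\<zero>}}"
    by (rule Collect_cong) (metis frac_class_eq)
  also have "\<dots> = fr ` fractions" by (auto simp: fractions_def)
  finally show ?thesis .
qed

lemma j_nonzero_closed:
  assumes "b \<in> carrier R - {\<zero>}" "d \<in> carrier R - {\<zero>}"
  shows "b \<otimes> d \<in> carrier R - {\<zero>}"
proof -
  have "j (b \<otimes> d) \<noteq> 0" using assms by (simp add: j_mult j_eq_0_iff)
  thus ?thesis using assms by (auto simp: j_zero)
qed

lemma frac_mult: "z \<in> fractions \<Longrightarrow> w \<in> fractions \<Longrightarrow> fr z \<otimes>\<^bsub>frac_field R\<^esub> fr w = fr (z * w)"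
proof -
  assume zw: "z \<in> fractions" "w \<in> fractions"
  \<comment> \<open>The operation of \<open>frac_field\<close> is a union over all representatives;
    it collapses because every choice gives the same class and \<open>fr z\<close>,
    \<open>fr w\<close> are nonempty.\<close>
  have "frac_class R (fst p \<otimes> fst q) (snd p \<otimes> snd q) = fr (z * w)"
    if "p \<in> fr z" "q \<in> fr w" for p q
    using fr_eqI[of "fst p" "snd p" z] fr_eqI[of "fst q" "snd q" w] that j_nonzero_closed[of "snd p" "snd q"]
    by (subst frac_class_eq) (auto simp: j_nonzero_closed j_mult)
  thus ?thesis using fr_nonempty[OF zw(1)] fr_nonempty[OF zw(2)]
    by (auto simp: frac_field_def)
qed

lemma frac_add: "z \<in> fractions \<Longrightarrow> w \<in> fractions \<Longrightarrow> fr z \<oplus>\<^bsub>frac_field R\<^esub> fr w = fr (z + w)"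
proof -
  assume zw: "z \<in> fractions" "w \<in> fractions"
  have "frac_class R ((fst p \<otimes> snd q) \<oplus> (fst q \<otimes> snd p)) (snd p \<otimes> snd q) = fr (z + w)"
    if "p \<in> fr z" "q \<in> fr w" for p q
    using fr_eqI[of "fst p" "snd p" z] fr_eqI[of "fst q" "snd q" w] that j_nonzero_closed[of "snd p" "snd q"]
    by (subst frac_class_eq) (auto simp: j_nonzero_closed j_mult j_add add_frac_eq j_eq_0_iff)
  thus ?thesis using fr_nonempty[OF zw(1)] fr_nonempty[OF zw(2)]
    by (auto simp: frac_field_def)
qed

lemma one_neq_zero_R: "\<one> \<in> carrier R - {\<zero>}"
  using j_one j_zero by force

lemma frac_embed_eq: "a \<in> carrier R \<Longrightarrow> frac_embed R a = fr (j a)"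
  using one_neq_zero_R by (simp add: frac_embed_def frac_class_eq j_one)

lemma frac_one: "\<one>\<^bsub>frac_field R\<^esub> = fr 1"
  using frac_embed_eq[of \<one>] by (simp add: frac_field_def frac_embed_def j_one)

lemma frac_zero: "\<zero>\<^bsub>frac_field R\<^esub> = fr 0"
  using frac_embed_eq[of \<zero>] by (simp add: frac_field_def frac_embed_def j_zero)

lemma j_in_fractions: "a \<in> carrier R \<Longrightarrow> j a \<in> fractions"
  using fractionsI[OF _ one_neq_zero_R] by (simp add: j_one)

lemma fractions_closed:
  shows fractions_zero: "0 \<in> fractions" and fractions_one: "1 \<in> fractions"
    and fractions_add: "z \<in> fractions \<Longrightarrow> w \<in> fractions \<Longrightarrow> z + w \<in> fractions"
    and fractions_mult: "z \<in> fractions \<Longrightarrow> w \<in> fractions \<Longrightarrow> z * w \<in> fractions"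
    and fractions_uminus: "z \<in> fractions \<Longrightarrow> - z \<in> fractions"
proof -
  show "0 \<in> fractions" "1 \<in> fractions" using j_in_fractions[of \<zero>] j_in_fractions[of \<one>] by (simp_all add: j_zero j_one)
  show "z + w \<in> fractions" "z * w \<in> fractions" if zw: "z \<in> fractions" "w \<in> fractions"
  proof -
    obtain a b where z: "z = j a / j b" "a \<in> carrier R" "b \<in> carrier R - {\<zero>}" using zw(1) by (auto simp: fractions_def)
    obtain c d where w: "w = j c / j d" "c \<in> carrier R" "d \<in> carrier R - {\<zero>}" using zw(2) by (auto simp: fractions_def)
    have "z + w = j (a \<otimes> d \<oplus> c \<otimes> b) / j (b \<otimes> d)"
      using z w by (simp add: j_mult j_add add_frac_eq j_eq_0_iff)
    thus "z + w \<in> fractions" using z w j_nonzero_closed by (auto simp only: intro!: fractionsI)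
    have "z * w = j (a \<otimes> c) / j (b \<otimes> d)" using z w by (simp add: j_mult)
    thus "z * w \<in> fractions" using z w j_nonzero_closed by (auto simp only: intro!: fractionsI)
  qed
  show "- z \<in> fractions" if zw: "z \<in> fractions"
  proof -
    obtain a b where z: "z = j a / j b" "a \<in> carrier R" "b \<in> carrier R - {\<zero>}" using zw(1) by (auto simp: fractions_def)
    hence "- z = j (\<ominus> a) / j b" by (simp add: j_uminus)
    thus ?thesis using z fractionsI[of "\<ominus> a" b] by simp
  qed
qed

lemma subring_fractions: "subring fractions ring_of_type_algebra"
proof -
  interpret F: ring "ring_of_type_algebra :: 'f ring" by (rule ring_from_type_algebra)
  show ?thesis
  proof (rule F.subringI)
    fix z assume z: "z \<in> fractions"
    have "\<ominus>\<^bsub>ring_of_type_algebra\<^esub> z = - z" by (rule F.minus_equality) auto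
    thus "\<ominus>\<^bsub>ring_of_type_algebra\<^esub> z \<in> fractions" using z by (simp add: fractions_uminus)
  qed (auto simp: fractions_one fractions_mult fractions_add)
qed

lemma fr_ring_iso: "fr \<in> ring_iso (ring_of_type_algebra\<lparr>carrier := fractions\<rparr>) (frac_field R)"
  by (rule ring_iso_memI)
    (auto simp: carrier_frac_field frac_mult frac_add frac_one bij_betw_def fr_inj)

lemma ring_frac_field: "ring (frac_field R)"
proof -
  interpret F: ring "ring_of_type_algebra :: 'f ring" by (rule ring_from_type_algebra)
  \<comment> \<open>Transport along an isomorphism yields a ring whose zero is the image of 0; by
    \<open>frac_zero\<close> this is the original zero.\<close>
  have "ring (frac_field R\<lparr>ring.zero := fr 0\<rparr>)"
    using ring.ring_iso_imp_img_ring[OF F.subring_is_ring[OF subring_fractions] fr_ring_iso] by simp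
  thus ?thesis by (simp flip: frac_zero)
qed

lemma frac_power:
  assumes "z \<in> fractions"
  shows "fr z [^]\<^bsub>frac_field R\<^esub> n = fr (z ^ n) \<and> z ^ n \<in> fractions"
proof -
  interpret F: ring "frac_field R" by (rule ring_frac_field)
  show ?thesis
    by (induction n) (use assms in \<open>auto simp: frac_one fractions_closed frac_mult mult.commute\<close>)
qed

text \<open>\<open>ring.eval\<close> reads coefficients from the leading one down,
  \<open>Poly\<close> from the constant one up, hence \<open>rev\<close>.\<close>

lemma eval_frac:
  assumes "set zs \<subseteq> fractions" "z \<in> fractions"
  shows "ring.eval (frac_field R) (map fr zs) (fr z) = fr (poly (Poly (rev zs)) z) \<and>
    poly (Poly (rev zs)) z \<in> fractions"
proof -
  interpret F: ring "frac_field R" by (rule ring_frac_field)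
  show ?thesis
    using assms(1)
  proof (induction zs)
    case Nil
    thus ?case by (simp add: frac_zero fractions_zero)
  next
    case (Cons a zs)
    have "poly (Poly (rev (a # zs))) z = a * z ^ length zs + poly (Poly (rev zs)) z"
      by (simp add: Poly_append poly_monom)
    thus ?case using Cons frac_power[OF assms(2), of "length zs"]
      by (simp add: frac_mult frac_add fractions_closed)
  qed
qed

lemma integral_over_frac_iff:
  assumes z: "z \<in> fractions"
  shows "integral_over (frac_field R) (frac_embed R ` carrier R) (fr z) \<longleftrightarrow>
    (\<exists>p. poly.coeff p (Polynomial.degree p) = 1 \<and> (\<forall>i. poly.coeff p i \<in> j ` carrier R) \<and> poly p z = 0)"
proof -
  have embed: "frac_embed R ` carrier R = fr ` j ` carrier R"
    by (simp add: image_image frac_embed_eq)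
  have jC: "j ` carrier R \<subseteq> fractions" using j_in_fractions by blast
  show ?thesis
  proof
    assume "integral_over (frac_field R) (frac_embed R ` carrier R) (fr z)"
    then obtain ps where ps: "ps \<noteq> []" "set ps \<subseteq> fr ` j ` carrier R" "hd ps = fr 1"
      "ring.eval (frac_field R) ps (fr z) = fr 0"
      unfolding integral_over_def embed frac_one frac_zero by blast
    from ps(2) have "ps \<in> lists (fr ` (j ` carrier R))" by auto
    then obtain zs where zs: "ps = map fr zs" "set zs \<subseteq> j ` carrier R"
      unfolding lists_image[of fr "j ` carrier R"] by blast
    have ne: "zs \<noteq> []" using ps(1) zs(1) by simp
    have "hd zs \<in> fractions" using ne zs(2) jC by (meson hd_in_set subset_iff)
    moreover have "fr (hd zs) = fr 1" using ps(3) ne by (simp add: zs(1) hd_map)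
    ultimately have hd: "hd zs = 1" using fr_inj fractions_one by (auto dest: inj_onD)
    define p where "p = Poly (rev zs)"
    have "fr (poly p z) = fr 0" "poly p z \<in> fractions"
      using eval_frac[of zs z] zs jC z ps(4) by (auto simp: p_def)
    hence "poly p z = 0" using fr_inj fractions_zero by (auto dest: inj_onD)
    \<comment> \<open>The leading coefficient 1 ensures that no leading zeros are stripped from the
      list.\<close>
    have coeffs: "coeffs p = rev zs" unfolding p_def
      using hd ne by (cases zs) (auto simp: strip_while_def)
    hence "p \<noteq> 0" using ne by auto
    hence "poly.coeff p (Polynomial.degree p) = 1" using hd ne coeffs by (simp add: last_rev flip: last_coeffs_eq_coeff_degree)
    moreover have "poly.coeff p i \<in> j ` carrier R" for i
    proof (cases "poly.coeff p i = 0")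
      case True
      thus ?thesis using j_zero by (metis imageI zero_closed)
    next
      case False
      hence "poly.coeff p i \<in> set (coeffs p)" using range_coeff[of p] by auto
      thus ?thesis using coeffs zs(2) by auto
    qed
    ultimately show "\<exists>p. poly.coeff p (Polynomial.degree p) = 1 \<and> (\<forall>i. poly.coeff p i \<in> j ` carrier R) \<and> poly p z = 0"
      using \<open>poly p z = 0\<close> by blast
  next
    assume "\<exists>p. poly.coeff p (Polynomial.degree p) = 1 \<and> (\<forall>i. poly.coeff p i \<in> j ` carrier R) \<and> poly p z = 0"
    then obtain p where p: "poly.coeff p (Polynomial.degree p) = 1" "\<And>i. poly.coeff p i \<in> j ` carrier R" "poly p z = 0" by blast
    have "p \<noteq> 0" using p(1) by auto
    define zs where "zs = rev (coeffs p)"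
    have "set (coeffs p) \<subseteq> range (poly.coeff p)" using range_coeff[of p] by blast
    hence sub: "set zs \<subseteq> j ` carrier R" using p(2) by (auto simp: zs_def)
    have ne: "zs \<noteq> []" using \<open>p \<noteq> 0\<close> by (simp add: zs_def)
    have "hd zs = 1" using \<open>p \<noteq> 0\<close> p(1) by (simp add: zs_def hd_rev last_coeffs_eq_coeff_degree)
    moreover have "ring.eval (frac_field R) (map fr zs) (fr z) = fr 0"
      using eval_frac[of zs z] sub jC z p(3) by (auto simp: zs_def)
    ultimately show "integral_over (frac_field R) (frac_embed R ` carrier R) (fr z)"
      unfolding integral_over_def embed frac_one frac_zero using sub ne
      by (intro exI[of _ "map fr zs"]) (auto simp: hd_map)
  qed
qed

end

section \<open>The algebra $B_{k,P}$\<close>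

locale B_algebra =
  fixes k :: nat and P :: "complex poly"
  assumes k_pos: "1 \<le> k" and P_nonzero: "P \<noteq> 0"
begin

definition \<psi> :: "poly3 \<Rightarrow> laurent" where
  "\<psi> g = poly (map_poly (to_laurent to_fract) g) (Poly_Mapping.single (- int k) (to_fract P))"

lemma unital_hom_psi: "unital_hom \<psi>"
  unfolding \<psi>_def by (intro unital_hom_poly_map_poly unital_hom_to_laurent unital_hom_to_fract)

lemmas psi_simps = unital_hom_simps[OF unital_hom_psi]

lemma psi_pCons: "\<psi> (pCons h g) =
    to_laurent to_fract h + Poly_Mapping.single (- int k) (to_fract P) * \<psi> g"
  by (simp add: \<psi>_def map_poly_pCons unital_hom_zero[OF unital_hom_to_laurent[OF unital_hom_to_fract]])

lemma psi_const: "\<psi> [:h:] = to_laurent to_fract h"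
  by (simp add: psi_pCons psi_simps)

lemma psi_monom: "\<psi> [:Polynomial.monom p n:] = Poly_Mapping.single (int n) (to_fract p)"
  by (simp add: psi_const to_laurent_monom unital_hom_to_fract)

lemma psi_s_const: "\<psi> (s_const p) = Poly_Mapping.single 0 (to_fract p)"
  using psi_monom[of p 0] by (simp add: s_const_def monom_0)

lemma psi_u_var: "\<psi> u_var = Poly_Mapping.single 1 1"
  using psi_monom[of 1 1] by (simp add: u_var_def monom_Suc monom_0)

lemma psi_v_var: "\<psi> v_var = Poly_Mapping.single (- int k) (to_fract P)"
proof -
  have v: "v_var = pCons 0 1" by (simp add: v_var_def one_pCons)
  show ?thesis unfolding v
    by (simp add: psi_pCons psi_simps unital_hom_zero[OF unital_hom_to_laurent[OF unital_hom_to_fract]])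
qed

definition relation :: poly3 where
  "relation = u_var ^ k * v_var - s_const P"

lemma psi_relation: "\<psi> relation = 0"
  by (simp add: relation_def psi_simps psi_u_var psi_v_var psi_s_const single_power mult_single)

text \<open>Modulo the relation, a power of \<open>u\<close> times any polynomial is free of \<open>v\<close>, where \<open>\<psi>\<close> is injective;
  and \<open>u\<close> can be cancelled because \<open>P\<close> is nonzero. So the kernel of \<open>\<psi>\<close> is generated by the relation.\<close>

lemma eliminate_v: "\<exists>N h r. u_var ^ N * g = [:h:] + relation * r"
proof (induction g)
  case 0
  show ?case by (intro exI[of _ 0]) simp
next
  case (pCons g0 g)
  then obtain N h r where IH: "u_var ^ N * g = [:h:] + relation * r" by blast
  have g: "pCons g0 g = [:g0:] + v_var * g" by (simp add: v_var_def)
  have u: "u_var ^ i = [:[:0, 1:] ^ i:]" for i by (simp add: u_var_def poly_const_pow)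
  have uv: "u_var ^ k * v_var = s_const P + relation" by (simp add: relation_def)
  have "u_var ^ (N + k) * pCons g0 g = u_var ^ (N + k) * [:g0:] + (u_var ^ k * v_var) * (u_var ^ N * g)"
    unfolding g by (simp add: algebra_simps power_add)
  also have "\<dots> = (u_var ^ (N + k) * [:g0:] + s_const P * [:h:]) + relation * ([:h:] + (s_const P + relation) * r)"
    unfolding IH uv by (simp add: algebra_simps)
  also have "u_var ^ (N + k) * [:g0:] + s_const P * [:h:] = [:[:0, 1:] ^ (N + k) * g0 + [:P:] * h:]"
    by (simp add: u s_const_def)
  finally show ?case by blast
qed

text \<open>Since \<open>k\<close> is positive, the relation is -P modulo u, and a nonzero
  polynomial in s is not a zero divisor modulo u. The argument is carried out for each coefficient
  in v.\<close>

lemma u_var_dvd_cancel: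
  assumes "u_var * g = relation * q"
  shows "u_var dvd q"
proof -
  let ?u = "[:0, 1:] :: complex poly poly"
  have u: "u_var = [:?u:]" by (simp add: u_var_def)
  have "?u dvd coeff q n" for n
  proof -
    \<comment> \<open>The coefficient of \<open>v_var * q\<close> at \<open>n\<close>, hence zero
      for \<open>n = 0\<close>.\<close>
    define cs where "cs = (case n of 0 \<Rightarrow> 0 | Suc i \<Rightarrow> coeff q i)"
    have "relation * q = pCons 0 (smult (?u ^ k) q) + smult [:- P:] q"
      by (simp add: relation_def u v_var_def s_const_def poly_const_pow left_diff_distrib)
    hence "?u * coeff g n = ?u ^ k * cs + [:- P:] * coeff q n"
      using arg_cong[OF assms, of "\<lambda>p. coeff p n"] by (simp add: u cs_def coeff_pCons split: nat.splits)
    hence "[:- P:] * coeff q n = ?u * coeff g n - ?u ^ k * cs" by simp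
    moreover have "?u dvd ?u ^ k" using k_pos by (intro dvd_power) auto
    ultimately have "?u dvd [:- P:] * coeff q n" by (metis dvd_diff dvd_mult2 dvd_triv_left)
    then obtain c where "[:- P:] * coeff q n = ?u * c" by (rule dvdE)
    hence "coeff ([:- P:] * coeff q n) 0 = coeff (?u * c) 0" by (simp only:)
    hence "coeff (coeff q n) 0 = 0" using P_nonzero by simp
    moreover obtain a c where "coeff q n = pCons a c" by (rule pCons_cases)
    ultimately have "coeff q n = ?u * c" by simp
    thus ?thesis by (rule dvdI)
  qed
  thus ?thesis unfolding u const_poly_dvd_iff by blast
qed

lemma u_var_power_dvd_cancel:
  assumes "u_var ^ N * g = relation * q"
  shows "relation dvd g"
  using assms
proof (induction N arbitrary: q)
  case (Suc N)
  then obtain q' where q': "q = u_var * q'" using u_var_dvd_cancel[of "u_var ^ N * g" q]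
    by (auto simp: mult.assoc elim: dvdE)
  hence "u_var * (u_var ^ N * g) = u_var * (relation * q')" using Suc.prems by (simp add: mult_ac)
  moreover have "u_var \<noteq> 0" by (simp add: u_var_def)
  ultimately have "u_var ^ N * g = relation * q'" by (metis mult_left_cancel)
  thus ?case by (rule Suc.IH)
qed auto

lemma psi_eq_0_iff: "\<psi> g = 0 \<longleftrightarrow> relation dvd g"
proof
  assume *: "\<psi> g = 0"
  obtain N h r where eq: "u_var ^ N * g = [:h:] + relation * r" using eliminate_v by blast
  have "to_laurent to_fract h = (0 :: laurent)"
    using arg_cong[OF eq, of \<psi>] * by (simp add: psi_simps psi_const psi_relation)
  hence "h = 0" by (simp add: to_laurent_eq_0_iff unital_hom_to_fract inj_def)
  thus "relation dvd g" using eq u_var_power_dvd_cancel[of N g r] by simp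
qed (auto elim!: dvdE simp: psi_simps psi_relation)

lemma B_ideal_eq: "B_ideal k P = {g. \<psi> g = 0}"
  by (auto simp: B_ideal_def cgenideal_def psi_eq_0_iff dvd_def mult.commute relation_def)

lemma B_class_eq: "B_class k P g = {h. \<psi> h = \<psi> g}"
proof -
  have "h \<in> B_class k P g \<longleftrightarrow> (\<exists>x. \<psi> x = 0 \<and> h = x + g)" for h
    by (auto simp: B_class_def a_r_coset_def' B_ideal_eq)
  moreover have "(\<exists>x. \<psi> x = 0 \<and> h = x + g) \<longleftrightarrow> \<psi> h = \<psi> g" for h
    by (auto simp: psi_simps intro!: exI[of _ "h - g"])
  ultimately show ?thesis by blast
qed

section \<open>The quotient ring and its embedding into a field\<close>

lemma carrier_B_ring: "carrier (B_ring k P) = range (B_class k P)"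
  by (auto simp: B_ring_def FactRing_def A_RCOSETS_def' B_class_def)

lemma ideal_B_ideal: "ideal (B_ideal k P) poly3_ring"
  unfolding B_ideal_def by (intro cring.cgenideal_ideal cring_from_type_algebra) auto

lemma cring_B_ring: "cring (B_ring k P)"
  unfolding B_ring_def by (intro ideal.quotient_is_cring ideal_B_ideal cring_from_type_algebra)

lemma B_class_hom: "B_class k P \<in> ring_hom poly3_ring (B_ring k P)"
  using ideal.rcos_ring_hom[OF ideal_B_ideal] by (simp add: B_ring_def B_class_def[abs_def])

lemma B_class_add: "B_class k P g \<oplus>\<^bsub>B_ring k P\<^esub> B_class k P h = B_class k P (g + h)"
  and B_class_mult: "B_class k P g \<otimes>\<^bsub>B_ring k P\<^esub> B_class k P h = B_class k P (g * h)"
  and B_class_one: "\<one>\<^bsub>B_ring k P\<^esub> = B_class k P 1"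
  using B_class_hom by (auto simp: ring_hom_def)

text \<open>\<open>\<psi>\<close> is constant on each coset, so the image is a singleton.\<close>

definition B_embed :: "poly3 set \<Rightarrow> laurent fract" where
  "B_embed b = to_fract (the_elem (\<psi> ` b))"

lemma B_embed_class: "B_embed (B_class k P g) = to_fract (\<psi> g)"
proof -
  have "\<psi> ` B_class k P g = {\<psi> g}" by (auto simp: B_class_eq)
  thus ?thesis by (simp add: B_embed_def)
qed

sublocale fraction_model "B_ring k P" B_embed
proof (rule fraction_model.intro[OF cring.axioms(1)[OF cring_B_ring]], unfold_locales)
  show "B_embed \<one>\<^bsub>B_ring k P\<^esub> = 1" by (simp add: B_class_one B_embed_class psi_simps)
  show "inj_on B_embed (carrier (B_ring k P))"
  proof (rule inj_onI)
    fix x y assume "x \<in> carrier (B_ring k P)" "y \<in> carrier (B_ring k P)" "B_embed x = B_embed y"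
    then obtain g h where "x = B_class k P g" "y = B_class k P h" "\<psi> g = \<psi> h"
      by (auto simp: carrier_B_ring B_embed_class)
    thus "x = y" by (simp add: B_class_eq)
  qed
qed (auto simp: carrier_B_ring B_class_add B_class_mult B_embed_class psi_simps)

lemma B_zero: "\<zero>\<^bsub>B_ring k P\<^esub> = B_class k P 0"
proof -
  have "B_embed (B_class k P 0) = B_embed \<zero>\<^bsub>B_ring k P\<^esub>"
    by (simp add: B_embed_class psi_simps j_zero)
  moreover have "B_class k P 0 \<in> carrier (B_ring k P)" by (simp add: carrier_B_ring)
  ultimately show ?thesis using j_inj by (metis inj_onD zero_closed)
qed

lemma B_class_in_nonzero_iff: "B_class k P g \<in> carrier (B_ring k P) - {\<zero>\<^bsub>B_ring k P\<^esub>} \<longleftrightarrow> \<psi> g \<noteq> 0"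
  by (auto simp: carrier_B_ring B_zero B_class_eq psi_simps)

lemma fr_eq: "fr z = {(B_class k P g, B_class k P h) | g h. \<psi> h \<noteq> 0 \<and> to_fract (\<psi> g) = z * to_fract (\<psi> h)}"
proof -
  have "(c, d) \<in> fr z \<longleftrightarrow> (\<exists>g h. c = B_class k P g \<and> d = B_class k P h \<and> \<psi> h \<noteq> 0 \<and>
      to_fract (\<psi> g) = z * to_fract (\<psi> h))" for c d
  proof -
    have "(c, d) \<in> fr z \<longleftrightarrow> (\<exists>g h. c = B_class k P g \<and> d = B_class k P h \<and> \<psi> h \<noteq> 0 \<and>
      to_fract (\<psi> g) / to_fract (\<psi> h) = z)"
      unfolding fr_def using B_class_in_nonzero_iff
      by (auto simp: carrier_B_ring B_embed_class) (metis B_embed_class)+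
    also have "\<dots> \<longleftrightarrow> (\<exists>g h. c = B_class k P g \<and> d = B_class k P h \<and> \<psi> h \<noteq> 0 \<and>
      to_fract (\<psi> g) = z * to_fract (\<psi> h))"
      by (metis divide_eq_eq to_fract_eq_0_iff)
    finally show ?thesis .
  qed
  thus ?thesis by auto
qed

lemma fractions_eq: "fractions = {to_fract (\<psi> g) / to_fract (\<psi> h) | g h. \<psi> h \<noteq> 0}"
proof -
  have "fractions = {B_embed (B_class k P g) / B_embed (B_class k P h) | g h.
      B_class k P h \<in> carrier (B_ring k P) - {\<zero>\<^bsub>B_ring k P\<^esub>}}"
    unfolding fractions_def by (auto simp: carrier_B_ring)
  thus ?thesis unfolding B_class_in_nonzero_iff B_embed_class .
qed

lemma B_image_eq: "B_embed ` carrier (B_ring k P) = to_fract ` range \<psi>"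
  by (auto simp: carrier_B_ring image_image B_embed_class)

text \<open>Denominators of coefficients and negative powers of u are cleared by elements q u^M,
  which come from C[s][u]. Hence the fraction field of \<open>B_ring k P\<close> contains all of
  C(s)[u, 1/u].\<close>

lemma laurent_times_psi: "\<exists>g h. \<psi> h \<noteq> 0 \<and> F * \<psi> h = \<psi> g"
proof (induction F rule: poly_mapping_single_add_induct)
  case (single n f)
  obtain p q where f: "f = Fract p q" "q \<noteq> 0" by (cases f) auto
  define M where "M = nat (- n)"
  have "f * to_fract q = to_fract p" using f by (simp add: Fract_conv_to_fract)
  hence "Poly_Mapping.single n f * \<psi> [:Polynomial.monom q M:] = \<psi> [:Polynomial.monom p (nat (n + int M)):]"
    by (simp add: psi_monom mult_single M_def)
  moreover have "\<psi> [:Polynomial.monom q M:] \<noteq> 0"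
    unfolding psi_monom using f(2) by (metis lookup_single_eq lookup_zero to_fract_eq_0_iff)
  ultimately show ?case by blast
next
  case (add F G)
  then obtain a b c d where ab: "\<psi> b \<noteq> 0" "F * \<psi> b = \<psi> a" and cd: "\<psi> d \<noteq> 0" "G * \<psi> d = \<psi> c"
    by blast
  have "(F + G) * \<psi> (b * d) = (F * \<psi> b) * \<psi> d + (G * \<psi> d) * \<psi> b"
    by (simp add: psi_simps algebra_simps)
  also have "\<dots> = \<psi> (a * d + c * b)" by (simp add: ab cd psi_simps)
  finally have "(F + G) * \<psi> (b * d) = \<dots>" .
  moreover have "\<psi> (b * d) \<noteq> 0" using ab cd by (simp add: psi_simps)
  ultimately show ?case by blast
qed

lemma laurent_in_fractions: "to_fract F \<in> fractions"
proof -
  obtain g h where "\<psi> h \<noteq> 0" "F * \<psi> h = \<psi> g" using laurent_times_psi by blast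
  hence "to_fract F = to_fract (\<psi> g) / to_fract (\<psi> h)"
    by (metis eq_divide_imp to_fract_eq_0_iff to_fract_mult)
  thus ?thesis using \<open>\<psi> h \<noteq> 0\<close> by (auto simp: fractions_eq)
qed

end

section \<open>The normalization $A_{k,P}$\<close>

lemma unital_hom_sum: "unital_hom f \<Longrightarrow> f (\<Sum>i\<in>I. g i) = (\<Sum>i\<in>I. f (g i))"
  by (induction I rule: infinite_finite_induct) (auto simp: unital_hom_zero unital_hom_add)

lemma unital_hom_prod: "unital_hom f \<Longrightarrow> f (\<Prod>i\<in>I. g i) = (\<Prod>i\<in>I. f (g i))"
  by (induction I rule: infinite_finite_induct) (auto simp: unital_hom_one unital_hom_mult)

lemma unital_hom_map_poly:
  assumes f: "unital_hom f"
  shows "unital_hom (map_poly f)"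
  using f by (intro unital_homI poly_eqI)
    (auto simp: coeff_map_poly unital_hom_zero unital_hom_add coeff_mult unital_hom_sum unital_hom_mult
      map_poly_1' unital_hom_one)

lemma poly_map_poly_hom: "unital_hom f \<Longrightarrow> poly (map_poly f p) (f x) = f (poly p x)"
  by (induction p) (auto simp: map_poly_pCons unital_hom_zero unital_hom_add unital_hom_mult)

lemma sum_single_lookup:
  "F = (\<Sum>n\<in>Poly_Mapping.keys F. Poly_Mapping.single n (Poly_Mapping.lookup F n))"
proof (rule poly_mapping_eqI)
  fix m
  have "(\<Sum>n\<in>Poly_Mapping.keys F. Poly_Mapping.lookup (Poly_Mapping.single n (Poly_Mapping.lookup F n)) m) =
        (\<Sum>n\<in>Poly_Mapping.keys F. if n = m then Poly_Mapping.lookup F m else 0)"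
    by (intro sum.cong) (auto simp: lookup_single when_def)
  thus "Poly_Mapping.lookup F m =
      Poly_Mapping.lookup (\<Sum>n\<in>Poly_Mapping.keys F. Poly_Mapping.single n (Poly_Mapping.lookup F n)) m"
    by (simp add: lookup_sum in_keys_iff)
qed

lemma primitive_root_powi_eq_1_iff:
  assumes "primitive_root_of_unity d z" "d > 0"
  shows "z powi n = 1 \<longleftrightarrow> int d dvd n"
proof (cases "n \<ge> 0")
  case True
  thus ?thesis using primitive_root_power_eq_1_iff[OF assms, of "nat n"] by (simp add: power_int_def nat_dvd_iff int_dvd_int_iff[symmetric])
next
  case False
  thus ?thesis using primitive_root_power_eq_1_iff[OF assms, of "nat (- n)"]
    by (simp add: power_int_def power_inverse int_dvd_int_iff[symmetric])
qed

lemma primitive_root_exists: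
  assumes "k > 0"
  shows "\<exists>z. primitive_root_of_unity k z"
proof -
  define z where "z = cis (2 * pi / real k)"
  have "z ^ j = cis (2 * pi * real j / real k)" for j by (simp add: z_def DeMoivre mult_ac)
  moreover have "cis (2 * pi * real j / real k) \<noteq> 1" if "0 < j" "j < k" for j
  proof
    assume "cis (2 * pi * real j / real k) = 1"
    hence "cos (2 * pi * real j / real k) = 1" by (metis cis.sel(1) one_complex.sel(1))
    then obtain m :: int where "2 * pi * real j / real k = of_int m * 2 * pi"
      by (auto simp: cos_one_2pi_int)
    hence "real j = of_int m * real k" using assms by (simp add: field_simps)
    hence "int j = m * int k" by (metis of_int_eq_iff of_int_mult of_int_of_nat_eq)
    hence "int k dvd int j" by simp
    hence "k dvd j" by simp
    thus False using that by (auto dest: dvd_imp_le)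
  qed
  ultimately have "primitive_root_of_unity k z"
    using assms by (auto simp: primitive_root_of_unity_def)
  thus ?thesis by blast
qed

text \<open>The divisor -div(f)/k. The finite support that \<open>Abs_poly_mapping\<close> demands
  is available for nonzero \<open>f\<close>.\<close>

definition root_divisor :: "nat \<Rightarrow> complex poly fract \<Rightarrow> q_divisor" where
  "root_divisor k f = Abs_poly_mapping (\<lambda>a. - of_int (ord_at a f) / of_nat k)"

lemma lookup_root_divisor:
  assumes "f \<noteq> 0"
  shows "Poly_Mapping.lookup (root_divisor k f) a = - of_int (ord_at a f) / of_nat k"
proof -
  have "finite {a. - of_int (ord_at a f) / of_nat k \<noteq> (0 :: rat)}"
    by (rule finite_subset[OF _ finite_ord_at_nonzero[OF assms]]) auto
  thus ?thesis by (simp add: root_divisor_def)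
qed

context B_algebra
begin

abbreviation A_coeffs :: "int \<Rightarrow> complex poly fract set" where
  "A_coeffs \<equiv> dpd_coeffs 0 (root_divisor k (to_fract P))"

lemma A_slope: "slope 0 (root_divisor k (to_fract P)) n a =
    (if 0 \<le> n then 0 else of_int (n * ord_at a (to_fract P)) / of_nat k)"
  by (simp add: slope_def lookup_root_divisor P_nonzero)

sublocale A: graded_coeffs_closed A_coeffs
  by (rule graded_coeffs_closed_dpd)
    (use P_nonzero in \<open>auto simp: lookup_root_divisor ord_at_to_fract divide_nonpos_nonneg\<close>)

lemma polynomial_in_A_coeffs: "n \<ge> 0 \<Longrightarrow> to_fract p \<in> A_coeffs n"
  by (auto simp: dpd_coeffs_iff A_slope ord_at_to_fract)

lemma psi_in_A: "\<psi> g \<in> A.laurents"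
proof (induction g)
  case 0
  thus ?case by (simp add: psi_simps A.laurents_zero)
next
  case (pCons h g)
  have "to_laurent to_fract h \<in> A.laurents"
    using polynomial_in_A_coeffs
    by (auto simp: A.laurents_def lookup_to_laurent unital_hom_to_fract A.coeffs_zero)
  moreover have "to_fract P \<in> A_coeffs (- int k)"
    using k_pos by (auto simp: dpd_coeffs_iff A_slope)
  ultimately show ?case using pCons.IH
    by (auto simp: psi_pCons A.single_in_laurents_iff intro!: A.laurents_add A.laurents_mult)
qed

section \<open>Integral and almost integral elements\<close>

lemma psi_range_closed:
  assumes "x \<in> to_fract ` range \<psi>" "y \<in> to_fract ` range \<psi>"
  shows "x + y \<in> to_fract ` range \<psi>" "x * y \<in> to_fract ` range \<psi>" "- x \<in> to_fract ` range \<psi>"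
proof -
  obtain g h where "x = to_fract (\<psi> g)" "y = to_fract (\<psi> h)" using assms by blast
  hence "x + y = to_fract (\<psi> (g + h))" "x * y = to_fract (\<psi> (g * h))" "- x = to_fract (\<psi> (- g))"
    by (simp_all add: psi_simps)
  thus "x + y \<in> to_fract ` range \<psi>" "x * y \<in> to_fract ` range \<psi>" "- x \<in> to_fract ` range \<psi>"
    by blast+
qed

lemma psi_range_sum:
  "(\<And>i. i \<in> I \<Longrightarrow> f i \<in> to_fract ` range \<psi>) \<Longrightarrow> (\<Sum>i\<in>I. f i) \<in> to_fract ` range \<psi>"
proof (induction I rule: infinite_finite_induct)
  case (insert i I)
  thus ?case by (simp add: psi_range_closed)
qed (use psi_simps(4) in \<open>force+\<close>)

text \<open>With \<open>N\<close> the degree of the equation, h^N clears the denominators of z^i for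
  i < N, and the equation expresses every higher power through the \<open>N\<close> preceding
  ones.\<close>

lemma integral_imp_almost_integral:
  assumes z: "z \<in> fractions" and p: "lead_coeff p = 1" "\<And>i. poly.coeff p i \<in> to_fract ` range \<psi>" "poly p z = 0"
  shows "\<exists>c. \<psi> c \<noteq> 0 \<and> (\<forall>i. to_fract (\<psi> c) * z ^ i \<in> to_fract ` range \<psi>)"
proof -
  obtain g h where gh: "\<psi> h \<noteq> 0" "z = to_fract (\<psi> g) / to_fract (\<psi> h)"
    using z by (auto simp: fractions_eq)
  define N where "N = Polynomial.degree p"
  define c where "c = h ^ N"
  have zN: "z ^ N = - (\<Sum>l<N. poly.coeff p l * z ^ l)"
  proof -
    have "0 = (\<Sum>l\<le>N. poly.coeff p l * z ^ l)" using p(3) by (simp add: poly_altdef N_def)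
    also have "\<dots> = (\<Sum>l<N. poly.coeff p l * z ^ l) + z ^ N"
      using p(1) by (simp add: N_def flip: lessThan_Suc_atMost)
    finally show ?thesis by (simp add: eq_neg_iff_add_eq_0 add.commute)
  qed
  have "to_fract (\<psi> c) * z ^ i \<in> to_fract ` range \<psi>" for i
  proof (induction i rule: less_induct)
    case (less i)
    show ?case
    proof (cases "i < N")
      case True
      have "to_fract (\<psi> c) * z ^ i = to_fract (\<psi> (g ^ i * h ^ (N - i)))"
      proof -
        have "to_fract (\<psi> c) = to_fract (\<psi> h) ^ i * to_fract (\<psi> h) ^ (N - i)"
          using True by (simp add: c_def psi_simps unital_hom_power[OF unital_hom_to_fract] flip: power_add)
        thus ?thesis using gh
          by (simp add: psi_simps unital_hom_power[OF unital_hom_to_fract] power_divide)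
      qed
      thus ?thesis by blast
    next
      case False
      have "to_fract (\<psi> c) * z ^ i = to_fract (\<psi> c) * z ^ (i - N) * z ^ N"
        using False by (simp add: mult.assoc flip: power_add)
      also have "\<dots> = - (\<Sum>l<N. poly.coeff p l * (to_fract (\<psi> c) * z ^ (i - N + l)))"
        unfolding zN by (simp add: sum_distrib_left power_add mult_ac)
      also have "\<dots> \<in> to_fract ` range \<psi>"
      proof -
        have "(\<Sum>l<N. poly.coeff p l * (to_fract (\<psi> c) * z ^ (i - N + l))) \<in> to_fract ` range \<psi>"
          using False by (intro psi_range_sum psi_range_closed p(2) less.IH) auto
        thus ?thesis using psi_range_closed(3) by blast
      qed
      finally show ?thesis .
    qed
  qed
  moreover have "\<psi> c \<noteq> 0" using gh by (simp add: c_def psi_simps)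
  ultimately show ?thesis by blast
qed

lemma almost_integral_imp_in_A:
  assumes c: "\<psi> c \<noteq> 0" and z: "\<And>i. to_fract (\<psi> c) * z ^ i \<in> to_fract ` range \<psi>"
  shows "z \<in> to_fract ` A.laurents"
proof -
  have "\<exists>F. z = to_fract F"
    by (rule laurent_completely_integrally_closed[OF c]) (use z in blast)
  then obtain F where F: "z = to_fract F" by blast
  have "\<psi> c * F ^ i \<in> A.laurents" for i
  proof -
    obtain g where "to_fract (\<psi> c * F ^ i) = to_fract (\<psi> g)"
      using z[of i] by (auto simp: F unital_hom_power[OF unital_hom_to_fract])
    hence "\<psi> c * F ^ i = \<psi> g" by (simp only: to_fract_eq_iff)
    thus ?thesis using psi_in_A by simp
  qed
  hence "F \<in> A.laurents" by (rule A.laurents_completely_integrally_closed[OF c])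
  thus ?thesis using F by blast
qed

text \<open>A coefficient in degree -k r has order at least r ord P everywhere, so it is a
  polynomial times P^r, and its term is a polynomial in s times the image of v^r. Divisibility of
  the degree by \<open>k\<close> makes the exponent r an integer.\<close>

lemma veronese_in_range:
  assumes F: "F \<in> A.laurents" and k: "\<And>n. Poly_Mapping.lookup F n \<noteq> 0 \<Longrightarrow> int k dvd n"
  shows "F \<in> range \<psi>"
proof -
  have "Poly_Mapping.single n (Poly_Mapping.lookup F n) \<in> range \<psi>" for n
  proof (cases "Poly_Mapping.lookup F n = 0")
    case True
    thus ?thesis using psi_simps(4) by (metis rangeI single_zero)
  next
    case False
    define f where "f = Poly_Mapping.lookup F n"
    have f: "f \<noteq> 0" "f \<in> A_coeffs n" using False F by (auto simp: f_def A.laurents_def)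
    \<comment> \<open>\<open>nat (- n)\<close> is 0 for nonnegative \<open>n\<close>, so that then
      \<open>r = 0\<close> and both signs share the preimage p u^(nat n) v^r.\<close>
    have "int k dvd int (nat (- n))" using k[OF False] by (cases "n \<ge> 0") auto
    hence "k dvd nat (- n)" by (simp only: int_dvd_int_iff)
    then obtain r where r: "nat (- n) = k * r" by (rule dvdE)
    have nr: "int (nat (- n)) = int k * int r" by (simp only: r of_nat_mult)
    have "0 \<le> ord_at a (f / to_fract P ^ r)" for a
    proof (cases "n \<ge> 0")
      case True
      hence "r = 0" using r k_pos by simp
      thus ?thesis using f True by (auto simp: dpd_coeffs_iff A_slope)
    next
      case neg: False
      hence n: "n = - (int k * int r)" using nr by simp
      have "0 \<le> of_int (ord_at a f) + (of_int (n * ord_at a (to_fract P)) / of_nat k :: rat)"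
        using f neg by (auto simp: dpd_coeffs_iff A_slope)
      also have "(of_int (n * ord_at a (to_fract P)) / of_nat k :: rat) = of_int (- int r * ord_at a (to_fract P))"
        using k_pos by (simp add: n)
      finally have "0 \<le> (of_int (ord_at a f + - int r * ord_at a (to_fract P)) :: rat)"
        by (simp only: of_int_add)
      hence "0 \<le> ord_at a f - int r * ord_at a (to_fract P)" by (simp only: of_int_0_le_iff)
      thus ?thesis using f P_nonzero by (simp add: ord_at_divide ord_at_power)
    qed
    then obtain p where p: "f / to_fract P ^ r = to_fract p" using polynomial_if_ord_at_nonneg by blast
    hence fp: "f = to_fract p * to_fract P ^ r" using P_nonzero by (simp add: field_simps)
    have n: "int (nat n) + int r * - int k = n" using nr by (cases "0 \<le> n") (auto simp: algebra_simps)
    have "\<psi> ([:Polynomial.monom p (nat n):] * v_var ^ r) = Poly_Mapping.single n f"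
      by (simp only: psi_simps psi_monom psi_v_var single_power mult_single n fp)
    hence "Poly_Mapping.single n f \<in> range \<psi>" by (metis rangeI)
    thus ?thesis by (simp add: f_def)
  qed
  hence "to_fract (\<Sum>n\<in>Poly_Mapping.keys F. Poly_Mapping.single n (Poly_Mapping.lookup F n)) \<in> to_fract ` range \<psi>"
    unfolding to_fract_sum by (intro psi_range_sum) blast
  thus ?thesis by (simp add: inj_image_mem_iff inj_def flip: sum_single_lookup)
qed

lemma A_laurents_coeff_mult:
  assumes "\<And>i. poly.coeff p i \<in> A.laurents" "\<And>i. poly.coeff q i \<in> A.laurents"
  shows "poly.coeff (p * q) i \<in> A.laurents"
  using assms by (simp add: coeff_mult A.laurents_sum A.laurents_mult)

text \<open>The product of the factors \<open>X - F(\<omega>\<^sup>j u)\<close> over the \<open>k\<close>-th roots of unity has coefficients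
  invariant under \<open>u \<mapsto> \<omega> u\<close>, so they only involve degrees divisible by \<open>k\<close>, where the
  normalization agrees with the ring itself.\<close>

lemma in_A_imp_integral:
  assumes F: "F \<in> A.laurents"
  shows "\<exists>p. lead_coeff p = 1 \<and> (\<forall>i. poly.coeff p i \<in> to_fract ` range \<psi>) \<and> poly p (to_fract F) = 0"
proof -
  obtain \<omega> where \<omega>: "primitive_root_of_unity k \<omega>" using primitive_root_exists k_pos by fastforce
  have \<omega>k: "\<omega> ^ k = 1" using \<omega> unfolding primitive_root_of_unity_def by blast
  hence \<omega>0: "\<omega> \<noteq> 0" using k_pos by (auto simp: zero_power)
  define w where "w = (to_fract [:\<omega>:] :: complex poly fract)"
  have w0: "w \<noteq> 0" using \<omega>0 by (simp add: w_def)
  have const_hom: "unital_hom (\<lambda>c :: complex. to_fract [:c:])"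
  proof (rule unital_homI)
    show "to_fract [:1 :: complex:] = 1" using to_fract_1[where ?'a = "complex poly"] by (simp only: one_pCons)
  qed (simp_all flip: to_fract_add to_fract_mult)
  have wp: "w ^ j = to_fract [:\<omega> ^ j:]" for j
    using unital_hom_power[OF const_hom, of \<omega> j] by (simp add: w_def)
  have wpi: "w powi n = to_fract [:\<omega> powi n:]" for n
    using unital_hom_powi[OF const_hom, of \<omega> n] by (simp add: w_def)
  have wk: "w ^ k = 1" by (simp add: wp \<omega>k unital_hom_one[OF const_hom])
  have id: "unital_hom (\<lambda>x :: complex poly fract. x)" by (simp add: unital_hom_def)
  define \<alpha> where "\<alpha> j = twist (\<lambda>x. x) (w ^ j)" for j :: nat
  have hom: "unital_hom (\<alpha> j)" for j
    unfolding \<alpha>_def using w0 by (intro unital_hom_twist id) auto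
  have \<alpha>1: "\<alpha> 1 (\<alpha> j G) = \<alpha> (Suc j) G" for j G
    by (rule poly_mapping_eqI) (simp add: \<alpha>_def lookup_twist[OF id] power_int_mult_distrib mult_ac)
  have \<alpha>0: "\<alpha> 0 G = G" for G
    by (rule poly_mapping_eqI) (simp add: \<alpha>_def lookup_twist[OF id])
  have \<alpha>k: "\<alpha> k G = G" for G
    by (rule poly_mapping_eqI) (simp add: \<alpha>_def lookup_twist[OF id] wk)
  \<comment> \<open>A twist by a root of unity multiplies each coefficient by a constant, an element
    of degree 0.\<close>
  have \<alpha>A: "\<alpha> j F \<in> A.laurents" for j
  proof -
    have "Poly_Mapping.lookup F n * (w ^ j) powi n \<in> A_coeffs (n + 0)" for n
    proof (rule A.coeffs_mult)
      show "Poly_Mapping.lookup F n \<in> A_coeffs n" using F by (simp add: A.laurents_def)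
      have "(w ^ j) powi n = to_fract [:(\<omega> ^ j) powi n:]"
        using unital_hom_powi[OF const_hom, of "\<omega> ^ j" n] by (simp add: wp)
      thus "(w ^ j) powi n \<in> A_coeffs 0" using polynomial_in_A_coeffs by simp
    qed
    thus ?thesis by (simp add: A.laurents_def \<alpha>_def lookup_twist[OF id])
  qed
  define f where "f j = [:- \<alpha> j F, 1:]" for j
  define p where "p = (\<Prod>j<k. f j)"
  obtain k' where k': "k = Suc k'" using k_pos by (cases k) auto
  have "map_poly (\<alpha> 1) p = (\<Prod>j<k. map_poly (\<alpha> 1) (f j))"
    unfolding p_def by (rule unital_hom_prod[OF unital_hom_map_poly[OF hom]])
  also have "\<dots> = (\<Prod>j<k. f (Suc j))"
    by (intro prod.cong)
      (auto simp: f_def map_poly_pCons unital_hom_simps[OF hom] \<alpha>1 simp del: One_nat_def)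
  also have "\<dots> = p"
  proof -
    \<comment> \<open>The twist permutes the factors cyclically, because
      \<open>\<omega> ^ k = 1\<close>.\<close>
    have "f k = f 0" by (simp add: f_def \<alpha>0 \<alpha>k)
    hence "(\<Prod>j<k. f (Suc j)) = f 0 * (\<Prod>j<k'. f (Suc j))" by (simp add: k' mult.commute)
    also have "\<dots> = p" by (simp add: p_def k' prod.lessThan_Suc_shift del: prod.lessThan_Suc)
    finally show ?thesis .
  qed
  finally have inv: "map_poly (\<alpha> 1) p = p" .
  have pA: "poly.coeff p i \<in> A.laurents" for i
  proof -
    have "poly.coeff (\<Prod>j\<in>I. f j) i \<in> A.laurents" if "finite I" for I i
      using that
    proof (induction I arbitrary: i)
      case empty
      thus ?case by (simp add: A.laurents_zero A.laurents_one)
    next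
      case (insert j I)
      have "poly.coeff (f j) i \<in> A.laurents" for i
        by (auto simp: f_def coeff_pCons A.laurents_one A.laurents_zero A.laurents_uminus \<alpha>A split: nat.splits)
      thus ?case using insert by (simp add: A_laurents_coeff_mult)
    qed
    thus ?thesis by (simp add: p_def)
  qed
  have "poly.coeff p i \<in> range \<psi>" for i
  proof (rule veronese_in_range[OF pA])
    fix n assume nz: "Poly_Mapping.lookup (poly.coeff p i) n \<noteq> 0"
    have "\<alpha> 1 (poly.coeff p i) = poly.coeff p i"
      using arg_cong[OF inv, of "\<lambda>p. poly.coeff p i"] by (simp add: coeff_map_poly unital_hom_zero[OF hom])
    hence "Poly_Mapping.lookup (poly.coeff p i) n * w powi n = Poly_Mapping.lookup (poly.coeff p i) n"
      using lookup_twist[OF id, of w "poly.coeff p i" n] by (simp add: \<alpha>_def)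
    hence "w powi n = 1" using nz by simp
    hence "to_fract [:\<omega> powi n:] = to_fract [:1:]" by (simp add: wpi unital_hom_one[OF const_hom])
    hence "\<omega> powi n = 1" by simp
    thus "int k dvd n" using primitive_root_powi_eq_1_iff[OF \<omega>] k_pos by simp
  qed
  hence "poly.coeff (fract_poly p) i \<in> to_fract ` range \<psi>" for i
    by (simp add: coeff_map_poly)
  moreover have "lead_coeff (fract_poly p) = 1"
  proof -
    have "lead_coeff p = (\<Prod>j<k. lead_coeff (f j))" unfolding p_def by (rule lead_coeff_prod)
    also have "\<dots> = 1" by (simp add: f_def)
    finally show ?thesis by (simp add: coeff_map_poly degree_map_poly)
  qed
  moreover have "poly (fract_poly p) (to_fract F) = 0"
  proof -
    have "poly (f 0) F = 0" by (simp add: f_def \<alpha>0)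
    hence "poly p F = 0" unfolding p_def k' prod.lessThan_Suc_shift by simp
    thus ?thesis by (simp add: poly_map_poly_hom[OF unital_hom_to_fract])
  qed
  ultimately show ?thesis by blast
qed

definition \<Phi> :: "laurent \<Rightarrow> (poly3 set \<times> poly3 set) set" where
  "\<Phi> F = fr (to_fract F)"

lemma Phi_inj: "\<Phi> F = \<Phi> G \<longleftrightarrow> F = G"
  using inj_onD[OF fr_inj _ laurent_in_fractions laurent_in_fractions, of F G] by (auto simp: \<Phi>_def)

lemma carrier_A_ring: "carrier (A_ring k P) = \<Phi> ` A.laurents"
proof -
  have iff: "fr z \<in> \<Phi> ` A.laurents \<longleftrightarrow>
      integral_over (frac_field (B_ring k P)) (frac_embed (B_ring k P) ` carrier (B_ring k P)) (fr z)"
    if z: "z \<in> fractions" for z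
  proof -
    have "fr z \<in> \<Phi> ` A.laurents \<longleftrightarrow> z \<in> to_fract ` A.laurents"
      using inj_onD[OF fr_inj _ z laurent_in_fractions] by (auto simp: \<Phi>_def)
    also have "\<dots> \<longleftrightarrow> (\<exists>p. lead_coeff p = 1 \<and> (\<forall>i. poly.coeff p i \<in> to_fract ` range \<psi>) \<and> poly p z = 0)"
      using in_A_imp_integral integral_imp_almost_integral[OF z] almost_integral_imp_in_A by blast
    finally show ?thesis by (simp add: integral_over_frac_iff[OF z] B_image_eq)
  qed
  have "\<Phi> ` A.laurents \<subseteq> fr ` fractions" using laurent_in_fractions by (auto simp: \<Phi>_def)
  hence "\<Phi> ` A.laurents = {x \<in> fr ` fractions. x \<in> \<Phi> ` A.laurents}" by blast
  also have "\<dots> = {x \<in> fr ` fractions.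
      integral_over (frac_field (B_ring k P)) (frac_embed (B_ring k P) ` carrier (B_ring k P)) x}"
  proof (rule Collect_cong, rule conj_cong[OF refl])
    fix x assume "x \<in> fr ` fractions"
    then obtain z where "z \<in> fractions" "x = fr z" by blast
    thus "x \<in> \<Phi> ` A.laurents \<longleftrightarrow>
        integral_over (frac_field (B_ring k P)) (frac_embed (B_ring k P) ` carrier (B_ring k P)) x"
      using iff by simp
  qed
  also have "\<dots> = carrier (A_ring k P)"
    by (simp add: A_ring_def normalization_ring_def carrier_frac_field)
  finally show ?thesis ..
qed

lemma A_ring_simps [simp]:
  "monoid.mult (A_ring k P) = monoid.mult (frac_field (B_ring k P))"
  "add (A_ring k P) = add (frac_field (B_ring k P))"
  "one (A_ring k P) = one (frac_field (B_ring k P))"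
  by (simp_all add: A_ring_def normalization_ring_def)

lemma Phi_mult: "\<Phi> F \<otimes>\<^bsub>A_ring k P\<^esub> \<Phi> G = \<Phi> (F * G)"
  and Phi_add: "\<Phi> F \<oplus>\<^bsub>A_ring k P\<^esub> \<Phi> G = \<Phi> (F + G)"
  and Phi_one: "\<one>\<^bsub>A_ring k P\<^esub> = \<Phi> 1"
  by (simp_all add: \<Phi>_def frac_mult frac_add frac_one laurent_in_fractions)

end

section \<open>Grading and group action on $A_{k,P}$\<close>

context B_algebra
begin

lemma homogeneous_psi:
  assumes "\<forall>i l. poly.coeff (poly.coeff g l) i \<noteq> 0 \<longrightarrow> int i - int k * int l = n"
  shows "\<psi> g = Poly_Mapping.single n (Poly_Mapping.lookup (\<psi> g) n)"
proof -
  have "Poly_Mapping.lookup (\<psi> g) m = 0" if "m \<noteq> n" for m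
    using assms that
  proof (induction g arbitrary: m n)
    case (pCons h g)
    \<comment> \<open>v has degree -k, so the part \<open>g\<close> behind one factor v is
      homogeneous of degree n + k; this is why the degree varies in the induction.\<close>
    have "\<forall>i l. poly.coeff (poly.coeff g l) i \<noteq> 0 \<longrightarrow> int i - int k * int l = n + int k"
      using pCons.prems(1) by (auto simp: coeff_pCons algebra_simps split: nat.splits)
    hence "Poly_Mapping.lookup (\<psi> g) (m + int k) = 0" using pCons.prems(2) by (intro pCons.IH) auto
    moreover have "poly.coeff h (nat m) = 0" if "m \<ge> 0"
      using pCons.prems(1)[rule_format, of 0 "nat m"] pCons.prems(2) that by auto
    ultimately show ?case
      by (auto simp: psi_pCons lookup_add lookup_single_mult lookup_to_laurent unital_hom_to_fract)
  qed (simp add: psi_simps)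
  thus ?thesis by (intro poly_mapping_eqI) (auto simp: lookup_single when_def)
qed

lemma monom_in_B_component: "B_class k P [:Polynomial.monom p n:] \<in> B_component k P (int n)"
  unfolding B_component_def
  by (rule imageI) (auto simp: coeff_pCons split: nat.splits if_splits)

lemma A_component_eq: "A_component k P n = \<Phi> ` Poly_Mapping.single n ` A_coeffs n"
proof (intro equalityI subsetI)
  fix x assume "x \<in> A_component k P n"
  then obtain m b b' where x: "x \<in> carrier (A_ring k P)"
    and b: "b \<in> B_component k P m - {\<zero>\<^bsub>B_ring k P\<^esub>}" and b': "b' \<in> B_component k P (m + n)"
    and eq: "x = frac_class (B_ring k P) b' b"
    unfolding A_component_def by blast
  obtain h where h: "b = B_class k P h"
    "\<psi> h = Poly_Mapping.single m (Poly_Mapping.lookup (\<psi> h) m)"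
    using b homogeneous_psi unfolding B_component_def by blast
  obtain g where g: "b' = B_class k P g"
    "\<psi> g = Poly_Mapping.single (m + n) (Poly_Mapping.lookup (\<psi> g) (m + n))"
    using b' homogeneous_psi unfolding B_component_def by blast
  have "b \<in> carrier (B_ring k P) - {\<zero>\<^bsub>B_ring k P\<^esub>}"
    using b h by (auto simp: carrier_B_ring)
  moreover from this have nz: "\<psi> h \<noteq> 0" using B_class_in_nonzero_iff h by simp
  ultimately have x': "x = fr (to_fract (\<psi> g) / to_fract (\<psi> h))"
    using frac_class_eq[of b' b] g h eq by (simp add: carrier_B_ring B_embed_class)
  define f where "f = Poly_Mapping.lookup (\<psi> g) (m + n) / Poly_Mapping.lookup (\<psi> h) m"
  have "Poly_Mapping.lookup (\<psi> h) m \<noteq> 0" using nz h(2) by (metis single_zero)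
  hence "\<psi> g = Poly_Mapping.single n f * \<psi> h"
    by (subst g(2), subst h(2)) (simp add: mult_single f_def add.commute)
  hence "to_fract (\<psi> g) / to_fract (\<psi> h) = to_fract (Poly_Mapping.single n f)"
    using nz by (metis eq_divide_imp to_fract_eq_0_iff to_fract_mult)
  hence x'': "x = \<Phi> (Poly_Mapping.single n f)" using x' by (simp add: \<Phi>_def)
  then have "Poly_Mapping.single n f \<in> A.laurents"
    using x by (auto simp: carrier_A_ring Phi_inj)
  thus "x \<in> \<Phi> ` Poly_Mapping.single n ` A_coeffs n"
    using x'' by (simp add: A.single_in_laurents_iff)
next
  fix x assume "x \<in> \<Phi> ` Poly_Mapping.single n ` A_coeffs n"
  then obtain f where f: "f \<in> A_coeffs n" "x = \<Phi> (Poly_Mapping.single n f)" by blast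
  obtain p q where pq: "f = Fract p q" "q \<noteq> 0" by (cases f) auto
  \<comment> \<open>A negative degree is moved into the denominator q u^M, so that the numerator p
    u^(n + M) has a nonnegative exponent and both come from C[s][u].\<close>
  define M where "M = nat (- n)"
  define b where "b = B_class k P [:Polynomial.monom q M:]"
  define b' where "b' = B_class k P [:Polynomial.monom p (nat (n + int M)):]"
  have \<psi>b: "\<psi> [:Polynomial.monom q M:] \<noteq> 0"
    unfolding psi_monom using pq(2) by (metis lookup_single_eq lookup_zero to_fract_eq_0_iff)
  hence b: "b \<in> carrier (B_ring k P) - {\<zero>\<^bsub>B_ring k P\<^esub>}"
    using B_class_in_nonzero_iff by (simp add: b_def)
  have "f * to_fract q = to_fract p" using pq by (simp add: Fract_conv_to_fract)
  hence "Poly_Mapping.single n f * \<psi> [:Polynomial.monom q M:] = \<psi> [:Polynomial.monom p (nat (n + int M)):]"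
    by (simp add: psi_monom mult_single M_def)
  hence "to_fract (Poly_Mapping.single n f) =
      to_fract (\<psi> [:Polynomial.monom p (nat (n + int M)):]) / to_fract (\<psi> [:Polynomial.monom q M:])"
    using \<psi>b by (metis eq_divide_imp to_fract_eq_0_iff to_fract_mult)
  moreover have "b' \<in> carrier (B_ring k P)" by (simp add: b'_def carrier_B_ring)
  ultimately have "x = frac_class (B_ring k P) b' b"
    using f(2) b by (simp add: frac_class_eq \<Phi>_def) (simp add: b_def b'_def B_embed_class)
  moreover have "x \<in> carrier (A_ring k P)"
    using f by (simp add: carrier_A_ring A.single_in_laurents_iff)
  moreover have "b \<in> B_component k P (int M) - {\<zero>\<^bsub>B_ring k P\<^esub>}"
    using b monom_in_B_component by (auto simp: b_def)
  moreover have "b' \<in> B_component k P (int M + n)"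
  proof -
    have "int (nat (n + int M)) = int M + n" by (simp add: M_def)
    thus ?thesis using monom_in_B_component[of p "nat (n + int M)"] by (simp only: b'_def)
  qed
  ultimately show "x \<in> A_component k P n" unfolding A_component_def by blast
qed

end

section \<open>The cyclic action and its effect on Laurent polynomials\<close>

lemma coeff_poly3_act:
  "coeff (coeff (coeff (poly3_act e z g) l) i) n = z ^ (e * i) * z ^ n * coeff (coeff (coeff g l) i) n"
proof -
  have c: "coeff (pcompose (map_poly (\<lambda>c. pcompose c [:0, z:]) h) [:0, [:z ^ e:]:]) i =
      smult (z ^ (e * i)) (pcompose (coeff h i) [:0, z:])" for h i
    by (simp add: coeff_pcompose_linear coeff_map_poly poly_const_pow power_mult)
  show ?thesis
    unfolding poly3_act_def by (subst coeff_map_poly, simp, simp only: c, simp add: coeff_pcompose_linear)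
qed

lemma poly3_act_inverse:
  assumes "z \<noteq> 0"
  shows "poly3_act e z (poly3_act e (inverse z) g) = g"
  using assms by (intro poly_eqI) (simp add: coeff_poly3_act field_simps)

text \<open>Semi-invariance gives P the same weight as u^k v, so the relation is an eigenvector of
  the action and its ideal is preserved.\<close>

locale B_algebra_action = B_algebra +
  fixes e :: nat and z :: complex
  assumes z_nonzero: "z \<noteq> 0"
    and P_semiinvariant: "pcompose P [:0, z:] = smult (z ^ (k * e)) P"
begin

definition \<alpha> :: "laurent \<Rightarrow> laurent" where
  "\<alpha> = twist (fract_subst [:0, z:]) (to_fract [:z ^ e:])"

lemma unital_hom_rotation: "unital_hom (fract_subst [:0, z:])"
  using z_nonzero by (intro unital_hom_fract_subst) simp

lemma unital_hom_alpha: "unital_hom \<alpha>"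
  unfolding \<alpha>_def using z_nonzero by (intro unital_hom_twist unital_hom_rotation) simp

lemma lookup_alpha: "Poly_Mapping.lookup (\<alpha> F) n =
    fract_subst [:0, z:] (Poly_Mapping.lookup F n) * to_fract [:z ^ e:] powi n"
  by (simp add: \<alpha>_def lookup_twist unital_hom_rotation)

lemma alpha_inj: "\<alpha> F = \<alpha> G \<Longrightarrow> F = G"
proof (rule poly_mapping_eqI)
  fix n assume "\<alpha> F = \<alpha> G"
  hence "Poly_Mapping.lookup (\<alpha> F) n = Poly_Mapping.lookup (\<alpha> G) n" by simp
  thus "Poly_Mapping.lookup F n = Poly_Mapping.lookup G n"
    using z_nonzero injD[OF unital_hom_inj[OF unital_hom_rotation]] by (simp add: lookup_alpha)
qed

lemma psi_act: "\<psi> (poly3_act e z g) = \<alpha> (\<psi> g)"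
proof (induction g)
  case 0
  have "poly3_act e z 0 = 0" by (simp add: poly3_act_def)
  thus ?case by (simp add: psi_simps unital_hom_zero[OF unital_hom_alpha])
next
  case (pCons h g)
  define h' where "h' = pcompose (map_poly (\<lambda>c. pcompose c [:0, z:]) h) [:0, [:z ^ e:]:]"
  have const: "to_fract [:z ^ e:] ^ i = (to_fract [:(z ^ e) ^ i:] :: complex poly fract)" for i
    by (simp add: poly_const_pow flip: unital_hom_power[OF unital_hom_to_fract])
  have "poly3_act e z (pCons h g) = pCons h' (poly3_act e z g)"
    by (simp add: poly3_act_def map_poly_pCons h'_def)
  moreover have "to_laurent to_fract h' = \<alpha> (to_laurent to_fract h)"
  proof (rule poly_mapping_eqI)
    fix n
    have "poly.coeff h' i = smult ((z ^ e) ^ i) (pcompose (poly.coeff h i) [:0, z:])" for i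
      by (simp add: h'_def coeff_pcompose_linear coeff_map_poly poly_const_pow)
    hence "to_fract (poly.coeff h' i) = fract_subst [:0, z:] (to_fract (poly.coeff h i)) * to_fract [:z ^ e:] ^ i" for i
      by (simp add: fract_subst_to_fract const mult.commute flip: to_fract_mult)
    thus "Poly_Mapping.lookup (to_laurent to_fract h') n = Poly_Mapping.lookup (\<alpha> (to_laurent to_fract h)) n"
      by (auto simp: lookup_alpha lookup_to_laurent unital_hom_to_fract power_int_def
          unital_hom_zero[OF unital_hom_rotation])
  qed
  \<comment> \<open>v corresponds to P u^-k; the weights z^(ke) of P and z^(-ke) of u^-k cancel,
    matching the trivial action on v.\<close>
  moreover have "\<alpha> (Poly_Mapping.single (- int k) (to_fract P)) = Poly_Mapping.single (- int k) (to_fract P)"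
  proof -
    have "fract_subst [:0, z:] (to_fract P) = to_fract P * to_fract [:z ^ e:] ^ k"
      by (simp add: fract_subst_to_fract P_semiinvariant const mult.commute power_mult[symmetric] flip: to_fract_mult)
    hence "\<alpha> (Poly_Mapping.single (- int k) (to_fract P)) =
        Poly_Mapping.single (- int k) (to_fract P * to_fract [:z ^ e:] ^ k * inverse (to_fract [:z ^ e:] ^ k))"
      by (simp add: \<alpha>_def twist_single unital_hom_rotation power_int_minus)
    also have "to_fract P * to_fract [:z ^ e:] ^ k * inverse (to_fract [:z ^ e:] ^ k) = to_fract P"
      using z_nonzero by (simp add: mult.assoc)
    finally show ?thesis .
  qed
  ultimately show ?case
    by (simp add: psi_pCons pCons.IH unital_hom_add[OF unital_hom_alpha] unital_hom_mult[OF unital_hom_alpha])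
qed

text \<open>\<open>B_act\<close> is a direct image, so every element of the target coset has to be
  hit; the inverse rotation provides the preimages.\<close>

lemma B_act_class: "B_act e z (B_class k P g) = B_class k P (poly3_act e z g)"
proof (intro equalityI subsetI)
  fix h assume h: "h \<in> B_class k P (poly3_act e z g)"
  define h' where "h' = poly3_act e (inverse z) h"
  have hh': "poly3_act e z h' = h" unfolding h'_def by (rule poly3_act_inverse[OF z_nonzero])
  hence "\<alpha> (\<psi> h') = \<alpha> (\<psi> g)" using h by (simp add: B_class_eq psi_act flip: psi_act)
  hence "h' \<in> B_class k P g" by (auto simp: B_class_eq dest: alpha_inj)
  thus "h \<in> B_act e z (B_class k P g)" using hh' by (force simp: B_act_def)
qed (auto simp: B_act_def B_class_eq psi_act)

lemma B_class_eq_iff: "B_class k P g = B_class k P h \<longleftrightarrow> \<psi> g = \<psi> h"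
proof
  have "g \<in> B_class k P g" by (simp add: B_class_eq)
  moreover assume "B_class k P g = B_class k P h"
  ultimately have "g \<in> B_class k P h" by simp
  thus "\<psi> g = \<psi> h" by (simp add: B_class_eq)
qed (simp add: B_class_eq)

text \<open>\<open>\<Phi> F\<close> consists of all pairs of cosets with quotient \<open>F\<close>,
  and the action turns this quotient into \<open>\<alpha> F\<close>. One pair suffices to conclude
  that \<open>F\<close> is fixed; the converse needs that the action permutes all pairs.\<close>

lemma A_act_Phi_iff: "A_act e z (\<Phi> F) = \<Phi> F \<longleftrightarrow> \<alpha> F = F"
proof -
  have mem: "(B_class k P g, B_class k P h) \<in> \<Phi> F \<longleftrightarrow> \<psi> h \<noteq> 0 \<and> \<psi> g = F * \<psi> h" for F g h
  proof -
    have "(B_class k P g, B_class k P h) \<in> \<Phi> F \<longleftrightarrow>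
      (\<exists>g' h'. \<psi> g = \<psi> g' \<and> \<psi> h = \<psi> h' \<and> \<psi> h' \<noteq> 0 \<and> to_fract (\<psi> g') = to_fract F * to_fract (\<psi> h'))"
      unfolding \<Phi>_def fr_eq by (simp add: B_class_eq_iff)
    also have "\<dots> \<longleftrightarrow> \<psi> h \<noteq> 0 \<and> to_fract (\<psi> g) = to_fract (F * \<psi> h)"
      unfolding to_fract_mult by metis
    finally show ?thesis by (simp only: to_fract_eq_iff)
  qed
  have cases: "\<exists>g h. x = (B_class k P g, B_class k P h)" if "x \<in> \<Phi> F" for x
    using that by (auto simp: \<Phi>_def fr_eq)
  have act: "(map_prod (B_act e z) (B_act e z)) (B_class k P g, B_class k P h) =
      (B_class k P (poly3_act e z g), B_class k P (poly3_act e z h))" for g h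
    by (simp add: B_act_class)
  have \<alpha>0: "\<alpha> G = 0 \<longleftrightarrow> G = 0" for G
    using alpha_inj[of G 0] by (auto simp: unital_hom_zero[OF unital_hom_alpha])
  note \<alpha>mult = unital_hom_mult[OF unital_hom_alpha]
  show ?thesis
  proof
    assume eq: "A_act e z (\<Phi> F) = \<Phi> F"
    obtain g h where gh: "\<psi> h \<noteq> 0" "F * \<psi> h = \<psi> g" using laurent_times_psi by blast
    hence "(B_class k P g, B_class k P h) \<in> \<Phi> F" by (simp add: mem)
    hence "map_prod (B_act e z) (B_act e z) (B_class k P g, B_class k P h) \<in> \<Phi> F"
      using eq unfolding A_act_def by blast
    hence "\<alpha> (\<psi> g) = F * \<alpha> (\<psi> h)" by (simp only: act mem psi_act)
    hence "\<alpha> F * \<alpha> (\<psi> h) = F * \<alpha> (\<psi> h)" by (simp flip: gh(2) add: \<alpha>mult)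
    thus "\<alpha> F = F" using gh(1) \<alpha>0 by simp
  next
    assume inv: "\<alpha> F = F"
    have iff: "(B_class k P (poly3_act e z g), B_class k P (poly3_act e z h)) \<in> \<Phi> F \<longleftrightarrow>
        (B_class k P g, B_class k P h) \<in> \<Phi> F" for g h
    proof -
      have "\<alpha> (\<psi> g) = F * \<alpha> (\<psi> h) \<longleftrightarrow> \<alpha> (\<psi> g) = \<alpha> (F * \<psi> h)" by (simp add: \<alpha>mult inv)
      also have "\<dots> \<longleftrightarrow> \<psi> g = F * \<psi> h" by (auto dest: alpha_inj)
      finally show ?thesis by (simp add: mem psi_act \<alpha>0)
    qed
    show "A_act e z (\<Phi> F) = \<Phi> F"
    proof (intro equalityI subsetI)
      fix x assume "x \<in> A_act e z (\<Phi> F)"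
      then obtain y where y: "x = map_prod (B_act e z) (B_act e z) y" "y \<in> \<Phi> F"
        unfolding A_act_def by (rule imageE)
      obtain g h where gh: "y = (B_class k P g, B_class k P h)" using cases[OF y(2)] by blast
      have "x = (B_class k P (poly3_act e z g), B_class k P (poly3_act e z h))"
        unfolding y(1) gh by (rule act)
      thus "x \<in> \<Phi> F" using y(2) iff[of g h] unfolding gh by simp
    next
      fix x assume x: "x \<in> \<Phi> F"
      obtain g h where gh: "x = (B_class k P g, B_class k P h)" using cases[OF x] by blast
      define g' h' where "g' = poly3_act e (inverse z) g" and "h' = poly3_act e (inverse z) h"
      have *: "poly3_act e z g' = g" "poly3_act e z h' = h"
        unfolding g'_def h'_def by (rule poly3_act_inverse[OF z_nonzero])+
      have "(B_class k P g', B_class k P h') \<in> \<Phi> F" using x iff[of g' h'] unfolding gh * by (rule iffD1[rotated])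
      moreover have "x = map_prod (B_act e z) (B_act e z) (B_class k P g', B_class k P h')"
        unfolding act * gh ..
      ultimately show "x \<in> A_act e z (\<Phi> F)" unfolding A_act_def by (metis imageI)
    qed
  qed
qed

lemma inv_ring_simps [simp]:
  "monoid.mult (inv_ring e z k P) = monoid.mult (A_ring k P)"
  "add (inv_ring e z k P) = add (A_ring k P)"
  "one (inv_ring e z k P) = one (A_ring k P)"
  by (simp_all add: inv_ring_def)

lemma carrier_inv_ring: "carrier (inv_ring e z k P) = \<Phi> ` {F \<in> A.laurents. \<alpha> F = F}"
  by (simp add: inv_ring_def carrier_A_ring Compr_image_eq A_act_Phi_iff)

lemma inv_component_eq:
  "inv_component e z k P n = \<Phi> ` Poly_Mapping.single n ` {f \<in> A_coeffs n. \<alpha> (Poly_Mapping.single n f) = Poly_Mapping.single n f}"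
  by (simp add: inv_component_def A_component_eq Compr_image_eq A_act_Phi_iff)

lemma inv_struct_eq: "inv_struct d k P f = \<Phi> (Poly_Mapping.single 0 (to_fract (subst_power d f)))"
  by (simp add: inv_struct_def frac_embed_eq carrier_B_ring B_embed_class psi_s_const \<Phi>_def)

end

section \<open>The invariant ring\<close>

text \<open>Surjectivity of s -> s^d: conditions at the points of the s-line thereby give conditions
  at all points of the t-line.\<close>

lemma complex_nth_root_exists:
  assumes "d > 0"
  shows "\<exists>a :: complex. a ^ d = b"
proof -
  let ?p = "Polynomial.monom 1 d - [:b:]"
  have "\<not> constant (poly ?p)"
  proof
    assume "constant (poly ?p)"
    hence "Polynomial.degree ?p = 0" by (simp add: constant_degree)
    then obtain c where c: "?p = [:c:]" by (rule degree_eq_zeroE)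
    have "Polynomial.monom 1 d = [:c + b:]" using c by (metis add_pCons add.right_neutral diff_add_cancel)
    thus False using degree_monom_pos[OF assms] by simp
  qed
  then obtain a where "poly ?p a = 0" using fundamental_theorem_of_algebra by blast
  thus ?thesis by (auto simp: poly_monom)
qed

lemma rotation_fract_subst_monom:
  assumes z: "primitive_root_of_unity d z" "d > 0"
  shows "fract_subst [:0, z:] (fract_subst (Polynomial.monom 1 d) f) = fract_subst (Polynomial.monom 1 d) f"
proof -
  have zd: "z ^ d = 1" using z unfolding primitive_root_of_unity_def by blast
  hence "z \<noteq> 0" using z(2) by (auto simp: zero_power)
  hence hom: "unital_hom (fract_subst [:0, z:])" by (intro unital_hom_fract_subst) simp
  have "pcompose (Polynomial.monom 1 d) [:0, z:] = Polynomial.monom 1 d"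
    using zd by (intro poly_eqI) (auto simp: coeff_pcompose_linear)
  hence *: "pcompose (pcompose p (Polynomial.monom 1 d)) [:0, z:] = pcompose p (Polynomial.monom 1 d)" for p
    by (simp flip: pcompose_assoc)
  obtain p q where f: "f = Fract p q" "q \<noteq> 0" by (cases f) auto
  show ?thesis
    unfolding f(1) fract_subst_Fract[OF degree_monom_pos[OF z(2)] f(2)] unital_hom_divide[OF hom]
    by (simp only: fract_subst_to_fract *)
qed

locale cyclic_quotient =
  fixes d e k m :: nat and \<zeta> :: complex and q P :: "complex poly"
  assumes d_pos: "1 \<le> d" and root: "primitive_root_of_unity d \<zeta>" and k1: "1 \<le> k"
    and q_monic: "lead_coeff q = 1" and P_eq: "P_of_laurent d e k q m P"
begin

definition power_map :: "complex poly fract \<Rightarrow> complex poly fract" where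
  "power_map = fract_subst (Polynomial.monom 1 d)"

definition s :: "complex poly fract" where
  "s = to_fract [:0, 1:]"

text \<open>The presentation corresponds to \<open>D\<^sub>+ = -e/d [0]\<close> and \<open>D\<^sub>- = -div Q / k\<close>; the isomorphism
  onto the invariants substitutes \<open>t = s\<^sup>d\<close> and \<open>u = s\<^sup>-\<^sup>e u'\<close>.\<close>

definition Q :: "complex poly fract" where
  "Q = to_fract q / to_fract (Polynomial.monom 1 m)"

definition Dp0 :: q_divisor where
  "Dp0 = Poly_Mapping.single 0 (- (of_nat e / of_nat d))"

definition Dm0 :: q_divisor where
  "Dm0 = root_divisor k Q"

lemma unital_hom_sigma: "unital_hom power_map"
  unfolding power_map_def using d_pos by (intro unital_hom_fract_subst degree_monom_pos) simp

lemma s_nonzero: "s \<noteq> 0"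
  by (simp add: s_def)

lemma q_nonzero: "q \<noteq> 0"
  using q_monic by auto

lemma Q_nonzero: "Q \<noteq> 0"
  using q_nonzero by (simp add: Q_def)

lemma P_fract: "to_fract P = power_map Q * s ^ (k * e)"
proof -
  have s: "to_fract (Polynomial.monom 1 n) = s ^ n" for n
    by (simp add: s_def monom_altdef unital_hom_power[OF unital_hom_to_fract])
  have "to_fract P * to_fract (subst_power d (Polynomial.monom 1 m)) =
      to_fract (subst_power d q) * to_fract (Polynomial.monom 1 (k * e))"
    using P_eq by (simp only: P_of_laurent_def flip: to_fract_mult)
  hence eq: "to_fract P * power_map (to_fract (Polynomial.monom 1 m)) = power_map (to_fract q) * s ^ (k * e)"
    unfolding power_map_def fract_subst_to_fract subst_power_def[symmetric] s[symmetric] .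
  have "power_map (to_fract (Polynomial.monom 1 m)) \<noteq> 0"
    by (simp add: unital_hom_eq_0_iff[OF unital_hom_sigma])
  thus ?thesis using eq by (simp add: Q_def unital_hom_divide[OF unital_hom_sigma] field_simps)
qed

lemma zeta_nonzero: "\<zeta> \<noteq> 0"
proof -
  have "\<zeta> ^ d = 1" using root unfolding primitive_root_of_unity_def by blast
  thus ?thesis using d_pos by (auto simp: zero_power)
qed

lemma rotation_s: "fract_subst [:0, \<zeta>:] s = to_fract [:\<zeta>:] * s"
  by (simp add: s_def fract_subst_to_fract pcompose_pCons flip: to_fract_mult)

lemma rotation_sigma: "fract_subst [:0, \<zeta>:] (power_map f) = power_map f"
  unfolding power_map_def using root d_pos by (intro rotation_fract_subst_monom) auto

lemma unital_hom_rot: "unital_hom (fract_subst [:0, \<zeta>:])"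
  using zeta_nonzero by (intro unital_hom_fract_subst) simp

lemma const_power: "to_fract [:\<zeta>:] ^ i = (to_fract [:\<zeta> ^ i:] :: complex poly fract)"
  by (simp add: poly_const_pow flip: unital_hom_power[OF unital_hom_to_fract])

sublocale B_algebra_action k P e \<zeta>
proof
  show "1 \<le> k" by (rule k1)
  show "\<zeta> \<noteq> 0" by (rule zeta_nonzero)
  show "P \<noteq> 0"
  proof
    assume "P = 0"
    hence "power_map Q * s ^ (k * e) = 0" by (simp flip: P_fract)
    thus False using s_nonzero Q_nonzero by (simp add: unital_hom_eq_0_iff[OF unital_hom_sigma])
  qed
  \<comment> \<open>Q(s^d) is invariant, so the factor s^(ke) alone determines the weight of
    \<open>P\<close>.\<close>
  have "to_fract (pcompose P [:0, \<zeta>:]) = fract_subst [:0, \<zeta>:] (power_map Q * s ^ (k * e))"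
    by (simp only: fract_subst_to_fract flip: P_fract)
  also have "\<dots> = to_fract [:\<zeta> ^ (k * e):] * to_fract P"
    unfolding unital_hom_mult[OF unital_hom_rot] unital_hom_power[OF unital_hom_rot] rotation_s
      rotation_sigma power_mult_distrib const_power P_fract by (rule mult.left_commute)
  also have "\<dots> = to_fract (smult (\<zeta> ^ (k * e)) P)" by (simp flip: to_fract_mult)
  finally show "pcompose P [:0, \<zeta>:] = smult (\<zeta> ^ (k * e)) P" by (simp only: to_fract_eq_iff)
qed

lemma ord_at_s: "ord_at a s = (if a = 0 then 1 else 0)"
  using ord_at_linear[of a 0] by (simp add: s_def)

lemma ord_at_sigma: "f \<noteq> 0 \<Longrightarrow> ord_at a (power_map f) = (if a = 0 then int d * ord_at 0 f else ord_at (a ^ d) f)"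
  unfolding power_map_def using d_pos by (intro ord_at_fract_subst_monom) auto

lemma ord_at_P: "ord_at a (to_fract P) =
    (if a = 0 then int d * ord_at 0 Q + int k * int e else ord_at (a ^ d) Q)"
  using s_nonzero Q_nonzero unital_hom_eq_0_iff[OF unital_hom_sigma]
  by (simp add: P_fract ord_at_mult ord_at_power ord_at_s ord_at_sigma)

lemma lookup_Dp0: "Poly_Mapping.lookup Dp0 a = (if a = 0 then - (of_nat e / of_nat d) else 0)"
  by (simp add: Dp0_def lookup_single when_def)

lemma lookup_Dm0: "Poly_Mapping.lookup Dm0 a = - of_int (ord_at a Q) / of_nat k"
  by (simp add: Dm0_def lookup_root_divisor Q_nonzero)

text \<open>This is the polynomiality of \<open>P\<close>, read at a d-th root of the point: over 0
  it says that d ord_0(Q) + k e is nonnegative, and division by d k gives the inequality.\<close>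

lemma D0_le: "\<forall>a. Poly_Mapping.lookup Dp0 a + Poly_Mapping.lookup Dm0 a \<le> 0"
proof
  fix b :: complex
  obtain a where a: "a ^ d = b" using complex_nth_root_exists d_pos by (metis less_eq_Suc_le One_nat_def)
  have P: "0 \<le> ord_at a (to_fract P)" by (simp add: ord_at_to_fract)
  show "Poly_Mapping.lookup Dp0 b + Poly_Mapping.lookup Dm0 b \<le> 0"
  proof (cases "a = 0")
    case True
    hence "b = 0" using a d_pos by (auto simp: zero_power)
    have "0 \<le> int d * ord_at 0 Q + int k * int e" using P True by (simp add: ord_at_P)
    hence "(0 :: rat) \<le> of_int (int d * ord_at 0 Q + int k * int e)" by (simp only: of_int_0_le_iff)
    thus ?thesis using d_pos k1 \<open>b = 0\<close> by (simp add: lookup_Dp0 lookup_Dm0 field_simps)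
  next
    case False
    hence "b \<noteq> 0" using a by auto
    thus ?thesis using P False a by (simp add: ord_at_P lookup_Dp0 lookup_Dm0)
  qed
qed

sublocale D: graded_coeffs_closed "dpd_coeffs Dp0 Dm0"
  by (rule graded_coeffs_closed_dpd[OF D0_le])

definition c :: "complex poly fract" where
  "c = inverse s ^ e"

lemma c_nonzero: "c \<noteq> 0"
  by (simp add: c_def s_nonzero)

lemma ord_at_c_powi: "ord_at a (c powi n) = (if a = 0 then - (n * int e) else 0)"
  using s_nonzero c_nonzero by (simp add: ord_at_powi c_def ord_at_power ord_at_inverse ord_at_s)

text \<open>The condition at a point \<open>a\<close> of the s-line is the condition at
  \<open>a ^ d\<close> on the t-line, multiplied by the ramification index \<open>d\<close> if
  \<open>a = 0\<close>. The factor s^(-en) thus counts as -en/d at 0, which is the origin of e/d in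
  \<open>Dp0\<close>.\<close>

lemma sigma_mem_iff: "power_map f * c powi n \<in> A_coeffs n \<longleftrightarrow> f \<in> dpd_coeffs Dp0 Dm0 n"
proof (cases "f = 0")
  case True
  thus ?thesis by (simp add: unital_hom_zero[OF unital_hom_sigma] A.coeffs_zero D.coeffs_zero)
next
  case False
  define G where "G = power_map f * c powi n"
  have nz: "power_map f \<noteq> 0" "c powi n \<noteq> 0"
    using False c_nonzero unital_hom_eq_0_iff[OF unital_hom_sigma] by auto
  have ordG: "ord_at a G = (if a = 0 then int d * ord_at 0 f - n * int e else ord_at (a ^ d) f)" for a
    using nz False by (simp add: G_def ord_at_mult ord_at_sigma ord_at_c_powi)
  have at0: "of_int (ord_at 0 G) + slope 0 (root_divisor k (to_fract P)) n 0 =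
      of_nat d * (of_int (ord_at 0 f) + slope Dp0 Dm0 n 0)"
  proof (cases "n \<ge> 0")
    case True
    have "slope 0 (root_divisor k (to_fract P)) n 0 = 0" using True by (simp add: A_slope)
    moreover have "slope Dp0 Dm0 n 0 = - (of_int n * of_nat e / of_nat d)"
      using True by (simp add: slope_def lookup_Dp0)
    ultimately show ?thesis using d_pos by (simp add: ordG distrib_left right_diff_distrib)
  next
    case neg: False
    have "slope 0 (root_divisor k (to_fract P)) n 0 =
        of_nat d * (of_int n * of_int (ord_at 0 Q) / of_nat k) + of_int n * of_nat e"
      using neg k1 by (simp add: A_slope ord_at_P distrib_left add_divide_distrib)
    moreover have "slope Dp0 Dm0 n 0 = of_int n * of_int (ord_at 0 Q) / of_nat k"
      using neg by (simp add: slope_def lookup_Dm0)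
    ultimately show ?thesis by (simp add: ordG distrib_left)
  qed
  have at: "of_int (ord_at a G) + slope 0 (root_divisor k (to_fract P)) n a =
      of_int (ord_at (a ^ d) f) + slope Dp0 Dm0 n (a ^ d)" if "a \<noteq> 0" for a
  proof -
    have "slope 0 (root_divisor k (to_fract P)) n a = slope Dp0 Dm0 n (a ^ d)"
      unfolding A_slope unfolding slope_def lookup_Dp0 lookup_Dm0 using that by (simp add: ord_at_P)
    thus ?thesis using that by (simp add: ordG)
  qed
  have "(\<forall>a. 0 \<le> of_int (ord_at a G) + slope 0 (root_divisor k (to_fract P)) n a) \<longleftrightarrow>
      (\<forall>b. 0 \<le> of_int (ord_at b f) + slope Dp0 Dm0 n b)" (is "?L \<longleftrightarrow> ?R")
  proof
    assume L: ?L
    show ?R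
    proof
      fix b :: complex
      obtain a where a: "a ^ d = b" using complex_nth_root_exists d_pos by (metis less_eq_Suc_le One_nat_def)
      show "0 \<le> of_int (ord_at b f) + slope Dp0 Dm0 n b"
      proof (cases "a = 0")
        case True
        hence "b = 0" using a d_pos by (auto simp: zero_power)
        have "0 \<le> of_nat d * (of_int (ord_at 0 f) + slope Dp0 Dm0 n 0)"
          unfolding at0[symmetric] by (rule L[rule_format])
        thus ?thesis using d_pos \<open>b = 0\<close> by (simp add: zero_le_mult_iff)
      next
        case False
        show ?thesis unfolding a[symmetric] at[OF False, symmetric] by (rule L[rule_format])
      qed
    qed
  next
    assume R: ?R
    show ?L
    proof
      fix a
      show "0 \<le> of_int (ord_at a G) + slope 0 (root_divisor k (to_fract P)) n a"
      proof (cases "a = 0")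
        case True
        have "0 \<le> of_nat d * (of_int (ord_at 0 f) + slope Dp0 Dm0 n 0)"
          by (rule mult_nonneg_nonneg[OF of_nat_0_le_iff R[rule_format]])
        thus ?thesis unfolding True at0 .
      next
        case False
        show ?thesis unfolding at[OF False] by (rule R[rule_format])
      qed
    qed
  qed
  moreover have "G \<noteq> 0" using nz by (simp add: G_def)
  ultimately show ?thesis using False by (simp add: dpd_coeffs_iff flip: G_def)
qed

lemma rotation_c: "fract_subst [:0, \<zeta>:] (c powi n) * to_fract [:\<zeta> ^ e:] powi n = c powi n"
proof -
  have z: "(to_fract [:\<zeta>:] :: complex poly fract) \<noteq> 0" using zeta_nonzero by simp
  have "fract_subst [:0, \<zeta>:] c * to_fract [:\<zeta> ^ e:] = c"
    unfolding c_def const_power[symmetric] unital_hom_power[OF unital_hom_rot]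
      unital_hom_inverse[OF unital_hom_rot] rotation_s
    using z s_nonzero by (simp add: power_mult_distrib power_inverse[symmetric] field_simps)
  thus ?thesis
    by (simp add: unital_hom_powi[OF unital_hom_rot] flip: power_int_mult_distrib)
qed

text \<open>c^n has the weight opposite to that of u^n, so invariance of G u^n means that G / c^n is
  fixed by the rotation and hence a function of s^d.\<close>

lemma invariant_single_iff:
  "G \<in> A_coeffs n \<and> \<alpha> (Poly_Mapping.single n G) = Poly_Mapping.single n G \<longleftrightarrow>
   (\<exists>f\<in>dpd_coeffs Dp0 Dm0 n. G = power_map f * c powi n)"
proof -
  have inv: "\<alpha> (Poly_Mapping.single n G) = Poly_Mapping.single n G \<longleftrightarrow>
      fract_subst [:0, \<zeta>:] G * to_fract [:\<zeta> ^ e:] powi n = G"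
    by (simp add: \<alpha>_def twist_single unital_hom_rotation inj_eq[OF inj_single])
  show ?thesis unfolding inv
  proof (intro iffI conjI)
    assume G: "G \<in> A_coeffs n \<and> fract_subst [:0, \<zeta>:] G * to_fract [:\<zeta> ^ e:] powi n = G"
    define x where "x = G / c powi n"
    have cn: "c powi n \<noteq> 0" using c_nonzero by simp
    have wn: "to_fract [:\<zeta> ^ e:] powi n \<noteq> (0 :: complex poly fract)" using zeta_nonzero by simp
    \<comment> \<open>Expanding the quotient by the constant \<open>\<zeta> ^ e\<close> to the power
      \<open>n\<close> turns its numerator into \<open>G\<close> and its denominator into
      c^n.\<close>
    have "fract_subst [:0, \<zeta>:] x =
      (fract_subst [:0, \<zeta>:] G * to_fract [:\<zeta> ^ e:] powi n) /
      (fract_subst [:0, \<zeta>:] (c powi n) * to_fract [:\<zeta> ^ e:] powi n)"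
      using wn by (simp add: x_def unital_hom_divide[OF unital_hom_rot])
    also have "\<dots> = x" using G by (simp add: rotation_c x_def)
    finally obtain f where "x = power_map f"
      unfolding power_map_def using rotation_invariant_fract[OF root] d_pos by auto
    hence "G = power_map f * c powi n" using cn by (simp add: x_def field_simps)
    thus "\<exists>f\<in>dpd_coeffs Dp0 Dm0 n. G = power_map f * c powi n" using G sigma_mem_iff by blast
  next
    assume "\<exists>f\<in>dpd_coeffs Dp0 Dm0 n. G = power_map f * c powi n"
    then obtain f where f: "f \<in> dpd_coeffs Dp0 Dm0 n" "G = power_map f * c powi n" by blast
    show "G \<in> A_coeffs n" using f sigma_mem_iff by simp
    have "fract_subst [:0, \<zeta>:] G * to_fract [:\<zeta> ^ e:] powi n =
        power_map f * (fract_subst [:0, \<zeta>:] (c powi n) * to_fract [:\<zeta> ^ e:] powi n)"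
      by (simp add: f(2) unital_hom_mult[OF unital_hom_rot] rotation_sigma mult.assoc)
    thus "fract_subst [:0, \<zeta>:] G * to_fract [:\<zeta> ^ e:] powi n = G" by (simp only: rotation_c f(2))
  qed
qed

definition \<theta> :: "laurent \<Rightarrow> laurent" where
  "\<theta> = twist power_map c"

lemma unital_hom_theta: "unital_hom \<theta>"
  unfolding \<theta>_def by (intro unital_hom_twist unital_hom_sigma c_nonzero)

lemma theta_single: "\<theta> (Poly_Mapping.single n f) = Poly_Mapping.single n (power_map f * c powi n)"
  by (simp add: \<theta>_def twist_single unital_hom_sigma)

lemma theta_inj: "\<theta> F = \<theta> G \<Longrightarrow> F = G"
proof (rule poly_mapping_eqI)
  fix n assume "\<theta> F = \<theta> G"
  hence "Poly_Mapping.lookup (\<theta> F) n = Poly_Mapping.lookup (\<theta> G) n" by simp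
  thus "Poly_Mapping.lookup F n = Poly_Mapping.lookup G n"
    using c_nonzero injD[OF unital_hom_inj[OF unital_hom_sigma]]
    by (simp add: \<theta>_def lookup_twist unital_hom_sigma)
qed

lemma lookup_alpha_eq_iff:
  "\<alpha> G = G \<longleftrightarrow> (\<forall>n. \<alpha> (Poly_Mapping.single n (Poly_Mapping.lookup G n)) =
                       Poly_Mapping.single n (Poly_Mapping.lookup G n))"
  by (simp add: poly_mapping_eq_iff fun_eq_iff lookup_alpha lookup_single when_def)
    (metis unital_hom_zero[OF unital_hom_rotation] mult_zero_left)

lemma theta_image: "\<theta> ` D.laurents = {G \<in> A.laurents. \<alpha> G = G}"
proof (intro equalityI subsetI)
  fix G assume "G \<in> \<theta> ` D.laurents"
  then obtain F where F: "F \<in> D.laurents" "G = \<theta> F" by blast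
  have "Poly_Mapping.lookup G n \<in> A_coeffs n \<and>
      \<alpha> (Poly_Mapping.single n (Poly_Mapping.lookup G n)) = Poly_Mapping.single n (Poly_Mapping.lookup G n)" for n
    unfolding invariant_single_iff using F
    by (auto simp: \<theta>_def lookup_twist unital_hom_sigma D.laurents_def)
  thus "G \<in> {G \<in> A.laurents. \<alpha> G = G}" using lookup_alpha_eq_iff[of G] by (simp add: A.laurents_def)
next
  fix G assume G: "G \<in> {G \<in> A.laurents. \<alpha> G = G}"
  have "\<exists>f\<in>dpd_coeffs Dp0 Dm0 n. Poly_Mapping.lookup G n = power_map f * c powi n" for n
    unfolding invariant_single_iff[symmetric] using G lookup_alpha_eq_iff[of G] by (simp add: A.laurents_def)
  then obtain f where f: "\<And>n. f n \<in> dpd_coeffs Dp0 Dm0 n"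
      "\<And>n. Poly_Mapping.lookup G n = power_map (f n) * c powi n" by metis
  \<comment> \<open>Preimages of the coefficients are chosen degree by degree; summing over the
    support of \<open>G\<close> keeps the result finitely supported.\<close>
  define F where "F = (\<Sum>n\<in>Poly_Mapping.keys G. Poly_Mapping.single n (f n))"
  have "\<theta> F = (\<Sum>n\<in>Poly_Mapping.keys G. Poly_Mapping.single n (Poly_Mapping.lookup G n))"
    by (simp add: F_def unital_hom_sum[OF unital_hom_theta] theta_single f(2))
  also have "\<dots> = G" by (rule sum_single_lookup[symmetric])
  finally have "G = \<theta> F" ..
  moreover have "F \<in> D.laurents" unfolding F_def
    by (intro D.laurents_sum) (simp add: D.single_in_laurents_iff f(1))
  ultimately show "G \<in> \<theta> ` D.laurents" by blast
qed

lemma dpd_algebra_iso_invariants_ring: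
  "graded_algebra_iso (dpd_ring Dp0 Dm0) (dpd_component Dp0 Dm0) dpd_struct
     (inv_ring e \<zeta> k P) (inv_component e \<zeta> k P) (inv_struct d k P)"
proof -
  define \<phi> where "\<phi> F = \<Phi> (\<theta> F)" for F
  have cD: "carrier (dpd_ring Dp0 Dm0) = D.laurents" by (simp add: carrier_dpd_ring D.laurents_def)
  have im: "\<phi> ` D.laurents = carrier (inv_ring e \<zeta> k P)"
    by (simp add: \<phi>_def carrier_inv_ring flip: theta_image image_image[of \<Phi> \<theta>])
  have "\<phi> \<in> ring_iso (dpd_ring Dp0 Dm0) (inv_ring e \<zeta> k P)"
  proof (rule ring_iso_memI)
    show "bij_betw \<phi> (carrier (dpd_ring Dp0 Dm0)) (carrier (inv_ring e \<zeta> k P))"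
      unfolding bij_betw_def cD im
      by (auto simp: inj_on_def \<phi>_def Phi_inj dest: theta_inj)
    show "\<phi> F \<in> carrier (inv_ring e \<zeta> k P)" if "F \<in> carrier (dpd_ring Dp0 Dm0)" for F
      using that unfolding cD by (simp flip: im)
    show "\<phi> (F \<otimes>\<^bsub>dpd_ring Dp0 Dm0\<^esub> G) = \<phi> F \<otimes>\<^bsub>inv_ring e \<zeta> k P\<^esub> \<phi> G"
      "\<phi> (F \<oplus>\<^bsub>dpd_ring Dp0 Dm0\<^esub> G) = \<phi> F \<oplus>\<^bsub>inv_ring e \<zeta> k P\<^esub> \<phi> G" for F G
      unfolding \<phi>_def inv_ring_simps Phi_mult Phi_add
      by (simp_all add: unital_hom_simps[OF unital_hom_theta])
    show "\<phi> \<one>\<^bsub>dpd_ring Dp0 Dm0\<^esub> = \<one>\<^bsub>inv_ring e \<zeta> k P\<^esub>"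
      unfolding \<phi>_def inv_ring_simps Phi_one by (simp add: unital_hom_one[OF unital_hom_theta])
  qed
  moreover have "\<phi> ` dpd_component Dp0 Dm0 n = inv_component e \<zeta> k P n" for n
  proof -
    have "{G \<in> A_coeffs n. \<alpha> (Poly_Mapping.single n G) = Poly_Mapping.single n G} =
        (\<lambda>f. power_map f * c powi n) ` dpd_coeffs Dp0 Dm0 n"
      using invariant_single_iff by blast
    thus ?thesis
      by (simp add: inv_component_eq dpd_component_def image_image \<phi>_def theta_single)
  qed
  moreover have "\<phi> (dpd_struct f) = inv_struct d k P f" for f
    by (simp add: \<phi>_def dpd_struct_def theta_single inv_struct_eq power_map_def fract_subst_to_fract subst_power_def)
  ultimately show ?thesis unfolding graded_algebra_iso_def by blast
qed

text \<open>Composition with the inverse of the standard isomorphism compares the given divisors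
  with \<open>Dp0\<close> and \<open>Dm0\<close>, for which both invariants are explicit.\<close>

lemma invariants_of_iso:
  assumes D: "\<forall>a. Poly_Mapping.lookup Dp a + Poly_Mapping.lookup Dm a \<le> 0"
    and iso: "dpd_iso_invariants Dp Dm d e \<zeta> k P"
  shows "Poly_Mapping.lookup Dp a + Poly_Mapping.lookup Dm a =
      Poly_Mapping.lookup Dp0 a + Poly_Mapping.lookup Dm0 a"
    and "frac (Poly_Mapping.lookup Dp a) = frac (Poly_Mapping.lookup Dp0 a)"
proof -
  have "graded_algebra_iso (inv_ring e \<zeta> k P) (inv_component e \<zeta> k P) (inv_struct d k P)
      (dpd_ring Dp0 Dm0) (dpd_component Dp0 Dm0) dpd_struct"
    by (rule graded_algebra_iso_sym[OF ring_dpd_ring[OF D0_le] dpd_component_subset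
          dpd_struct_in_carrier dpd_algebra_iso_invariants_ring])
  from graded_algebra_iso_trans[OF iso[unfolded dpd_iso_invariants_def] this]
  have "graded_algebra_iso (dpd_ring Dp Dm) (dpd_component Dp Dm) dpd_struct
      (dpd_ring Dp0 Dm0) (dpd_component Dp0 Dm0) dpd_struct" .
  from dpd_algebra_iso_invariants[OF D D0_le this, of a]
  show "Poly_Mapping.lookup Dp a + Poly_Mapping.lookup Dm a =
      Poly_Mapping.lookup Dp0 a + Poly_Mapping.lookup Dm0 a"
    and "frac (Poly_Mapping.lookup Dp a) = frac (Poly_Mapping.lookup Dp0 a)" by simp_all
qed

end

section \<open>The equivalence\<close>

lemma divisor_denominator:
  fixes D :: q_divisor
  shows "\<exists>k\<ge>1. \<forall>a. of_nat k * Poly_Mapping.lookup D a \<in> \<int>"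
proof (induction D rule: poly_mapping_single_add_induct)
  case (single b x)
  obtain k where "k > 0" "of_nat k * x \<in> \<int>" using common_denominator by blast
  thus ?case by (intro exI[of _ k]) (auto simp: lookup_single when_def)
next
  case (add F G)
  then obtain k l where kl: "k \<ge> 1" "\<And>a. of_nat k * Poly_Mapping.lookup F a \<in> \<int>"
    "l \<ge> 1" "\<And>a. of_nat l * Poly_Mapping.lookup G a \<in> \<int>" by blast
  have "of_nat (k * l) * Poly_Mapping.lookup (F + G) a \<in> \<int>" for a
  proof -
    have "of_nat (k * l) * Poly_Mapping.lookup (F + G) a =
        of_nat l * (of_nat k * Poly_Mapping.lookup F a) + of_nat k * (of_nat l * Poly_Mapping.lookup G a)"
      by (simp add: lookup_add algebra_simps)
    also have "\<dots> \<in> \<int>" by (intro Ints_add Ints_mult[OF Ints_of_nat] kl)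
    finally show ?thesis .
  qed
  thus ?case using kl by (intro exI[of _ "k * l"]) auto
qed

lemma lookup_div_frac: "Poly_Mapping.lookup (div_frac D) a = frac (Poly_Mapping.lookup D a)"
  by (simp add: div_frac_def div_floor_def lookup_minus lookup_map_zero frac_def)

text \<open>A shift by the floor of -D_+ reduces D_+ to -e/d [0], and the shifted D_- dictates Q.
  The inequality D_+ + D_- <= 0 makes P a polynomial. The last clause serves the case of a
  polynomial Q.\<close>

lemma laurent_presentation:
  assumes D: "\<forall>a. Poly_Mapping.lookup Dp a + Poly_Mapping.lookup Dm a \<le> 0"
    and d: "1 \<le> d" and root: "primitive_root_of_unity d \<zeta>"
    and frac: "div_frac (- Dp) = Poly_Mapping.single 0 (of_nat e / of_nat d)"
  obtains k q m P where "1 \<le> k" "lead_coeff q = 1" "P_of_laurent d e k q m P"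
    "dpd_iso_invariants Dp Dm d e \<zeta> k P"
    "Poly_Mapping.lookup Dp 0 + Poly_Mapping.lookup Dm 0 \<le> - (of_nat e / of_nat d) \<longrightarrow> m = 0"
proof -
  let ?p = "Poly_Mapping.lookup Dp" and ?m = "Poly_Mapping.lookup Dm"
  define E where "E = div_floor (- Dp)"
  have E: "Poly_Mapping.lookup E a = \<lfloor>- ?p a\<rfloor>" for a by (simp add: E_def div_floor_def lookup_map_zero)
  have fr: "- ?p a - of_int \<lfloor>- ?p a\<rfloor> = (if a = 0 then of_nat e / of_nat d else 0)" for a
    using arg_cong[OF frac, of "\<lambda>D. Poly_Mapping.lookup D a"]
    by (auto simp: lookup_div_frac frac_def lookup_single when_def)
  obtain h where h: "h \<noteq> 0" "\<And>a. ord_at a h = \<lfloor>- ?p a\<rfloor>" using function_with_divisor[of E] E by auto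
  define Dm' :: q_divisor where "Dm' = Dm - Poly_Mapping.map of_int E"
  have Dm': "Poly_Mapping.lookup Dm' a = ?m a - of_int \<lfloor>- ?p a\<rfloor>" for a
    by (simp add: Dm'_def lookup_minus lookup_map_zero E)
  \<comment> \<open>The shift preserves D_+ + D_-, so the new D_- is this sum plus e/d at 0. Away
    from 0 it is at most 0, and Q can have a pole only at 0.\<close>
  have Dm'': "Poly_Mapping.lookup Dm' a = ?p a + ?m a + (if a = 0 then of_nat e / of_nat d else 0)" for a
    using fr[of a] by (simp add: Dm')
  obtain k where k: "1 \<le> k" "\<And>a. of_nat k * Poly_Mapping.lookup Dm' a \<in> \<int>"
    using divisor_denominator by blast
  define E2 where "E2 = div_floor (div_scale k (- Dm'))"
  have "of_int (Poly_Mapping.lookup E2 a) = - (of_nat k * Poly_Mapping.lookup Dm' a)" for a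
  proof -
    have "- (of_nat k * Poly_Mapping.lookup Dm' a) \<in> \<int>" using k(2) by simp
    thus ?thesis by (auto simp: E2_def div_floor_def div_scale_def lookup_map_zero elim!: Ints_cases)
  qed
  then obtain Q0 where Q0: "Q0 \<noteq> 0" "\<And>a. of_int (ord_at a Q0) = - (of_nat k * Poly_Mapping.lookup Dm' a)"
    using function_with_divisor[of E2] by auto
  have Dm_Q0: "Poly_Mapping.lookup Dm' a = - of_int (ord_at a Q0) / of_nat k" for a
    using k(1) by (simp add: Q0(2))
  have Q0_le: "of_nat k * (?p a + ?m a) \<le> 0" for a
    using D by (intro mult_nonneg_nonpos) auto
  \<comment> \<open>The order of the pole of \<open>Q0\<close> at 0, or 0 if there is none.\<close>
  define m where "m = nat (- ord_at 0 Q0)"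
  define t where "t = (to_fract (Polynomial.monom 1 m) :: complex poly fract)"
  have t: "t \<noteq> 0" "ord_at a t = (if a = 0 then int m else 0)" for a
    by (auto simp: t_def ord_at_to_fract intro: order_0I simp: poly_monom)
  have "0 \<le> ord_at a (Q0 * t)" for a
  proof (cases "a = 0")
    case True
    thus ?thesis using Q0(1) t by (simp add: ord_at_mult m_def)
  next
    case False
    have "(0 :: rat) \<le> of_int (ord_at a Q0)" using Q0_le[of a] False by (simp add: Q0(2) Dm'')
    hence "0 \<le> ord_at a Q0" by (simp only: of_int_0_le_iff)
    thus ?thesis using Q0(1) t by (simp add: ord_at_mult)
  qed
  then obtain q0 where q0: "Q0 * t = to_fract q0" using polynomial_if_ord_at_nonneg by blast
  have "q0 \<noteq> 0" using q0 Q0(1) t(1) by auto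
  \<comment> \<open>Making \<open>q\<close> monic changes Q by a constant factor, which does not
    affect its divisor.\<close>
  define q where "q = smult (inverse (lead_coeff q0)) q0"
  have q: "lead_coeff q = 1" "q \<noteq> 0" using \<open>q0 \<noteq> 0\<close> by (simp_all add: q_def)
  have ord_q: "ord_at a (to_fract q / t) = ord_at a Q0" for a
  proof -
    have "ord_at a (to_fract q) = ord_at a (Q0 * t)"
      using \<open>q0 \<noteq> 0\<close> by (simp add: q0 q_def ord_at_to_fract order_smult)
    thus ?thesis using q(2) t(1) Q0(1) by (simp add: ord_at_divide ord_at_mult)
  qed
  define R where "R = fract_subst (Polynomial.monom 1 d) (to_fract q / t) * to_fract (Polynomial.monom 1 (k * e))"
  have hom: "unital_hom (fract_subst (Polynomial.monom 1 d))"
    using d by (intro unital_hom_fract_subst degree_monom_pos) simp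
  have "0 \<le> ord_at a R" for a
  proof -
    have nz: "fract_subst (Polynomial.monom 1 d) (to_fract q / t) \<noteq> 0"
      using q(2) t(1) by (simp add: unital_hom_eq_0_iff[OF hom])
    have "ord_at a R = (if a = 0 then int d * ord_at 0 Q0 + int (k * e) else ord_at (a ^ d) Q0)"
      unfolding R_def using nz q(2) t(1) d
      by (subst ord_at_mult) (auto simp: ord_at_fract_subst_monom ord_q ord_at_to_fract poly_monom
          intro!: order_0I)
    \<comment> \<open>The term e/d in the shifted divisor cancels k e, which leaves -d k times the
      value of D_+ + D_- at 0.\<close>
    moreover have "(0 :: rat) \<le> of_int (int d * ord_at 0 Q0 + int (k * e))"
    proof -
      have "of_nat d * (of_nat k * (?p 0 + ?m 0)) \<le> 0"
        by (rule mult_nonneg_nonpos[OF of_nat_0_le_iff Q0_le])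
      thus ?thesis using d by (simp add: Q0(2) Dm'' distrib_left right_diff_distrib)
    qed
    moreover have "(0 :: rat) \<le> of_int (ord_at (a ^ d) Q0)" if "a \<noteq> 0"
      using Q0_le[of "a ^ d"] that by (simp add: Q0(2) Dm'')
    ultimately show ?thesis unfolding of_int_0_le_iff by auto
  qed
  then obtain P where P: "R = to_fract P" using polynomial_if_ord_at_nonneg by blast
  have P_eq: "P_of_laurent d e k q m P"
  proof -
    have nz: "fract_subst (Polynomial.monom 1 d) t \<noteq> 0"
      using t(1) by (simp add: unital_hom_eq_0_iff[OF hom])
    have "R * fract_subst (Polynomial.monom 1 d) t =
        fract_subst (Polynomial.monom 1 d) (to_fract q) * to_fract (Polynomial.monom 1 (k * e))"
      using nz by (simp add: R_def unital_hom_divide[OF hom])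
    thus ?thesis
      unfolding P t_def fract_subst_to_fract subst_power_def[symmetric] P_of_laurent_def
      by (simp only: to_fract_eq_iff flip: to_fract_mult)
  qed
  interpret C: cyclic_quotient d e k m \<zeta> q P
    by unfold_locales (use d root k q P_eq in auto)
  have "graded_algebra_iso (dpd_ring Dp Dm) (dpd_component Dp Dm) dpd_struct
      (dpd_ring C.Dp0 C.Dm0) (dpd_component C.Dp0 C.Dm0) dpd_struct"
  proof (rule dpd_algebra_iso_shift[OF h(1)])
    show "Poly_Mapping.lookup C.Dp0 a = ?p a + of_int (ord_at a h)" for a
      using fr[of a] by (auto simp: C.lookup_Dp0 h(2))
    have "C.Q = to_fract q / t" by (simp add: C.Q_def t_def)
    thus "Poly_Mapping.lookup C.Dm0 a = ?m a - of_int (ord_at a h)" for a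
      by (simp only: C.lookup_Dm0 h(2) ord_q Dm'[symmetric] Dm_Q0)
  qed
  hence "dpd_iso_invariants Dp Dm d e \<zeta> k P"
    unfolding dpd_iso_invariants_def
    by (rule graded_algebra_iso_trans[OF _ C.dpd_algebra_iso_invariants_ring])
  moreover have "m = 0" if "?p 0 + ?m 0 \<le> - (of_nat e / of_nat d)"
  proof -
    have "of_nat k * Poly_Mapping.lookup Dm' 0 \<le> 0"
      using that by (intro mult_nonneg_nonpos) (auto simp: Dm'')
    hence "(0 :: rat) \<le> of_int (ord_at 0 Q0)" by (simp add: Q0(2))
    hence "0 \<le> ord_at 0 Q0" by (simp only: of_int_0_le_iff)
    thus ?thesis by (simp add: m_def)
  qed
  ultimately show ?thesis using that k(1) q(1) P_eq by blast
qed

text \<open>The invariant is the fractional part of D_+, while the condition concerns -D_+. Negation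
  turns a fractional part r into 1 - r, except that 0 stays 0.\<close>

lemma frac_of_neg_cong:
  fixes x y :: "'a :: floor_ceiling"
  assumes "frac x = frac y"
  shows "frac (- x) = frac (- y)"
proof -
  have "x \<in> \<int> \<longleftrightarrow> y \<in> \<int>" using assms by (simp flip: frac_eq_0_iff)
  thus ?thesis using assms by (simp add: frac_neg)
qed

lemma (in cyclic_quotient) div_frac_of_iso:
  assumes "\<forall>a. Poly_Mapping.lookup Dp a + Poly_Mapping.lookup Dm a \<le> 0"
    and "dpd_iso_invariants Dp Dm d e \<zeta> k P" and "e < d"
  shows "div_frac (- Dp) = Poly_Mapping.single 0 (of_nat e / of_nat d)"
proof (rule poly_mapping_eqI)
  fix a
  \<comment> \<open>The bound \<open>e < d\<close> enters here: the invariants recover e/d only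
    modulo integers.\<close>
  have "frac (of_nat e / of_nat d :: rat) = of_nat e / of_nat d"
    using assms(3) by (simp add: frac_eq)
  thus "Poly_Mapping.lookup (div_frac (- Dp)) a = Poly_Mapping.lookup (Poly_Mapping.single 0 (of_nat e / of_nat d)) a"
    using frac_of_neg_cong[OF invariants_of_iso(2)[OF assms(1,2), of a]]
    by (auto simp: lookup_div_frac lookup_Dp0 lookup_single when_def)
qed

text \<open>In every presentation -ord_0(Q)/k equals the value of D_+ + D_- at 0 plus e/d, since the
  sum of the divisors is an invariant. A polynomial Q is therefore possible exactly if this number
  is at most 0, which is the second equivalence.\<close>

theorem proposition4p14:
  fixes Dp Dm :: q_divisor and d e :: nat and \<zeta> :: complex
  assumes "\<forall>a. Poly_Mapping.lookup Dp a + Poly_Mapping.lookup Dm a \<le> 0"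
    and "1 \<le> d" and "e < d" and "coprime e d"
    and "primitive_root_of_unity d \<zeta>"
  shows "(div_frac (- Dp) = Poly_Mapping.single 0 (of_nat e / of_nat d)
      \<longleftrightarrow> (\<exists>k q m P. 1 \<le> k \<and> lead_coeff q = 1 \<and> P_of_laurent d e k q m P \<and>
            dpd_iso_invariants Dp Dm d e \<zeta> k P))
    \<and> ((\<exists>k Q. 1 \<le> k \<and> lead_coeff Q = 1 \<and>
            dpd_iso_invariants Dp Dm d e \<zeta> k (subst_power d Q * Polynomial.monom 1 (k * e)))
      \<longleftrightarrow> div_frac (- Dp) = Poly_Mapping.single 0 (of_nat e / of_nat d) \<and>
          Poly_Mapping.lookup Dp 0 + Poly_Mapping.lookup Dm 0 \<le> - (of_nat e / of_nat d))"
proof -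
  \<comment> \<open>A polynomial Q is the case \<open>m = 0\<close> of the Laurent form, with
    \<open>P\<close> then determined by \<open>q\<close>.\<close>
  have laurent_zero: "P_of_laurent d e k q 0 P \<longleftrightarrow> P = subst_power d q * Polynomial.monom 1 (k * e)" for k q P
    by (simp add: P_of_laurent_def subst_power_def monom_0 pcompose_1 flip: one_pCons)
  have quotient: "cyclic_quotient d e k m \<zeta> q P"
    if "1 \<le> k" "lead_coeff q = 1" "P_of_laurent d e k q m P" for k q m P
    using that assms by (simp add: cyclic_quotient_def)
  show ?thesis
  proof (intro conjI iffI; (elim exE conjE)?)
    assume "div_frac (- Dp) = Poly_Mapping.single 0 (of_nat e / of_nat d)"
    then obtain k q m P where "1 \<le> k" "lead_coeff q = 1" "P_of_laurent d e k q m P"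
      "dpd_iso_invariants Dp Dm d e \<zeta> k P"
      by (rule laurent_presentation[OF assms(1,2,5)])
    thus "\<exists>k q m P. 1 \<le> k \<and> lead_coeff q = 1 \<and> P_of_laurent d e k q m P \<and>
        dpd_iso_invariants Dp Dm d e \<zeta> k P" by (intro exI conjI)
  next
    fix k q m P
    assume *: "1 \<le> k" "lead_coeff q = 1" "P_of_laurent d e k q m P" "dpd_iso_invariants Dp Dm d e \<zeta> k P"
    show "div_frac (- Dp) = Poly_Mapping.single 0 (of_nat e / of_nat d)"
      by (rule cyclic_quotient.div_frac_of_iso[OF quotient[OF *(1-3)] assms(1) *(4) assms(3)])
  next
    fix k Q
    assume *: "1 \<le> k" "lead_coeff Q = 1"
      and iso: "dpd_iso_invariants Dp Dm d e \<zeta> k (subst_power d Q * Polynomial.monom 1 (k * e))"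
    interpret C: cyclic_quotient d e k 0 \<zeta> Q "subst_power d Q * Polynomial.monom 1 (k * e)"
      by (rule quotient[OF *]) (simp add: laurent_zero)
    show "div_frac (- Dp) = Poly_Mapping.single 0 (of_nat e / of_nat d)"
      by (rule C.div_frac_of_iso[OF assms(1) iso assms(3)])
    \<comment> \<open>A polynomial Q has no pole at 0, so the coefficient of \<open>C.Dm0\<close>
      there is at most 0.\<close>
    have "0 \<le> ord_at 0 C.Q" by (simp add: C.Q_def monom_0 ord_at_to_fract flip: one_pCons)
    hence "(0 :: rat) \<le> of_int (ord_at 0 C.Q) / of_nat k" by simp
    thus "Poly_Mapping.lookup Dp 0 + Poly_Mapping.lookup Dm 0 \<le> - (of_nat e / of_nat d)"
      by (simp add: C.invariants_of_iso(1)[OF assms(1) iso] C.lookup_Dp0 C.lookup_Dm0)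
  next
    assume *: "div_frac (- Dp) = Poly_Mapping.single 0 (of_nat e / of_nat d)"
      "Poly_Mapping.lookup Dp 0 + Poly_Mapping.lookup Dm 0 \<le> - (of_nat e / of_nat d)"
    obtain k q m P where kqmP: "1 \<le> k" "lead_coeff q = 1" "P_of_laurent d e k q m P"
      "dpd_iso_invariants Dp Dm d e \<zeta> k P" and m: "Poly_Mapping.lookup Dp 0 + Poly_Mapping.lookup Dm 0 \<le> - (of_nat e / of_nat d) \<longrightarrow> m = 0"
      by (rule laurent_presentation[OF assms(1,2,5) *(1)])
    have "P = subst_power d q * Polynomial.monom 1 (k * e)"
      using kqmP(3) unfolding m[rule_format, OF *(2)] laurent_zero .
    thus "\<exists>k Q. 1 \<le> k \<and> lead_coeff Q = 1 \<and>
        dpd_iso_invariants Dp Dm d e \<zeta> k (subst_power d Q * Polynomial.monom 1 (k * e))"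
      using kqmP by (intro exI[of _ k] exI[of _ q] conjI) simp_all
  qed
qed

end
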